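(* Let $\mathcal{X},\mathcal{Y},\mathcal{Z},\hat{\mathcal{X}}$ be finite sets, $P_{X,Y,Z}$ a probability distribution on $\mathcal{X}\times\mathcal{Y}\times\mathcal{Z}$, $F:\mathcal{X}\times\mathcal{Y}\to\mathcal{F}$ a function, and $d:\mathcal{F}\times\hat{\mathcal{X}}\to[0,\infty)$ a distortion measure. Let $\mathcal{R}_{\text{eve}}$ be the rate-distortion-equivocation region, defined in the context, for end-user privacy at an eavesdropper (observing $W$ and $Z^n$) with causal reconstruction, i.e. $\hat{X}_i\sim p(\hat{x}_i|w,y^i,\hat{x}^{i-1})$ for $i=1,\dots,n$. Let $\mathcal{R}_{\text{in}}^{(\text{eve,causal})}$ be the set of all $(R,D,\triangle)\in\mathbb{R}_+^3$ such that $$R\ge I(X;U),\qquad D\ge E[d(F(X,Y),\hat{X})],\qquad \triangle\le H(\hat{X}|U,Z),$$ for some random variables $(X,Y,Z,U,\hat{X})$, with $U\in\mathcal{U}$, $\hat{X}\in\hat{\mathcal{X}}$, whose joint distribution has the form $P_{X,Y,Z}(x,y,z)P_{U|X}(u|x)P_{\hat{X}|U,Y}(\hat{x}|u,y)$ with $|\mathcal{U}|\le|\mathcal{X}|+3$. Let $\mathcal{R}_{\text{out}}^{(\text{eve,causal})}$ be the set of all $(R,D,\triangle)\in\mathbb{R}_+^3$ such that $$R\ge I(X;U),\qquad D\ge E[d(F(X,Y),\hat{X})],\qquad \triangle\le H(\hat{X}|T,Z),$$ for some random variables $(X,Y,Z,U,T,\hat{X})$, with $U,T$ taking values in some finite sets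 and $\hat{X}\in\hat{\mathcal{X}}$, whose joint distribution has the form $P_{X,Y,Z}(x,y,z)P_{U|X}(u|x)P_{T|U}(t|u)P_{\hat{X}|U,Y}(\hat{x}|u,y)$ and satisfies $H(T|U)=0$. Then $$\mathcal{R}_{\text{in}}^{(\text{eve,causal})}\subseteq\mathcal{R}_{\text{eve}}\subseteq\mathcal{R}_{\text{out}}^{(\text{eve,causal})}.$$
   Context: $(X^n,Y^n,Z^n)$ denotes $n$-length sequences with $(X_i,Y_i,Z_i)$, $i=1,\dots,n$, i.i.d. according to $P_{X,Y,Z}$. The function $F^{(n)}(X^n,Y^n)$ is component-wise: its $i$-th component is $F(X_i,Y_i)$. The distortion is $d^{(n)}(F^{(n)}(X^n,Y^n),\hat{X}^n)=\frac1n\sum_{i=1}^n d(F(X_i,Y_i),\hat{X}_i)$. Notation: $y^i=(y_1,\dots,y_i)$. A $(|\mathcal{W}^{(n)}|,n)$-code with causal reconstruction consists of a finite set $\mathcal{W}^{(n)}$, a deterministic encoder $f^{(n)}:\mathcal{X}^n\to\mathcal{W}^{(n)}$, and a stochastic decoder that generates $\hat{X}^n\in\hat{\mathcal{X}}^n$ sequentially: for each $i=1,\dots,n$, $\hat{X}_i$ is drawn according to a conditional distribution $p(\hat{x}_i|w,y^i,\hat{x}^{i-1})$ (which may depend on $i$), where $W=f^{(n)}(X^n)$; that is, given $(W,Y^n)=(w,y^n)$, $\hat{X}^n$ has distribution $\prod_{i=1}^n p(\hat{x}_i|w,y^i,\hat{x}^{i-1})$ and is conditionally independent of $(X^n,Z^n)$.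 A tuple $(R,D,\triangle)\in\mathbb{R}_+^3$ is achievable if for any $\delta>0$ and all sufficiently large $n$ there exists such a code with $\frac1n\log|\mathcal{W}^{(n)}|\le R+\delta$, $E[d^{(n)}(F^{(n)}(X^n,Y^n),\hat{X}^n)]\le D+\delta$, and $\frac1n H(\hat{X}^n|W,Z^n)\ge\triangle-\delta$. The region $\mathcal{R}_{\text{eve}}$ is the set of all achievable tuples. $H$ and $I$ denote Shannon entropy and mutual information (with the same logarithm base throughout), and $\mathbb{R}_+=[0,\infty)$. *)

theory Defs
  imports "HOL-Probability.Probability"
begin

text \<open>Source symbols are triples \<open>(x, y, z)\<close>; the alphabets are types of class \<open>finite\<close>.
  Auxiliary variables and message sets are not tied to a given type and range over finite
  subsets of \<open>nat\<close>. \<open>b\<close> is the common base of all logarithms.\<close>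

text \<open>All variables used below live on countable types, so the counting measure on the whole
  type serves as the reference measure.\<close>

definition cond_entropy_pmf :: "real \<Rightarrow> 'a pmf \<Rightarrow> ('a \<Rightarrow> 'b) \<Rightarrow> ('a \<Rightarrow> 'c) \<Rightarrow> real" where
  "cond_entropy_pmf b p X Y =
     prob_space.conditional_entropy (measure_pmf p) b (count_space UNIV) (count_space UNIV) X Y"

definition mutual_info_pmf :: "real \<Rightarrow> 'a pmf \<Rightarrow> ('a \<Rightarrow> 'b) \<Rightarrow> ('a \<Rightarrow> 'c) \<Rightarrow> real" where
  "mutual_info_pmf b p X Y =
     prob_space.mutual_information (measure_pmf p) b (count_space UNIV) (count_space UNIV) X Y"

text \<open>On finitely supported distributions these are the usual finite sums.\<close>

lemma distributed_pmf:
  "distributed (measure_pmf p) (count_space UNIV) X (\<lambda>x. ennreal (pmf (map_pmf X p) x))"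
  unfolding distributed_def
  by (auto simp: measure_pmf_eq_density[symmetric] map_pmf_rep_eq[symmetric])

lemma sigma_finite_count_space_countable: "sigma_finite_measure (count_space (UNIV :: 'b::countable set))"
  by (rule sigma_finite_measure_count_space_countable) auto

lemma pair_count_space_countable:
  "count_space (UNIV :: 'b::countable set) \<Otimes>\<^sub>M count_space (UNIV :: 'c::countable set) = count_space UNIV"
  by (simp add: pair_measure_countable)

lemma integral_count_space_pmf:
  fixes g :: "'a \<Rightarrow> real"
  assumes "finite (set_pmf Q)"
  shows "(\<integral>z. pmf Q z * g z \<partial>count_space UNIV) = (\<Sum>z\<in>set_pmf Q. pmf Q z * g z)"
proof -
  have sub: "{z. pmf Q z * g z \<noteq> 0} \<subseteq> set_pmf Q" by (auto simp: set_pmf_iff)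
  then have "finite {z. pmf Q z * g z \<noteq> 0}" by (rule finite_subset) (rule assms)
  then have "(\<integral>z. pmf Q z * g z \<partial>count_space UNIV) = (\<Sum>z | pmf Q z * g z \<noteq> 0. pmf Q z * g z)"
    by (subst lebesgue_integral_count_space_finite_support) simp_all
  also have "\<dots> = (\<Sum>z\<in>set_pmf Q. pmf Q z * g z)"
    by (rule sum.mono_neutral_left[OF assms sub]) auto
  finally show ?thesis .
qed

lemma cond_entropy_pmf_sum:
  fixes X :: "'a \<Rightarrow> 'b::countable" and Y :: "'a \<Rightarrow> 'c::countable"
  assumes "1 < b" and fin: "finite (set_pmf p)"
  shows "cond_entropy_pmf b p X Y =
    - (\<Sum>(x, y)\<in>set_pmf (map_pmf (\<lambda>a. (X a, Y a)) p).
         pmf (map_pmf (\<lambda>a. (X a, Y a)) p) (x, y) *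
         log b (pmf (map_pmf (\<lambda>a. (X a, Y a)) p) (x, y) / pmf (map_pmf Y p) y))"
proof -
  interpret information_space "measure_pmf p" b
    by unfold_locales (rule assms)
  have fm: "finite (set_pmf (map_pmf (\<lambda>a. (X a, Y a)) p))" using fin by simp
  have "cond_entropy_pmf b p X Y = - (\<integral>(x, y). pmf (map_pmf (\<lambda>a. (X a, Y a)) p) (x, y) * log b (pmf (map_pmf (\<lambda>a. (X a, Y a)) p) (x, y) / pmf (map_pmf Y p) y)
      \<partial>(count_space UNIV \<Otimes>\<^sub>M count_space UNIV))"
    unfolding cond_entropy_pmf_def
    by (rule conditional_entropy_generic_eq[OF sigma_finite_count_space_countable sigma_finite_count_space_countable distributed_pmf])
       (auto simp: pair_count_space_countable distributed_pmf)
  then show ?thesis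
    using integral_count_space_pmf[of "map_pmf (\<lambda>a. (X a, Y a)) p"] fm
    by (simp add: pair_count_space_countable case_prod_unfold del: set_map_pmf)
qed

lemma mutual_info_pmf_sum:
  fixes X :: "'a \<Rightarrow> 'b::countable" and Y :: "'a \<Rightarrow> 'c::countable"
  assumes "1 < b" and fin: "finite (set_pmf p)"
  shows "mutual_info_pmf b p X Y =
    (\<Sum>(x, y)\<in>set_pmf (map_pmf (\<lambda>a. (X a, Y a)) p).
         pmf (map_pmf (\<lambda>a. (X a, Y a)) p) (x, y) *
         log b (pmf (map_pmf (\<lambda>a. (X a, Y a)) p) (x, y) / (pmf (map_pmf X p) x * pmf (map_pmf Y p) y)))"
proof -
  interpret information_space "measure_pmf p" b
    by unfold_locales (rule assms)
  have fm: "finite (set_pmf (map_pmf (\<lambda>a. (X a, Y a)) p))" using fin by simp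
  let ?f = "\<lambda>x. pmf (map_pmf (\<lambda>a. (X a, Y a)) p) x * log b (pmf (map_pmf (\<lambda>a. (X a, Y a)) p) x / (pmf (map_pmf X p) (fst x) * pmf (map_pmf Y p) (snd x)))"
  have "mutual_info_pmf b p X Y = integral\<^sup>L (count_space UNIV \<Otimes>\<^sub>M count_space UNIV) ?f"
    unfolding mutual_info_pmf_def
    by (rule mutual_information_distr[OF sigma_finite_count_space_countable sigma_finite_count_space_countable distributed_pmf _ distributed_pmf])
       (auto simp: pair_count_space_countable distributed_pmf)
  then show ?thesis
    using integral_count_space_pmf[of "map_pmf (\<lambda>a. (X a, Y a)) p"] fm
    by (simp add: pair_count_space_countable case_prod_unfold del: set_map_pmf)
qed

text \<open>The decoder kernel \<open>q i w ys xhs\<close> is \<open>p(\<cdot> | w, y\<^sup>i, xh\<^sup>i\<^sup>-\<^sup>1)\<close>, \<open>i \<ge> 1\<close>;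
  \<open>causal_decoder q w ys i\<close> is the law of the first \<open>i\<close> reconstruction symbols.\<close>

primrec causal_decoder ::
  "(nat \<Rightarrow> nat \<Rightarrow> 'y list \<Rightarrow> 'xh list \<Rightarrow> 'xh pmf) \<Rightarrow> nat \<Rightarrow> 'y list \<Rightarrow> nat \<Rightarrow> 'xh list pmf" where
  "causal_decoder q w ys 0 = return_pmf []"
| "causal_decoder q w ys (Suc i) = do {
     xhs \<leftarrow> causal_decoder q w ys i;
     xh \<leftarrow> q (Suc i) w (take (Suc i) ys) xhs;
     return_pmf (xhs @ [xh])}"

definition code_joint ::
  "('x \<times> 'y \<times> 'z) pmf \<Rightarrow> nat \<Rightarrow> ('x list \<Rightarrow> nat) \<Rightarrow>
   (nat \<Rightarrow> nat \<Rightarrow> 'y list \<Rightarrow> 'xh list \<Rightarrow> 'xh pmf) \<Rightarrow>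
   ('x list \<times> 'y list \<times> 'z list \<times> nat \<times> 'xh list) pmf" where
  "code_joint P n f q = do {
     s \<leftarrow> replicate_pmf n P;
     let xs = map fst s;
     let ys = map (fst \<circ> snd) s;
     let zs = map (snd \<circ> snd) s;
     let w = f xs;
     xhs \<leftarrow> causal_decoder q w ys n;
     return_pmf (xs, ys, zs, w, xhs)}"

definition avg_distortion ::
  "('x \<Rightarrow> 'y \<Rightarrow> 'f) \<Rightarrow> ('f \<Rightarrow> 'xh \<Rightarrow> real) \<Rightarrow> nat \<Rightarrow> 'x list \<Rightarrow> 'y list \<Rightarrow> 'xh list \<Rightarrow> real" where
  "avg_distortion F d n xs ys xhs = (1 / real n) * (\<Sum>i<n. d (F (xs ! i) (ys ! i)) (xhs ! i))"

definition achievable_eve ::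
  "real \<Rightarrow> ('x \<times> 'y \<times> 'z) pmf \<Rightarrow> ('x \<Rightarrow> 'y \<Rightarrow> 'f) \<Rightarrow> ('f \<Rightarrow> 'xh \<Rightarrow> real) \<Rightarrow>
   real \<Rightarrow> real \<Rightarrow> real \<Rightarrow> bool" where
  "achievable_eve b P F d R D \<Delta> \<longleftrightarrow>
     (\<forall>\<delta>>0. \<forall>\<^sub>F n in sequentially.
        \<exists>(W :: nat set) (f :: 'x list \<Rightarrow> nat)
          (q :: nat \<Rightarrow> nat \<Rightarrow> 'y list \<Rightarrow> 'xh list \<Rightarrow> 'xh pmf).
          finite W \<and> (\<forall>xs. length xs = n \<longrightarrow> f xs \<in> W) \<and>
          (1 / real n) * log b (real (card W)) \<le> R + \<delta> \<and>
          measure_pmf.expectation (code_joint P n f q)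
            (\<lambda>(xs, ys, zs, w, xhs). avg_distortion F d n xs ys xhs) \<le> D + \<delta> \<and>
          (1 / real n) * cond_entropy_pmf b (code_joint P n f q)
            (\<lambda>(xs, ys, zs, w, xhs). xhs) (\<lambda>(xs, ys, zs, w, xhs). (w, zs)) \<ge> \<Delta> - \<delta>)"

definition region_eve ::
  "real \<Rightarrow> ('x \<times> 'y \<times> 'z) pmf \<Rightarrow> ('x \<Rightarrow> 'y \<Rightarrow> 'f) \<Rightarrow> ('f \<Rightarrow> 'xh \<Rightarrow> real) \<Rightarrow>
   (real \<times> real \<times> real) set" where
  "region_eve b P F d =
     {(R, D, \<Delta>). 0 \<le> R \<and> 0 \<le> D \<and> 0 \<le> \<Delta> \<and> achievable_eve b P F d R D \<Delta>}"

definition joint_in ::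
  "('x \<times> 'y \<times> 'z) pmf \<Rightarrow> ('x \<Rightarrow> nat pmf) \<Rightarrow> (nat \<Rightarrow> 'y \<Rightarrow> 'xh pmf) \<Rightarrow>
   ('x \<times> 'y \<times> 'z \<times> nat \<times> 'xh) pmf" where
  "joint_in P PU PXh = do {
     (x, y, z) \<leftarrow> P;
     u \<leftarrow> PU x;
     xh \<leftarrow> PXh u y;
     return_pmf (x, y, z, u, xh)}"

definition region_in ::
  "real \<Rightarrow> ('x::finite \<times> 'y \<times> 'z) pmf \<Rightarrow> ('x \<Rightarrow> 'y \<Rightarrow> 'f) \<Rightarrow> ('f \<Rightarrow> 'xh \<Rightarrow> real) \<Rightarrow>
   (real \<times> real \<times> real) set" where
  "region_in b P F d =
     {(R, D, \<Delta>). 0 \<le> R \<and> 0 \<le> D \<and> 0 \<le> \<Delta> \<and>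
        (\<exists>(\<U> :: nat set) (PU :: 'x \<Rightarrow> nat pmf) (PXh :: nat \<Rightarrow> 'y \<Rightarrow> 'xh pmf).
           finite \<U> \<and> card \<U> \<le> CARD('x) + 3 \<and> (\<forall>x. set_pmf (PU x) \<subseteq> \<U>) \<and>
           R \<ge> mutual_info_pmf b (joint_in P PU PXh)
                 (\<lambda>(x, y, z, u, xh). x) (\<lambda>(x, y, z, u, xh). u) \<and>
           D \<ge> measure_pmf.expectation (joint_in P PU PXh)
                 (\<lambda>(x, y, z, u, xh). d (F x y) xh) \<and>
           \<Delta> \<le> cond_entropy_pmf b (joint_in P PU PXh)
                 (\<lambda>(x, y, z, u, xh). xh) (\<lambda>(x, y, z, u, xh). (u, z)))}"

definition joint_out ::
  "('x \<times> 'y \<times> 'z) pmf \<Rightarrow> ('x \<Rightarrow> nat pmf) \<Rightarrow> (nat \<Rightarrow> nat pmf) \<Rightarrow> (nat \<Rightarrow> 'y \<Rightarrow> 'xh pmf) \<Rightarrow>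
   ('x \<times> 'y \<times> 'z \<times> nat \<times> nat \<times> 'xh) pmf" where
  "joint_out P PU PT PXh = do {
     (x, y, z) \<leftarrow> P;
     u \<leftarrow> PU x;
     t \<leftarrow> PT u;
     xh \<leftarrow> PXh u y;
     return_pmf (x, y, z, u, t, xh)}"

definition region_out ::
  "real \<Rightarrow> ('x \<times> 'y \<times> 'z) pmf \<Rightarrow> ('x \<Rightarrow> 'y \<Rightarrow> 'f) \<Rightarrow> ('f \<Rightarrow> 'xh \<Rightarrow> real) \<Rightarrow>
   (real \<times> real \<times> real) set" where
  "region_out b P F d =
     {(R, D, \<Delta>). 0 \<le> R \<and> 0 \<le> D \<and> 0 \<le> \<Delta> \<and>
        (\<exists>(\<U> :: nat set) (\<T> :: nat set) (PU :: 'x \<Rightarrow> nat pmf) (PT :: nat \<Rightarrow> nat pmf)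
           (PXh :: nat \<Rightarrow> 'y \<Rightarrow> 'xh pmf).
           finite \<U> \<and> finite \<T> \<and>
           (\<forall>x. set_pmf (PU x) \<subseteq> \<U>) \<and> (\<forall>u\<in>\<U>. set_pmf (PT u) \<subseteq> \<T>) \<and>
           cond_entropy_pmf b (joint_out P PU PT PXh)
             (\<lambda>(x, y, z, u, t, xh). t) (\<lambda>(x, y, z, u, t, xh). u) = 0 \<and>
           R \<ge> mutual_info_pmf b (joint_out P PU PT PXh)
                 (\<lambda>(x, y, z, u, t, xh). x) (\<lambda>(x, y, z, u, t, xh). u) \<and>
           D \<ge> measure_pmf.expectation (joint_out P PU PT PXh)
                 (\<lambda>(x, y, z, u, t, xh). d (F x y) xh) \<and>
           \<Delta> \<le> cond_entropy_pmf b (joint_out P PU PT PXh)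
                 (\<lambda>(x, y, z, u, t, xh). xh) (\<lambda>(x, y, z, u, t, xh). (t, z)))}"

end

theory Submission
  imports Defs "HOL-Real_Asymp.Real_Asymp"
begin

text \<open>Inner region: a covering code of rate about \<open>I(X;U)\<close> followed by the memoryless decoder
  \<open>P(xh | u\<^sub>i, y\<^sub>i)\<close>. Covering makes the expected joint type of \<open>(X\<^sup>n, U\<^sup>n(W))\<close> close to \<open>P(x, u)\<close>,
  and the distortion is linear in this type. The equivocation is bounded below by a function linear
  in the type through a single use of Gibbs' inequality, which compares the law of the code with one
  that keeps the true law of \<open>Xh\<^sup>n\<close> given \<open>(W, Z\<^sup>n)\<close> and replaces the other conditional laws by products
  of single-letter ones; smoothing these keeps all logarithms finite.

  Outer region: in a code take \<open>U = (i, W, Y\<^sup>i\<^sup>-\<^sup>1, Xh\<^sup>i\<^sup>-\<^sup>1)\<close> with \<open>i\<close> uniform and \<open>T\<close> constant. Gibbs'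
  inequality gives \<open>I(X;U) \<le> (1/n) log |W|\<close> and \<open>(1/n) H(Xh\<^sup>n | W, Z\<^sup>n) \<le> H(Xh | Z)\<close>. To let the slack
  tend to \<open>0\<close> without bounding the alphabet of \<open>U\<close>, note that the laws of \<open>X\<close> and \<open>(Z, Xh)\<close>, the
  conditional entropy \<open>H(X|U)\<close> and the distortion are averages over \<open>U\<close> of a continuous function on
  a compact set; they range over a convex hull, which is again compact.\<close>

section \<open>Kernels, information measures and sequential laws\<close>

text \<open>The product reference law of the inner region is chosen so that its letterwise
  log-likelihood ratio has mean I(X;U) + H(Xh|U,Z) under the ideal letter law. Subtracting log |W|,
  about n I(X;U), then leaves n H(Xh|U,Z), and finitely many average letter statistics of the code
  suffice. Smoothing is forced by source words that no codeword covers: they may be paired with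
  codeword letters that the ideal law excludes, where the unsmoothed reference law can vanish and
  Gibbs' inequality would not apply. In the outer region the obstacle is that codes are allowed a
  slack while the region is not, and that the alphabet of the past grows with n. Mutual information
  is not an average over U, but I(X;U) = H(X) - H(X|U) with H(X) fixed, and H(Xh|Z) is a continuous
  function of the averaged law of (Z, Xh). So a vector of fixed dimension records everything, and
  the worst violation of the constraints attains its minimum on a compact set.\<close>

lemma expectation_bind_finite:
  fixes h :: "'b \<Rightarrow> real"
  assumes "finite (set_pmf p)" "\<And>x. x \<in> set_pmf p \<Longrightarrow> finite (set_pmf (f x))"
  shows "measure_pmf.expectation (bind_pmf p f) h =
    measure_pmf.expectation p (\<lambda>x. measure_pmf.expectation (f x) h)"
  using assms
  by (subst pmf_expectation_bind[of "set_pmf p"]) (auto simp: integral_measure_pmf[of "set_pmf p"])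

lemma expectation_cong_pmf:
  fixes f g :: "'a \<Rightarrow> real"
  assumes "\<And>x. x \<in> set_pmf p \<Longrightarrow> f x = g x"
  shows "measure_pmf.expectation p f = measure_pmf.expectation p g"
  by (rule integral_cong_AE) (auto simp: AE_measure_pmf_iff assms)

lemma expectation_mono_pmf:
  fixes f g :: "'a \<Rightarrow> real"
  assumes "finite (set_pmf p)" "\<And>x. x \<in> set_pmf p \<Longrightarrow> f x \<le> g x"
  shows "measure_pmf.expectation p f \<le> measure_pmf.expectation p g"
  by (rule integral_mono_AE)
     (auto simp: AE_measure_pmf_iff assms intro: integrable_measure_pmf_finite)

text \<open>Joint laws are often written as a law followed by a kernel mapped under
  \<open>Pair\<close>: in this shape the mass at a point is a product, and nested constructions
  unfold by rewriting.\<close>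

lemma pmf_dependent_pair:
  "pmf (bind_pmf p (\<lambda>a. map_pmf (Pair a) (k a))) (a, b) = pmf p a * pmf (k a) b"
proof -
  have "pmf (map_pmf (Pair a') (k a')) (a, b) = indicator {a} a' * pmf (k a) b" for a'
  proof (cases "a' = a")
    case True
    have "pmf (map_pmf (Pair a) (k a)) (Pair a b) = pmf (k a) b"
      by (rule pmf_map_inj') (auto simp: inj_def)
    with True show ?thesis by simp
  qed (auto simp: pmf_eq_0_set_pmf)
  then show ?thesis
    by (simp add: pmf_bind measure_pmf_single)
qed

text \<open>A total version of the conditional law of the second component. Off the support of the
  first marginal it is an arbitrary point mass, which keeps it a probability law everywhere.\<close>

definition cond_kernel :: "('a \<times> 'b) pmf \<Rightarrow> 'a \<Rightarrow> 'b pmf" where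
  "cond_kernel p a =
     (if a \<in> set_pmf (map_pmf fst p) then map_pmf snd (cond_pmf p {ab. fst ab = a})
      else return_pmf undefined)"

text \<open>The product form holds at all points: where the marginal vanishes, so does the joint
  mass.\<close>

lemma pmf_cond_kernel: "pmf (map_pmf fst p) a * pmf (cond_kernel p a) b = pmf p (a, b)"
proof (cases "a \<in> set_pmf (map_pmf fst p)")
  case True
  then have ne: "set_pmf p \<inter> {ab. fst ab = a} \<noteq> {}" by auto
  let ?c = "cond_pmf p {ab. fst ab = a}"
  have m: "measure p {ab. fst ab = a} = pmf (map_pmf fst p) a"
    by (simp add: pmf_map vimage_def)
  have "pmf (map_pmf snd ?c) (snd (a, b)) = pmf ?c (a, b)"
  proof (cases "(a, b) \<in> set_pmf ?c")
    case True
    then show ?thesis using ne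
      by (intro pmf_map_inj) (auto simp: inj_on_def set_cond_pmf)
  next
    case False
    then have "b \<notin> set_pmf (map_pmf snd ?c)" using ne by (auto simp: set_cond_pmf)
    with False have "pmf (map_pmf snd ?c) b = 0" "pmf ?c (a, b) = 0"
      by (simp_all add: pmf_eq_0_set_pmf del: set_map_pmf)
    then show ?thesis by simp
  qed
  moreover have "pmf (map_pmf fst p) a \<noteq> 0"
    using True by (simp add: pmf_eq_0_set_pmf del: set_map_pmf)
  ultimately show ?thesis
    using True by (simp add: cond_kernel_def pmf_cond[OF ne] m del: set_map_pmf)
next
  case False
  then have "(a, b) \<notin> set_pmf p" by force
  with False have "pmf p (a, b) = 0" "pmf (map_pmf fst p) a = 0"
    by (simp_all add: pmf_eq_0_set_pmf del: set_map_pmf)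
  then show ?thesis by simp
qed

lemma bind_cond_kernel:
  "bind_pmf (map_pmf fst p) (\<lambda>a. map_pmf (Pair a) (cond_kernel p a)) = p"
proof (rule pmf_eqI)
  fix ab :: "'a \<times> 'b"
  show "pmf (bind_pmf (map_pmf fst p) (\<lambda>a. map_pmf (Pair a) (cond_kernel p a))) ab = pmf p ab"
    by (cases ab) (simp only: pmf_dependent_pair pmf_cond_kernel)
qed

lemma finite_set_cond_kernel:
  assumes "finite (set_pmf p)"
  shows "finite (set_pmf (cond_kernel p a))"
proof (cases "a \<in> set_pmf (map_pmf fst p)")
  case True
  then have ne: "set_pmf p \<inter> {ab. fst ab = a} \<noteq> {}" by auto
  have "finite (set_pmf (map_pmf snd (cond_pmf p {ab. fst ab = a})))"
    using assms ne by simp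
  with True show ?thesis by (simp add: cond_kernel_def del: set_map_pmf)
qed (simp add: cond_kernel_def)

text \<open>Termwise ln t \<le> t - 1; the values of \<open>q\<close> on the image of
  \<open>h\<close> sum to at most 1 because \<open>h\<close> is injective. Reading \<open>q\<close>
  through \<open>h\<close> lets the reference law live on another type, where the sample is
  regrouped in the order in which that law draws it.\<close>

lemma gibbs_inequality:
  assumes "1 < b" and fin: "finite (set_pmf p)" and inj: "inj_on h (set_pmf p)"
    and pos: "\<And>w. w \<in> set_pmf p \<Longrightarrow> 0 < pmf q (h w)"
  shows "measure_pmf.expectation p (\<lambda>w. log b (pmf q (h w) / pmf p w)) \<le> 0"
proof -
  have "measure_pmf.expectation p (\<lambda>w. ln (pmf q (h w) / pmf p w)) =
      (\<Sum>w\<in>set_pmf p. pmf p w * ln (pmf q (h w) / pmf p w))"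
    by (subst integral_measure_pmf[OF fin]) auto
  also have "\<dots> \<le> (\<Sum>w\<in>set_pmf p. pmf q (h w) - pmf p w)"
  proof (rule sum_mono)
    fix w assume w: "w \<in> set_pmf p"
    then have pp: "0 < pmf p w" by (simp add: pmf_positive)
    have "ln (pmf q (h w) / pmf p w) \<le> pmf q (h w) / pmf p w - 1"
      using pp pos[OF w] by (intro ln_le_minus_one) simp
    then have "pmf p w * ln (pmf q (h w) / pmf p w) \<le> pmf p w * (pmf q (h w) / pmf p w - 1)"
      using pp by (intro mult_left_mono) auto
    also have "\<dots> = pmf q (h w) - pmf p w" using pp by (simp add: field_simps)
    finally show "pmf p w * ln (pmf q (h w) / pmf p w) \<le> pmf q (h w) - pmf p w" .
  qed
  also have "\<dots> = sum (pmf q) (h ` set_pmf p) - 1"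
    by (simp add: sum_subtractf sum.reindex[OF inj] sum_pmf_eq_1[OF fin])
  also have "\<dots> \<le> 0"
    using fin by (simp add: measure_measure_pmf_finite[symmetric])
  finally have "measure_pmf.expectation p (\<lambda>w. ln (pmf q (h w) / pmf p w)) / ln b \<le> 0"
    using \<open>1 < b\<close> by (simp add: divide_nonpos_pos)
  then show ?thesis by (simp add: log_def)
qed

section \<open>Information measures as expectations of log-likelihood ratios\<close>

lemma cond_entropy_pmf_expectation:
  fixes X :: "'a \<Rightarrow> 'b::countable" and Y :: "'a \<Rightarrow> 'c::countable"
  assumes "1 < b" and fin: "finite (set_pmf p)"
  shows "cond_entropy_pmf b p X Y = measure_pmf.expectation p
    (\<lambda>a. - log b (pmf (map_pmf (\<lambda>a. (X a, Y a)) p) (X a, Y a) / pmf (map_pmf Y p) (Y a)))"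
proof -
  let ?m = "map_pmf (\<lambda>a. (X a, Y a)) p"
  have fm: "finite (set_pmf ?m)" using fin by simp
  have "cond_entropy_pmf b p X Y = measure_pmf.expectation ?m
     (\<lambda>z. - log b (pmf ?m z / pmf (map_pmf Y p) (snd z)))"
    by (subst integral_measure_pmf[of "set_pmf ?m"])
       (use fm in \<open>auto simp: cond_entropy_pmf_sum[OF assms] case_prod_unfold sum_negf simp del: set_map_pmf\<close>)
  then show ?thesis by simp
qed

lemma mutual_info_pmf_expectation:
  fixes X :: "'a \<Rightarrow> 'b::countable" and Y :: "'a \<Rightarrow> 'c::countable"
  assumes "1 < b" and fin: "finite (set_pmf p)"
  shows "mutual_info_pmf b p X Y = measure_pmf.expectation p
    (\<lambda>a. log b (pmf (map_pmf (\<lambda>a. (X a, Y a)) p) (X a, Y a) /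
                 (pmf (map_pmf X p) (X a) * pmf (map_pmf Y p) (Y a))))"
proof -
  let ?m = "map_pmf (\<lambda>a. (X a, Y a)) p"
  have fm: "finite (set_pmf ?m)" using fin by simp
  have "mutual_info_pmf b p X Y = measure_pmf.expectation ?m
     (\<lambda>z. log b (pmf ?m z / (pmf (map_pmf X p) (fst z) * pmf (map_pmf Y p) (snd z))))"
    by (subst integral_measure_pmf[of "set_pmf ?m"])
       (use fm in \<open>auto simp: mutual_info_pmf_sum[OF assms] case_prod_unfold simp del: set_map_pmf\<close>)
  then show ?thesis by simp
qed

text \<open>The kernel sees the whole word drawn so far and, through its length, the position. One
  recursion thus covers causal decoders and position-dependent reference laws.\<close>

primrec seq_pmf :: "('a list \<Rightarrow> 'a pmf) \<Rightarrow> nat \<Rightarrow> 'a list pmf" where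
  "seq_pmf k 0 = return_pmf []"
| "seq_pmf k (Suc n) = bind_pmf (seq_pmf k n) (\<lambda>l. map_pmf (\<lambda>a. l @ [a]) (k l))"

lemma length_seq_pmf: "l \<in> set_pmf (seq_pmf k n) \<Longrightarrow> length l = n"
  by (induction n arbitrary: l) auto

lemma pmf_seq_pmf:
  "pmf (seq_pmf k n) l =
    (if length l = n then \<Prod>i<n. pmf (k (take i l)) (l ! i) else 0)"
proof (induction n arbitrary: l)
  case 0
  then show ?case by (auto simp: indicator_def)
next
  case (Suc n)
  show ?case
  proof (cases "length l = Suc n")
    case False
    then have "l \<notin> set_pmf (seq_pmf k (Suc n))" using length_seq_pmf by blast
    with False show ?thesis by (simp add: pmf_eq_0_set_pmf del: seq_pmf.simps)
  next
    case True
    then obtain l' a where l: "l = l' @ [a]" and n: "length l' = n"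
      by (metis length_Suc_conv_rev)
    have inj: "inj (\<lambda>(l', a). l' @ [a])" by (auto simp: inj_def)
    have "seq_pmf k (Suc n) = map_pmf (\<lambda>(l', a). l' @ [a])
        (bind_pmf (seq_pmf k n) (\<lambda>l. map_pmf (Pair l) (k l)))"
      by (simp add: map_bind_pmf pmf.map_comp o_def)
    then have "pmf (seq_pmf k (Suc n)) l =
        pmf (bind_pmf (seq_pmf k n) (\<lambda>l. map_pmf (Pair l) (k l))) (l', a)"
      using pmf_map_inj'[OF inj, of _ "(l', a)"] l by simp
    then show ?thesis using l n
      by (simp add: pmf_dependent_pair Suc.IH nth_append)
  qed
qed

lemma finite_set_seq_pmf:
  assumes "\<And>l. finite (set_pmf (k l))"
  shows "finite (set_pmf (seq_pmf k n))"
  by (induction n) (auto simp: assms)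

section \<open>Independent and identically distributed words\<close>

lemma pmf_replicate_pmf:
  "pmf (replicate_pmf n p) l = (if length l = n then \<Prod>i<n. pmf p (l ! i) else 0)"
proof (induction n arbitrary: l)
  case 0
  then show ?case by (auto simp: indicator_def)
next
  case (Suc n)
  show ?case
  proof (cases "length l = Suc n")
    case False
    then have "l \<notin> set_pmf (replicate_pmf (Suc n) p)" by (auto simp only: set_replicate_pmf)
    with False show ?thesis by (simp add: pmf_eq_0_set_pmf del: replicate_pmf.simps)
  next
    case True
    then obtain a l' where l: "l = a # l'" and n: "length l' = n"
      by (auto simp: length_Suc_conv)
    have inj: "inj (\<lambda>(a, l'). a # l')" by (auto simp: inj_def)
    have "replicate_pmf (Suc n) p = map_pmf (\<lambda>(a, l'). a # l')
        (bind_pmf p (\<lambda>a. map_pmf (Pair a) (replicate_pmf n p)))"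
      by (simp add: map_bind_pmf pmf.map_comp o_def map_pmf_def bind_assoc_pmf bind_return_pmf)
    then have "pmf (replicate_pmf (Suc n) p) l =
        pmf (bind_pmf p (\<lambda>a. map_pmf (Pair a) (replicate_pmf n p))) (a, l')"
      using pmf_map_inj'[OF inj, of _ "(a, l')"] l by simp
    then show ?thesis using l n
      by (simp add: pmf_dependent_pair Suc.IH prod.lessThan_Suc_shift del: prod.lessThan_Suc)
  qed
qed

lemma finite_set_replicate_pmf:
  assumes "finite (set_pmf p)"
  shows "finite (set_pmf (replicate_pmf n p))"
  using finite_lists_length_eq[OF assms, of n]
  by (rule rev_finite_subset) (auto simp: set_replicate_pmf)

text \<open>A step of a kernel that preserves \<open>p\<close>, applied at a single position, yields
  a letter of law \<open>p\<close> that is independent of the other letters.\<close>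

lemma replicate_pmf_resample:
  assumes "bind_pmf p k = p" "i < n"
  shows "bind_pmf (replicate_pmf n p) (\<lambda>l. map_pmf (\<lambda>a. l[i := a]) (k (l ! i))) = replicate_pmf n p"
  using assms(2)
proof (induction n arbitrary: i)
  case (Suc n)
  show ?case
  proof (cases i)
    case 0
    have "bind_pmf (replicate_pmf (Suc n) p) (\<lambda>l. map_pmf (\<lambda>a. l[i := a]) (k (l ! i)))
       = bind_pmf p (\<lambda>x. bind_pmf (replicate_pmf n p) (\<lambda>xs. bind_pmf (k x) (\<lambda>a. return_pmf (a # xs))))"
      using 0 by (simp add: bind_assoc_pmf bind_return_pmf map_pmf_def)
    also have "\<dots> = bind_pmf (bind_pmf p k) (\<lambda>a. bind_pmf (replicate_pmf n p) (\<lambda>xs. return_pmf (a # xs)))"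
      by (subst bind_commute_pmf) (simp add: bind_assoc_pmf)
    finally show ?thesis by (simp add: assms(1))
  next
    case (Suc j)
    with Suc.prems have "j < n" by simp
    have upd: "list_update (x # xs) (Suc j) = (\<lambda>a. x # xs[j := a])" for x and xs :: "'a list"
      by auto
    have "bind_pmf (replicate_pmf (Suc n) p) (\<lambda>l. map_pmf (\<lambda>a. l[i := a]) (k (l ! i)))
       = bind_pmf p (\<lambda>x. map_pmf ((#) x)
           (bind_pmf (replicate_pmf n p) (\<lambda>l. map_pmf (\<lambda>a. l[j := a]) (k (l ! j)))))"
      using Suc by (simp add: bind_assoc_pmf bind_return_pmf map_bind_pmf pmf.map_comp o_def upd)
    also have "\<dots> = replicate_pmf (Suc n) p"
      by (simp only: Suc.IH[OF \<open>j < n\<close>]) (simp add: map_pmf_def)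
    finally show ?thesis .
  qed
qed simp

lemma map_replicate_pmf: "map_pmf (map g) (replicate_pmf n p) = replicate_pmf n (map_pmf g p)"
proof (induction n)
  case (Suc n)
  have "map_pmf (map g) (replicate_pmf (Suc n) p) =
      bind_pmf p (\<lambda>x. map_pmf ((#) (g x)) (map_pmf (map g) (replicate_pmf n p)))"
    by (simp add: map_bind_pmf pmf.map_comp o_def) (simp add: map_pmf_def)
  also have "\<dots> = replicate_pmf (Suc n) (map_pmf g p)"
    unfolding Suc.IH by (simp add: bind_map_pmf map_pmf_def[of "(#) _"])
  finally show ?case .
qed simp

section \<open>The law of a causal code\<close>

text \<open>Later letters do not feed back into the law of earlier ones.\<close>

lemma take_seq_pmf:
  assumes "i \<le> n"
  shows "map_pmf (take i) (seq_pmf k n) = seq_pmf k i"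
  using assms
proof (induction n)
  case (Suc n)
  show ?case
  proof (cases "i = Suc n")
    case True
    have "map_pmf (take i) (seq_pmf k (Suc n)) = map_pmf id (seq_pmf k (Suc n))"
      by (rule map_pmf_cong) (use True in \<open>auto dest: length_seq_pmf simp del: seq_pmf.simps\<close>)
    with True show ?thesis by simp
  next
    case False
    with Suc.prems have "i \<le> n" by simp
    have "map_pmf (take i) (seq_pmf k (Suc n)) =
        bind_pmf (seq_pmf k n) (\<lambda>l. map_pmf (\<lambda>a. take i (l @ [a])) (k l))"
      by (simp add: map_bind_pmf pmf.map_comp o_def)
    also have "\<dots> = bind_pmf (seq_pmf k n) (\<lambda>l. return_pmf (take i l))"
    proof (rule bind_pmf_cong)
      fix l assume "l \<in> set_pmf (seq_pmf k n)"
      then have "length l = n" by (rule length_seq_pmf)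
      with \<open>i \<le> n\<close> show "map_pmf (\<lambda>a. take i (l @ [a])) (k l) = return_pmf (take i l)"
        by (simp add: map_pmf_const)
    qed simp
    finally show ?thesis using Suc.IH \<open>i \<le> n\<close> by (simp flip: map_pmf_def)
  qed
qed simp

text \<open>The decoder step and the visible part of \<open>ys\<close> are both recovered from the
  length of the past, so for fixed \<open>w\<close> and \<open>ys\<close> a causal decoder is a
  sequential law.\<close>

lemma causal_decoder_eq_seq_pmf:
  "causal_decoder q w ys n = seq_pmf (\<lambda>l. q (Suc (length l)) w (take (Suc (length l)) ys) l) n"
proof (induction n)
  case (Suc n)
  show ?case
    by (simp only: causal_decoder.simps seq_pmf.simps Suc map_pmf_def[symmetric])
       (rule bind_pmf_cong, auto dest: length_seq_pmf)
qed simp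

lemma causal_decoder_cong:
  assumes "take i ys = take i ys'"
  shows "causal_decoder q w ys i = causal_decoder q w ys' i"
  using assms
proof (induction i)
  case (Suc i)
  then have "take i ys = take i ys'"
    by (metis take_take min.absorb1 le_SucI order_refl)
  with Suc show ?case by simp
qed simp

text \<open>Only the source word and the reconstruction are kept: the other components of
  \<open>code_joint\<close> are functions of the source word.\<close>

definition code_pmf ::
  "('x \<times> 'y \<times> 'z) pmf \<Rightarrow> nat \<Rightarrow> ('x list \<Rightarrow> nat) \<Rightarrow>
   (nat \<Rightarrow> nat \<Rightarrow> 'y list \<Rightarrow> 'xh list \<Rightarrow> 'xh pmf) \<Rightarrow> (('x \<times> 'y \<times> 'z) list \<times> 'xh list) pmf" where
  "code_pmf P n f q = bind_pmf (replicate_pmf n P)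
     (\<lambda>s. map_pmf (Pair s) (causal_decoder q (f (map fst s)) (map (fst \<circ> snd) s) n))"

lemma code_joint_eq_map_code_pmf:
  "code_joint P n f q = map_pmf
     (\<lambda>(s, xhs). (map fst s, map (fst \<circ> snd) s, map (snd \<circ> snd) s, f (map fst s), xhs))
     (code_pmf P n f q)"
  unfolding code_joint_def code_pmf_def Let_def
  by (simp add: map_bind_pmf pmf.map_comp o_def map_pmf_def[symmetric])

lemma set_code_pmf:
  assumes "(s, xhs) \<in> set_pmf (code_pmf P n f q)"
  shows "length s = n" "length xhs = n" "set s \<subseteq> set_pmf P"
  using assms
  by (auto simp: code_pmf_def set_replicate_pmf causal_decoder_eq_seq_pmf dest: length_seq_pmf)

lemma pmf_code_pmf:
  assumes "length s = n" "length xhs = n"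
  shows "pmf (code_pmf P n f q) (s, xhs) = (\<Prod>i<n. pmf P (s ! i) *
    pmf (q (Suc i) (f (map fst s)) (take i (map (fst \<circ> snd) s) @ [fst (snd (s ! i))]) (take i xhs)) (xhs ! i))"
proof -
  have "pmf (causal_decoder q w (map (fst \<circ> snd) s) n) xhs =
     (\<Prod>i<n. pmf (q (Suc i) w (take i (map (fst \<circ> snd) s) @ [fst (snd (s ! i))]) (take i xhs)) (xhs ! i))" for w
    using assms by (simp add: causal_decoder_eq_seq_pmf pmf_seq_pmf take_Suc_conv_app_nth)
  then show ?thesis
    using assms by (simp add: code_pmf_def pmf_dependent_pair pmf_replicate_pmf prod.distrib)
qed

lemma finite_set_code_pmf:
  fixes P :: "('x::finite \<times> 'y::finite \<times> 'z::finite) pmf"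
    and q :: "nat \<Rightarrow> nat \<Rightarrow> 'y list \<Rightarrow> 'xh::finite list \<Rightarrow> 'xh pmf"
  shows "finite (set_pmf (code_pmf P n f q))"
  by (auto simp: code_pmf_def finite_set_replicate_pmf finite_set_seq_pmf causal_decoder_eq_seq_pmf)

text \<open>The order of drawing encodes both Markov chains: (Y, Z) depends on U only through X, and
  Xh depends on (X, Z) only through (U, Y).\<close>

definition letter_joint ::
  "('x \<times> 'y \<times> 'z) pmf \<Rightarrow> ('u \<times> 'x) pmf \<Rightarrow> ('u \<Rightarrow> 'y \<Rightarrow> 'xh pmf) \<Rightarrow> ('u \<times> 'x \<times> 'y \<times> 'z \<times> 'xh) pmf"
where
  "letter_joint P J \<kappa> = bind_pmf J (\<lambda>(u, x). bind_pmf (cond_kernel P x) (\<lambda>(y, z).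
     map_pmf (\<lambda>xh. (u, x, y, z, xh)) (\<kappa> u y)))"

text \<open>The joint law of the auxiliary variable and the letter X at position \<open>i\<close>.
  Positions count from 0, so \<open>take i\<close> is the strict past.\<close>

definition past_pmf ::
  "('x \<times> 'y \<times> 'z) pmf \<Rightarrow> nat \<Rightarrow> ('x list \<Rightarrow> nat) \<Rightarrow>
   (nat \<Rightarrow> nat \<Rightarrow> 'y list \<Rightarrow> 'xh list \<Rightarrow> 'xh pmf) \<Rightarrow> nat \<Rightarrow> ((nat \<times> 'y list \<times> 'xh list) \<times> 'x) pmf" where
  "past_pmf P n f q i = map_pmf
     (\<lambda>(s, xhs). ((f (map fst s), take i (map (fst \<circ> snd) s), take i xhs), fst (s ! i)))
     (code_pmf P n f q)"

text \<open>By causality the decoder may be stopped after \<open>i\<close> steps, before it reads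
  the side information at position \<open>i\<close>.\<close>

lemma past_pmf_eq:
  assumes "i \<le> n"
  shows "past_pmf P n f q i = bind_pmf (replicate_pmf n P) (\<lambda>s.
    map_pmf (\<lambda>xhs. ((f (map fst s), take i (map (fst \<circ> snd) s), xhs), fst (s ! i)))
      (causal_decoder q (f (map fst s)) (map (fst \<circ> snd) s) i))"
  unfolding past_pmf_def code_pmf_def causal_decoder_eq_seq_pmf take_seq_pmf[OF assms, symmetric]
  by (simp add: map_bind_pmf pmf.map_comp o_def)

lemma bind_cond_kernel_same_fst:
  "bind_pmf P (\<lambda>s. map_pmf (Pair (fst s)) (cond_kernel P (fst s))) = P"
  using bind_cond_kernel[of P] by (simp add: bind_map_pmf)

text \<open>Given \<open>X\<^sub>i\<close>, the side information \<open>(Y\<^sub>i, Z\<^sub>i)\<close> can be resampled from its conditional law without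
  changing the source law, and neither the message nor the past of the decoder notices.\<close>

lemma single_letter_law:
  fixes P :: "('x \<times> 'y \<times> 'z) pmf"
  assumes "i < n"
  shows "map_pmf (\<lambda>(s, xhs). ((f (map fst s), take i (map (fst \<circ> snd) s), take i xhs),
      fst (s ! i), fst (snd (s ! i)), snd (snd (s ! i)), xhs ! i)) (code_pmf P n f q) =
    letter_joint P (past_pmf P n f q i) (\<lambda>(w, ys, xhs) y. q (Suc i) w (ys @ [y]) xhs)"
proof -
  let ?R = "replicate_pmf n P"
  let ?ys = "map (fst \<circ> snd) :: ('x \<times> 'y \<times> 'z) list \<Rightarrow> 'y list"
  \<comment> \<open>The side information at position \<open>i\<close> enters both as an output and
    as an input of the kernel. With it isolated as the argument \<open>v\<close>, the rest of
    \<open>G\<close> depends only on data that resampling preserves.\<close>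
  define G where "G s v = bind_pmf (causal_decoder q (f (map fst s)) (?ys s) i) (\<lambda>xhs.
     map_pmf (\<lambda>xh. ((f (map fst s), take i (?ys s), xhs), fst (s ! i), fst v, snd v, xh))
       (q (Suc i) (f (map fst s)) (take i (?ys s) @ [fst v]) xhs))" for s and v :: "'y \<times> 'z"
  have "map_pmf (\<lambda>(s, xhs). ((f (map fst s), take i (?ys s), take i xhs),
      fst (s ! i), fst (snd (s ! i)), snd (snd (s ! i)), xhs ! i)) (code_pmf P n f q) =
      bind_pmf ?R (\<lambda>s. map_pmf (\<lambda>xhs. ((f (map fst s), take i (?ys s), take i xhs),
        fst (s ! i), fst (snd (s ! i)), snd (snd (s ! i)), xhs ! i))
        (causal_decoder q (f (map fst s)) (?ys s) n))"
    by (simp add: code_pmf_def map_bind_pmf pmf.map_comp o_def)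
  also have "\<dots> = bind_pmf ?R (\<lambda>s. G s (snd (s ! i)))"
  proof (rule bind_pmf_cong)
    fix s assume "s \<in> set_pmf ?R"
    then have len: "length s = n" by (simp add: set_replicate_pmf)
    let ?w = "f (map fst s)"
    let ?D = "causal_decoder q ?w (?ys s)"
    have tk: "map_pmf (take (Suc i)) (?D n) = ?D (Suc i)"
      unfolding causal_decoder_eq_seq_pmf by (rule take_seq_pmf) (use assms in simp)
    let ?g = "\<lambda>xhs. ((?w, take i (?ys s), take i xhs),
        fst (s ! i), fst (snd (s ! i)), snd (snd (s ! i)), xhs ! i)"
    have "map_pmf ?g (?D n) = map_pmf ?g (map_pmf (take (Suc i)) (?D n))"
      by (simp add: pmf.map_comp o_def min_def)
    also have "\<dots> = bind_pmf (?D i) (\<lambda>xhs. map_pmf (\<lambda>xh. ?g (xhs @ [xh])) (q (Suc i) ?w (take (Suc i) (?ys s)) xhs))"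
      unfolding tk by (simp add: map_bind_pmf pmf.map_comp o_def map_pmf_def[symmetric])
    also have "\<dots> = G s (snd (s ! i))"
      unfolding G_def
    proof (rule bind_pmf_cong)
      fix xhs assume "xhs \<in> set_pmf (?D i)"
      then have "length xhs = i"
        unfolding causal_decoder_eq_seq_pmf by (rule length_seq_pmf)
      then show "map_pmf (\<lambda>xh. ?g (xhs @ [xh])) (q (Suc i) ?w (take (Suc i) (?ys s)) xhs) =
        map_pmf (\<lambda>xh. ((?w, take i (?ys s), xhs), fst (s ! i), fst (snd (s ! i)), snd (snd (s ! i)), xh))
          (q (Suc i) ?w (take i (?ys s) @ [fst (snd (s ! i))]) xhs)"
        using len assms by (simp add: take_Suc_conv_app_nth nth_append)
    qed simp
    finally show "map_pmf ?g (?D n) = G s (snd (s ! i))" .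
  qed simp
  \<comment> \<open>Insert a resampling of (Y, Z) at position \<open>i\<close> given X; it preserves
    \<open>P\<close> by disintegration over the first component.\<close>
  also have "\<dots> = bind_pmf (bind_pmf ?R (\<lambda>s. map_pmf (\<lambda>a. s[i := a])
      (map_pmf (Pair (fst (s ! i))) (cond_kernel P (fst (s ! i)))))) (\<lambda>s. G s (snd (s ! i)))"
    by (subst replicate_pmf_resample[OF bind_cond_kernel_same_fst assms]) simp
  also have "\<dots> = bind_pmf ?R (\<lambda>s. bind_pmf (cond_kernel P (fst (s ! i))) (\<lambda>v. G s v))"
    unfolding bind_assoc_pmf bind_map_pmf
  proof (intro bind_pmf_cong refl)
    fix s v assume "s \<in> set_pmf ?R"
    then have len: "length s = n" by (simp add: set_replicate_pmf)
    let ?s = "s[i := (fst (s ! i), v)]"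
    have 1: "map fst ?s = map fst s"
      using len assms by (simp add: map_update list_update_same_conv)
    have 2: "take i (?ys ?s) = take i (?ys s)"
      using assms len by (simp add: map_update take_update_cancel)
    have 3: "?s ! i = (fst (s ! i), v)" using assms len by simp
    show "G ?s (snd (?s ! i)) = G s v"
      unfolding G_def causal_decoder_cong[OF 2] by (simp only: 1 2 3 fst_conv snd_conv)
  qed
  also have "\<dots> = letter_joint P (past_pmf P n f q i) (\<lambda>(w, ys, xhs) y. q (Suc i) w (ys @ [y]) xhs)"
    unfolding G_def letter_joint_def past_pmf_eq[OF less_imp_le[OF assms]] bind_assoc_pmf bind_map_pmf
    \<comment> \<open>So far the fresh side information is drawn before the past of the decoder, in
      \<open>letter_joint\<close> after it; given the source word the two draws are
      independent.\<close>
    by (subst bind_commute_pmf) (simp add: case_prod_unfold)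
  finally show ?thesis .
qed

lemma message_letter_past_pmf:
  assumes "i < n"
  shows "map_pmf (\<lambda>((w, _), x). (w, x)) (past_pmf P n f q i) =
    map_pmf (\<lambda>xs. (f xs, xs ! i)) (replicate_pmf n (map_pmf fst P))"
proof -
  have "map_pmf (\<lambda>((w, _), x). (w, x)) (past_pmf P n f q i) =
      map_pmf (\<lambda>s. (f (map fst s), fst (s ! i))) (replicate_pmf n P)"
    by (simp add: past_pmf_def code_pmf_def map_bind_pmf pmf.map_comp o_def case_prod_unfold
        map_pmf_const) (simp add: map_pmf_def)
  also have "\<dots> = map_pmf (\<lambda>s. (f (map fst s), map fst s ! i)) (replicate_pmf n P)"
    by (rule map_pmf_cong) (use assms in \<open>auto simp: set_replicate_pmf\<close>)
  finally show ?thesis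
    by (simp add: map_replicate_pmf[symmetric] pmf.map_comp o_def)
qed

lemma law_nth_replicate_pmf:
  assumes "i < n"
  shows "map_pmf (\<lambda>xs. xs ! i) (replicate_pmf n p) = p"
  using assms
proof (induction n arbitrary: i)
  case (Suc n)
  have "map_pmf (\<lambda>xs. xs ! i) (replicate_pmf (Suc n) p) =
      bind_pmf p (\<lambda>x. map_pmf (\<lambda>xs. (x # xs) ! i) (replicate_pmf n p))"
    by (simp add: map_bind_pmf pmf.map_comp o_def) (simp add: map_pmf_def)
  then show ?case
    using Suc by (cases i) (auto simp: map_pmf_const bind_return_pmf')
qed simp

section \<open>Covering\<close>

text \<open>Serves to extract one good codeword from an average over random codewords.\<close>

lemma expectation_le_value:
  fixes f :: "'a \<Rightarrow> real"
  assumes "finite (set_pmf p)"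
  obtains x where "x \<in> set_pmf p" "measure_pmf.expectation p f \<le> f x"
proof -
  have ne: "f ` set_pmf p \<noteq> {}" using set_pmf_not_empty by auto
  then have "Max (f ` set_pmf p) \<in> f ` set_pmf p" using assms by (intro Max_in) auto
  then obtain x where x: "x \<in> set_pmf p" "f x = Max (f ` set_pmf p)" by auto
  have "measure_pmf.expectation p f \<le> measure_pmf.expectation p (\<lambda>_. f x)"
    by (rule expectation_mono_pmf[OF assms]) (use x(2) assms in \<open>auto intro: Max_ge\<close>)
  with x(1) show thesis by (intro that[of x]) auto
qed

section \<open>Weak law of large numbers\<close>

lemma expectation_replicate_Suc:
  fixes h :: "'a list \<Rightarrow> real"
  assumes "finite (set_pmf p)"
  shows "measure_pmf.expectation (replicate_pmf (Suc n) p) h =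
    measure_pmf.expectation p (\<lambda>x. measure_pmf.expectation (replicate_pmf n p) (\<lambda>xs. h (x # xs)))"
  by (simp add: map_pmf_def[symmetric] expectation_bind_finite assms finite_set_replicate_pmf)

lemma second_moment_replicate_pmf:
  fixes \<psi> :: "'a \<Rightarrow> real"
  assumes fin: "finite (set_pmf p)" and mean: "measure_pmf.expectation p \<psi> = 0"
  shows "measure_pmf.expectation (replicate_pmf n p) (\<lambda>l. sum_list (map \<psi> l)) = 0 \<and>
    measure_pmf.expectation (replicate_pmf n p) (\<lambda>l. (sum_list (map \<psi> l))\<^sup>2) =
      real n * measure_pmf.expectation p (\<lambda>a. (\<psi> a)\<^sup>2)"
proof (induction n)
  case (Suc n)
  have int [simp]: "integrable (measure_pmf (replicate_pmf n p)) g" for g :: "'a list \<Rightarrow> real"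
    by (rule integrable_measure_pmf_finite) (rule finite_set_replicate_pmf[OF fin])
  have int' [simp]: "integrable (measure_pmf p) g" for g :: "'a \<Rightarrow> real"
    by (rule integrable_measure_pmf_finite) (rule fin)
  show ?case
    using Suc mean
    by (simp add: expectation_replicate_Suc[OF fin] power2_sum algebra_simps del: replicate_pmf.simps)
qed simp

text \<open>Chebyshev's inequality: the indicator of a deviation is at most the normalized square of
  the centred sum.\<close>

lemma weak_law:
  fixes \<psi> :: "'a \<Rightarrow> real"
  assumes fin: "finite (set_pmf p)" and "0 < \<epsilon>" "0 < n"
  defines "\<mu> \<equiv> measure_pmf.expectation p \<psi>"
  shows "measure_pmf.prob (replicate_pmf n p) {l. \<bar>sum_list (map \<psi> l) - real n * \<mu>\<bar> > real n * \<epsilon>}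
    \<le> measure_pmf.expectation p (\<lambda>a. (\<psi> a - \<mu>)\<^sup>2) / (real n * \<epsilon>\<^sup>2)"
proof -
  let ?R = "replicate_pmf n p"
  let ?A = "{l. \<bar>sum_list (map \<psi> l) - real n * \<mu>\<bar> > real n * \<epsilon>}"
  let ?c = "\<lambda>a. \<psi> a - \<mu>"
  have int [simp]: "integrable (measure_pmf p) g" for g :: "'a \<Rightarrow> real"
    by (rule integrable_measure_pmf_finite) (rule fin)
  have centred: "sum_list (map ?c l) = sum_list (map \<psi> l) - real (length l) * \<mu>" for l
    by (induction l) (auto simp: algebra_simps)
  have "measure_pmf.prob ?R ?A = measure_pmf.expectation ?R (indicator ?A)"
    by simp
  also have "\<dots> \<le> measure_pmf.expectation ?R (\<lambda>l. (sum_list (map ?c l))\<^sup>2 / (real n * \<epsilon>)\<^sup>2)"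
  proof (rule expectation_mono_pmf)
    fix l assume "l \<in> set_pmf ?R"
    then have len: "length l = n" by (simp add: set_replicate_pmf)
    show "indicator ?A l \<le> (sum_list (map ?c l))\<^sup>2 / (real n * \<epsilon>)\<^sup>2"
    proof (cases "l \<in> ?A")
      case True
      then have "\<bar>real n * \<epsilon>\<bar> \<le> \<bar>sum_list (map ?c l)\<bar>"
        using \<open>0 < \<epsilon>\<close> by (simp add: centred len)
      then have "(real n * \<epsilon>)\<^sup>2 \<le> (sum_list (map ?c l))\<^sup>2" by (simp only: abs_le_square_iff)
      with True show ?thesis using assms by (simp add: divide_simps)
    qed simp
  qed (rule finite_set_replicate_pmf[OF fin])
  also have "\<dots> = real n * measure_pmf.expectation p (\<lambda>a. (?c a)\<^sup>2) / (real n * \<epsilon>)\<^sup>2"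
    using second_moment_replicate_pmf[OF fin, of ?c n] by (simp add: \<mu>_def)
  also have "\<dots> = measure_pmf.expectation p (\<lambda>a. (?c a)\<^sup>2) / (real n * \<epsilon>\<^sup>2)"
    using assms by (simp add: power2_eq_square field_simps)
  finally show ?thesis .
qed

text \<open>Union bound by induction on the family; the tolerance \<kappa> is generalized because
  each new function takes half of it.\<close>

lemma weak_law_finite_family:
  fixes \<Psi> :: "('a \<Rightarrow> real) set"
  assumes fin: "finite (set_pmf p)" and "finite \<Psi>" "0 < \<epsilon>" "0 < \<kappa>"
  shows "\<forall>\<^sub>F n in sequentially. measure_pmf.prob (replicate_pmf n p)
    {l. \<exists>\<psi>\<in>\<Psi>. \<bar>sum_list (map \<psi> l) - real n * measure_pmf.expectation p \<psi>\<bar> > real n * \<epsilon>} \<le> \<kappa>"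
  using assms(2,4)
proof (induction \<Psi> arbitrary: \<kappa>)
  case (insert \<psi> \<Psi>)
  let ?A = "\<lambda>\<psi> n. {l. \<bar>sum_list (map \<psi> l) - real n * measure_pmf.expectation p \<psi>\<bar> > real n * \<epsilon>}"
  let ?v = "measure_pmf.expectation p (\<lambda>a. (\<psi> a - measure_pmf.expectation p \<psi>)\<^sup>2)"
  have "((\<lambda>n. v / (real n * \<epsilon>\<^sup>2)) \<longlongrightarrow> 0) sequentially" for v :: real
    using \<open>0 < \<epsilon>\<close> by real_asymp
  from this[of ?v] have "\<forall>\<^sub>F n in sequentially. ?v / (real n * \<epsilon>\<^sup>2) < \<kappa> / 2"
    by (rule order_tendstoD) (use insert.prems in simp)
  moreover have "\<forall>\<^sub>F n in sequentially. measure_pmf.prob (replicate_pmf n p) (\<Union>\<psi>\<in>\<Psi>. ?A \<psi> n) \<le> \<kappa> / 2"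
    using insert.IH[of "\<kappa> / 2"] insert.prems by (simp add: UN_iff[symmetric] Collect_bex_eq)
  ultimately show ?case using eventually_gt_at_top[of 0]
  proof eventually_elim
    case (elim n)
    have "measure_pmf.prob (replicate_pmf n p) (?A \<psi> n \<union> (\<Union>\<psi>\<in>\<Psi>. ?A \<psi> n)) \<le>
       measure_pmf.prob (replicate_pmf n p) (?A \<psi> n) + measure_pmf.prob (replicate_pmf n p) (\<Union>\<psi>\<in>\<Psi>. ?A \<psi> n)"
      by (rule measure_Un_le) auto
    also have "\<dots> \<le> \<kappa> / 2 + \<kappa> / 2"
      by (rule add_mono[OF order_trans[OF weak_law[OF fin \<open>0 < \<epsilon>\<close>] less_imp_le]]) (use elim in auto)
    also have "?A \<psi> n \<union> (\<Union>\<psi>\<in>\<Psi>. ?A \<psi> n) = {l. \<exists>\<psi>\<in>insert \<psi> \<Psi>. l \<in> ?A \<psi> n}" by auto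
    finally show ?case by simp
  qed
qed simp

lemma replicate_pair_pmf:
  "replicate_pmf n (pair_pmf p q) =
    map_pmf (\<lambda>(xs, ys). zip xs ys) (pair_pmf (replicate_pmf n p) (replicate_pmf n q))"
proof (induction n)
  case (Suc n)
  have "map_pmf (\<lambda>(xs, ys). zip xs ys) (pair_pmf (replicate_pmf (Suc n) p) (replicate_pmf (Suc n) q)) =
    bind_pmf p (\<lambda>x. bind_pmf (replicate_pmf n p) (\<lambda>xs. bind_pmf q (\<lambda>y.
      bind_pmf (replicate_pmf n q) (\<lambda>ys. return_pmf ((x, y) # zip xs ys)))))"
    by (simp add: pair_pmf_def map_bind_pmf bind_assoc_pmf bind_return_pmf)
  also have "\<dots> = bind_pmf p (\<lambda>x. bind_pmf q (\<lambda>y. bind_pmf (replicate_pmf n p) (\<lambda>xs.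
      bind_pmf (replicate_pmf n q) (\<lambda>ys. return_pmf ((x, y) # zip xs ys)))))"
    by (subst bind_commute_pmf) (rule refl)
  also have "\<dots> = bind_pmf (pair_pmf p q) (\<lambda>a. map_pmf ((#) a)
      (map_pmf (\<lambda>(xs, ys). zip xs ys) (pair_pmf (replicate_pmf n p) (replicate_pmf n q))))"
    by (simp add: pair_pmf_def map_bind_pmf bind_assoc_pmf bind_return_pmf)
  also have "\<dots> = replicate_pmf (Suc n) (pair_pmf p q)"
    unfolding Suc[symmetric] by (simp add: map_pmf_def)
  finally show ?case by simp
qed (simp add: pair_pmf_def bind_return_pmf)

text \<open>Draw the codeword at random, independently of the source word. Passing from
  \<open>L\<close> to the product of its marginals costs at most the factor \<theta> on
  \<open>G\<close>, so the average captured mass is at least \<theta> times the mass, under n copies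
  of \<open>L\<close>, of the good words whose source part lies in \<open>B\<close>. Some codeword
  reaches this average.\<close>

lemma covering_step:
  fixes L :: "('x \<times> 'u) pmf"
  assumes fin: "finite (set_pmf L)" and "0 \<le> \<theta>"
    and ratio: "\<And>l. l \<in> G \<Longrightarrow> l \<in> set_pmf (replicate_pmf n L) \<Longrightarrow> \<theta> * pmf (replicate_pmf n L) l \<le>
      pmf (replicate_pmf n (pair_pmf (map_pmf fst L) (map_pmf snd L))) l"
  obtains us where "us \<in> set_pmf (replicate_pmf n (map_pmf snd L))"
    "\<theta> * (measure_pmf.prob (replicate_pmf n (map_pmf fst L)) B - measure_pmf.prob (replicate_pmf n L) (- G)) \<le>
      measure_pmf.prob (replicate_pmf n (map_pmf fst L)) {xs \<in> B. zip xs us \<in> G}"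
proof -
  let ?X = "replicate_pmf n (map_pmf fst L)" and ?U = "replicate_pmf n (map_pmf snd L)"
  let ?L = "replicate_pmf n L"
  let ?N = "replicate_pmf n (pair_pmf (map_pmf fst L) (map_pmf snd L))"
  let ?T = "{l. map fst l \<in> B}"
  have finL: "finite (set_pmf ?L)" by (rule finite_set_replicate_pmf[OF fin])
  have finU: "finite (set_pmf ?U)" and finX: "finite (set_pmf ?X)"
    by (auto intro!: finite_set_replicate_pmf simp: fin)
  obtain us where us: "us \<in> set_pmf ?U"
    "measure_pmf.expectation ?U (\<lambda>us. measure_pmf.prob ?X {xs \<in> B. zip xs us \<in> G}) \<le>
       measure_pmf.prob ?X {xs \<in> B. zip xs us \<in> G}"
    by (rule expectation_le_value[OF finU])
  have "measure_pmf.prob ?X B = measure_pmf.prob ?L ?T"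
    by (simp add: map_replicate_pmf[symmetric] vimage_def)
  also have "\<dots> \<le> measure_pmf.prob ?L (G \<inter> ?T) + measure_pmf.prob ?L (- G)"
    by (rule order_trans[OF measure_pmf.finite_measure_mono measure_Un_le]) auto
  finally have "\<theta> * (measure_pmf.prob ?X B - measure_pmf.prob ?L (- G)) \<le> \<theta> * measure_pmf.prob ?L (G \<inter> ?T)"
    using \<open>0 \<le> \<theta>\<close> by (intro mult_left_mono) auto
  \<comment> \<open>The likelihood ratio is controlled only on the support of
    \<open>replicate_pmf n L\<close>, hence this restriction before the change of measure.\<close>
  also have "measure_pmf.prob ?L (G \<inter> ?T) = measure_pmf.prob ?L (set_pmf ?L \<inter> (G \<inter> ?T))"
    by (subst measure_Int_set_pmf[symmetric]) (simp add: Int_commute)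
  also have "\<theta> * \<dots> \<le> measure_pmf.prob ?N (set_pmf ?L \<inter> (G \<inter> ?T))"
    using finL by (simp add: measure_measure_pmf_finite sum_distrib_left)
       (rule sum_mono, auto intro: ratio)
  also have "\<dots> \<le> measure_pmf.prob ?N (G \<inter> ?T)"
    by (rule measure_pmf.finite_measure_mono) auto
  also have "\<dots> = measure_pmf.expectation ?N (indicator (G \<inter> ?T))"
    by simp
  also have "\<dots> = measure_pmf.expectation (pair_pmf ?U ?X) (\<lambda>(us, xs). indicator (G \<inter> ?T) (zip xs us))"
    unfolding replicate_pair_pmf pair_commute_pmf[of ?X ?U]
    by (simp only: integral_map_pmf case_prod_unfold fst_conv snd_conv)
  also have "\<dots> = measure_pmf.expectation ?U (\<lambda>us. measure_pmf.expectation ?X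
       (\<lambda>xs. indicator (G \<inter> ?T) (zip xs us) :: real))"
    by (simp add: pair_pmf_def expectation_bind_finite finU finX)
  also have "\<dots> = measure_pmf.expectation ?U (\<lambda>us. measure_pmf.prob ?X {xs \<in> B. zip xs us \<in> G})"
  proof (rule expectation_cong_pmf)
    fix us assume us: "us \<in> set_pmf ?U"
    have "measure_pmf.expectation ?X (\<lambda>xs. indicator (G \<inter> ?T) (zip xs us) :: real) =
        measure_pmf.expectation ?X (indicator {xs \<in> B. zip xs us \<in> G})"
      by (rule expectation_cong_pmf) (use us in \<open>auto simp: set_replicate_pmf indicator_def\<close>)
    then show "measure_pmf.expectation ?X (\<lambda>xs. indicator (G \<inter> ?T) (zip xs us) :: real) =
        measure_pmf.prob ?X {xs \<in> B. zip xs us \<in> G}" by simp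
  qed
  finally show thesis using us by (intro that[of us]) auto
qed

text \<open>Codewords are picked greedily: each new one captures at least a fraction \<open>\<theta>\<close> of the uncovered
  mass exceeding \<open>L\<^sup>n(- G)\<close>.\<close>

lemma greedy_covering:
  fixes L :: "('x \<times> 'u) pmf"
  assumes fin: "finite (set_pmf L)" and \<theta>: "0 \<le> \<theta>" "\<theta> \<le> 1"
    and ratio: "\<And>l. l \<in> G \<Longrightarrow> l \<in> set_pmf (replicate_pmf n L) \<Longrightarrow> \<theta> * pmf (replicate_pmf n L) l \<le>
      pmf (replicate_pmf n (pair_pmf (map_pmf fst L) (map_pmf snd L))) l"
  shows "\<exists>c. (\<forall>k. c k \<in> set_pmf (replicate_pmf n (map_pmf snd L))) \<and>
    measure_pmf.prob (replicate_pmf n (map_pmf fst L)) {xs. \<forall>k<M. zip xs (c k) \<notin> G} \<le>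
      measure_pmf.prob (replicate_pmf n L) (- G) + (1 - \<theta>) ^ M"
proof (induction M)
  case 0
  obtain us where "us \<in> set_pmf (replicate_pmf n (map_pmf snd L))"
    by (metis ex_in_conv set_pmf_not_empty)
  then show ?case by (intro exI[of _ "\<lambda>_. us"]) simp
next
  case (Suc M)
  let ?X = "replicate_pmf n (map_pmf fst L)"
  let ?\<eta> = "measure_pmf.prob (replicate_pmf n L) (- G)"
  from Suc obtain c where c: "\<And>k. c k \<in> set_pmf (replicate_pmf n (map_pmf snd L))"
    and le: "measure_pmf.prob ?X {xs. \<forall>k<M. zip xs (c k) \<notin> G} \<le> ?\<eta> + (1 - \<theta>) ^ M" by blast
  let ?B = "{xs. \<forall>k<M. zip xs (c k) \<notin> G}"
  obtain us where us: "us \<in> set_pmf (replicate_pmf n (map_pmf snd L))"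
    "\<theta> * (measure_pmf.prob ?X ?B - ?\<eta>) \<le> measure_pmf.prob ?X {xs \<in> ?B. zip xs us \<in> G}"
    using covering_step[OF fin \<theta>(1) ratio] by blast
  let ?c = "c(M := us)"
  have "{xs. \<forall>k<Suc M. zip xs (?c k) \<notin> G} = ?B - {xs \<in> ?B. zip xs us \<in> G}"
    by (auto simp: less_Suc_eq)
  then have "measure_pmf.prob ?X {xs. \<forall>k<Suc M. zip xs (?c k) \<notin> G} =
      measure_pmf.prob ?X ?B - measure_pmf.prob ?X {xs \<in> ?B. zip xs us \<in> G}"
    by (simp only:) (rule measure_pmf.finite_measure_Diff, auto)
  \<comment> \<open>If m is the uncovered mass, then m - \<theta> (m - \<eta>) = \<eta> + (1 -
    \<theta>) (m - \<eta>): the excess over \<eta> shrinks geometrically.\<close>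
  also have "\<dots> \<le> ?\<eta> + (1 - \<theta>) * (measure_pmf.prob ?X ?B - ?\<eta>)"
    using us(2) by (simp add: algebra_simps)
  also have "\<dots> \<le> ?\<eta> + (1 - \<theta>) * (1 - \<theta>) ^ M"
    using le \<theta> by (intro add_left_mono mult_left_mono) auto
  finally have "measure_pmf.prob ?X {xs. \<forall>k<Suc M. zip xs (?c k) \<notin> G} \<le> ?\<eta> + (1 - \<theta>) ^ Suc M"
    by simp
  then show ?case using c us(1) by (intro exI[of _ ?c]) auto
qed

text \<open>Gibbs' inequality against the product of the marginals. In the covering argument it
  keeps \<theta> at most 1 and the codebook nonempty.\<close>

lemma mutual_info_nonneg:
  fixes L :: "('x \<times> 'u) pmf"
  assumes "1 < b" "finite (set_pmf L)"
  shows "0 \<le> measure_pmf.expectation L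
    (\<lambda>a. log b (pmf L a / (pmf (map_pmf fst L) (fst a) * pmf (map_pmf snd L) (snd a))))"
proof -
  have pos: "0 < pmf (map_pmf fst L) (fst a) * pmf (map_pmf snd L) (snd a)"
    if "a \<in> set_pmf L" for a
    using that by (intro mult_pos_pos pmf_positive) auto
  have "measure_pmf.expectation L
      (\<lambda>a. log b (pmf (pair_pmf (map_pmf fst L) (map_pmf snd L)) (id a) / pmf L a)) \<le> 0"
    by (rule gibbs_inequality) (use assms pos in \<open>auto simp: pmf_pair\<close>)
  also have "measure_pmf.expectation L
      (\<lambda>a. log b (pmf (pair_pmf (map_pmf fst L) (map_pmf snd L)) (id a) / pmf L a)) =
    measure_pmf.expectation L
      (\<lambda>a. - log b (pmf L a / (pmf (map_pmf fst L) (fst a) * pmf (map_pmf snd L) (snd a))))"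
  proof (rule expectation_cong_pmf)
    fix a assume a: "a \<in> set_pmf L"
    have "pmf (pair_pmf (map_pmf fst L) (map_pmf snd L)) (id a) =
        pmf (map_pmf fst L) (fst a) * pmf (map_pmf snd L) (snd a)"
      by (cases a) (simp add: pmf_pair)
    then show "log b (pmf (pair_pmf (map_pmf fst L) (map_pmf snd L)) (id a) / pmf L a) =
        - log b (pmf L a / (pmf (map_pmf fst L) (fst a) * pmf (map_pmf snd L) (snd a)))"
      using pos[OF a] pmf_positive[OF a] by (simp only: log_divide_pos minus_diff_eq)
  qed
  finally show ?thesis by simp
qed

definition info_density :: "real \<Rightarrow> ('x \<times> 'u) pmf \<Rightarrow> 'x \<times> 'u \<Rightarrow> real" where
  "info_density b L a =
     log b (pmf L a / (pmf (map_pmf fst L) (fst a) * pmf (map_pmf snd L) (snd a)))"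

text \<open>Letter by letter, \<open>L\<close> equals the product of its marginals times
  \<open>b\<close> to the power of the information density; multiplying along the word turns the
  densities into their sum.\<close>

lemma info_density_typical:
  fixes L :: "('x \<times> 'u) pmf"
  assumes "1 < b" and l: "l \<in> set_pmf (replicate_pmf n L)"
    and le: "sum_list (map (info_density b L) l) \<le> t"
  shows "b powr (- t) * pmf (replicate_pmf n L) l \<le>
    pmf (replicate_pmf n (pair_pmf (map_pmf fst L) (map_pmf snd L))) l"
proof -
  let ?N = "pair_pmf (map_pmf fst L) (map_pmf snd L)"
  have len: "length l = n" and sub: "set l \<subseteq> set_pmf L"
    using l by (auto simp: set_replicate_pmf)
  have N: "pmf ?N a = pmf (map_pmf fst L) (fst a) * pmf (map_pmf snd L) (snd a)" for a
    by (cases a) (simp add: pmf_pair)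
  have posL: "0 < pmf L a" if "a \<in> set_pmf L" for a by (rule pmf_positive[OF that])
  have posN: "0 < pmf ?N a" if "a \<in> set_pmf L" for a
    unfolding N using that by (intro mult_pos_pos pmf_positive) auto
  have "pmf L a = pmf ?N a * b powr info_density b L a" if "a \<in> set_pmf L" for a
    using posL[OF that] posN[OF that] \<open>1 < b\<close>
    by (simp add: info_density_def N[symmetric] powr_log_cancel)
  then have "(\<Prod>i<n. pmf L (l ! i)) = (\<Prod>i<n. pmf ?N (l ! i) * b powr info_density b L (l ! i))"
    using sub len by (intro prod.cong refl) (metis lessThan_iff nth_mem subsetD)
  also have "\<dots> = (\<Prod>i<n. pmf ?N (l ! i)) * b powr (\<Sum>i<n. info_density b L (l ! i))"
    using \<open>1 < b\<close> by (simp add: prod.distrib powr_sum)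
  also have "(\<Sum>i<n. info_density b L (l ! i)) = sum_list (map (info_density b L) l)"
    by (simp add: sum_list_sum_nth len atLeast0LessThan)
  also have "(\<Prod>i<n. pmf ?N (l ! i)) * b powr \<dots> \<le> (\<Prod>i<n. pmf ?N (l ! i)) * b powr t"
    using le \<open>1 < b\<close> by (intro mult_left_mono prod_nonneg) auto
  finally show ?thesis
    using len \<open>1 < b\<close> by (simp add: pmf_replicate_pmf powr_minus field_simps)
qed

text \<open>The code is judged only by averages of the test functions in \<open>\<Psi>\<close>.
  Together with the information density they define one typical set, which serves both the change of
  measure and the accuracy on covered words. Uncovered words are rare and their deviation is
  bounded.\<close>

lemma covering:
  fixes L :: "('x \<times> 'u) pmf" and \<Psi> :: "('x \<times> 'u \<Rightarrow> real) set"
  assumes b: "1 < b" and fin: "finite (set_pmf L)" and "finite \<Psi>" and \<epsilon>: "0 < \<epsilon>"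
  shows "\<forall>\<^sub>F n in sequentially. \<exists>M c f.
    0 < M \<and> log b (real M) \<le> real n * (measure_pmf.expectation L (info_density b L) + \<epsilon>) \<and>
    (\<forall>k. c k \<in> set_pmf (replicate_pmf n (map_pmf snd L))) \<and> (\<forall>xs. f xs < M) \<and>
    (\<forall>\<psi>\<in>\<Psi>. \<bar>measure_pmf.expectation (replicate_pmf n (map_pmf fst L))
        (\<lambda>xs. \<Sum>i<n. \<psi> (xs ! i, c (f xs) ! i)) - real n * measure_pmf.expectation L \<psi>\<bar> \<le> real n * \<epsilon>)"
proof -
  let ?I = "measure_pmf.expectation L (info_density b L)"
  let ?S = "set_pmf (map_pmf fst L) \<times> set_pmf (map_pmf snd L)"
  \<comment> \<open>The rate costs 3 \<open>e\<close>: twice \<open>e\<close> in the exponent of the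
    codebook size and once for rounding up. The deviation also costs 3 \<open>e\<close>: once on
    covered words and twice, through 2 \<kappa>, on the others.\<close>
  define e where "e = \<epsilon> / 4"
  have e: "0 < e" using \<epsilon> by (simp add: e_def)
  have I: "0 \<le> ?I" using mutual_info_nonneg[OF b fin] by (simp add: info_density_def[abs_def])
  have "finite ((\<lambda>(\<psi>, a). \<bar>\<psi> a\<bar> + \<bar>measure_pmf.expectation L \<psi>\<bar>) ` (\<Psi> \<times> ?S))"
    using fin \<open>finite \<Psi>\<close> by simp
  then obtain C where C0: "\<And>v. v \<in> (\<lambda>(\<psi>, a). \<bar>\<psi> a\<bar> + \<bar>measure_pmf.expectation L \<psi>\<bar>) ` (\<Psi> \<times> ?S) \<Longrightarrow> v \<le> C"
    by (meson bdd_above_finite bdd_above_def bdd_above.unfold)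
  define C' where "C' = max C 1"
  have C: "\<bar>\<psi> a - measure_pmf.expectation L \<psi>\<bar> \<le> C'" if "\<psi> \<in> \<Psi>" "a \<in> ?S" for \<psi> a
    using C0[of "\<bar>\<psi> a\<bar> + \<bar>measure_pmf.expectation L \<psi>\<bar>"] that unfolding C'_def by fastforce
  have C': "0 < C'" by (simp add: C'_def)
  define \<kappa> where "\<kappa> = e / C'"
  have \<kappa>: "0 < \<kappa>" using e C' by (simp add: \<kappa>_def)
  let ?\<Phi> = "insert (info_density b L) \<Psi>"
  have "\<forall>\<^sub>F n in sequentially. measure_pmf.prob (replicate_pmf n L)
    {l. \<exists>\<psi>\<in>?\<Phi>. \<bar>sum_list (map \<psi> l) - real n * measure_pmf.expectation L \<psi>\<bar> > real n * e} \<le> \<kappa>"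
    by (rule weak_law_finite_family) (use fin \<open>finite \<Psi>\<close> e \<kappa> in auto)
  moreover have "((\<lambda>n. exp (- (b powr (real n * e)))) \<longlongrightarrow> 0) sequentially"
    using b e by real_asymp
  then have "\<forall>\<^sub>F n in sequentially. exp (- (b powr (real n * e))) < \<kappa>"
    by (rule order_tendstoD) (rule \<kappa>)
  moreover have "\<forall>\<^sub>F n in sequentially. log b 2 \<le> real n * e"
    using e by real_asymp
  ultimately show ?thesis
  proof eventually_elim
    case (elim n)
    let ?X = "replicate_pmf n (map_pmf fst L)"
    define G where "G = {l. \<forall>\<psi>\<in>?\<Phi>. \<bar>sum_list (map \<psi> l) - real n * measure_pmf.expectation L \<psi>\<bar> \<le> real n * e}"
    have compl: "- G = {l. \<exists>\<psi>\<in>?\<Phi>. \<bar>sum_list (map \<psi> l) - real n * measure_pmf.expectation L \<psi>\<bar> > real n * e}"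
      by (auto simp: G_def not_le)
    \<comment> \<open>The exponents of \<theta> and \<open>M\<close> differ by \<open>e\<close>, so
      M \<theta> is at least b powr (n e), and (1 - \<theta>) ^ M \<le> exp (- M \<theta>) tends to
      0.\<close>
    define \<theta> where "\<theta> = b powr (- (real n * (?I + e)))"
    define M where "M = nat \<lceil>b powr (real n * (?I + 2 * e))\<rceil>"
    have ge1: "1 \<le> b powr (real n * (?I + 2 * e))"
      using b I e by (intro ge_one_powr_ge_zero) auto
    then have M: "b powr (real n * (?I + 2 * e)) \<le> real M" "real M \<le> 2 * b powr (real n * (?I + 2 * e))"
      and M0: "0 < M"
      unfolding M_def by linarith+
    have "log b (real M) \<le> log b (2 * b powr (real n * (?I + 2 * e)))"
      using M(2) M0 b by simp
    also have "\<dots> = log b 2 + real n * (?I + 2 * e)" using b by (simp add: log_mult)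
    also have "\<dots> \<le> real n * (?I + \<epsilon>)"
    proof -
      have "0 \<le> real n * e" "real n * \<epsilon> = 4 * (real n * e)" using e by (auto simp: e_def)
      then show ?thesis using elim(3) by (simp only: distrib_left)
    qed
    finally have rate: "log b (real M) \<le> real n * (?I + \<epsilon>)" .
    have \<theta>: "0 \<le> \<theta>" "\<theta> \<le> 1"
      using b I e by (auto simp: \<theta>_def powr_minus inverse_le_1_iff intro!: ge_one_powr_ge_zero)
    have ratio: "\<theta> * pmf (replicate_pmf n L) l \<le>
        pmf (replicate_pmf n (pair_pmf (map_pmf fst L) (map_pmf snd L))) l"
      if "l \<in> G" "l \<in> set_pmf (replicate_pmf n L)" for l
      unfolding \<theta>_def
      by (rule info_density_typical[OF b that(2)]) (use that(1) in \<open>auto simp: G_def algebra_simps\<close>)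
    from greedy_covering[OF fin \<theta> ratio] obtain c where
      c: "\<And>k. c k \<in> set_pmf (replicate_pmf n (map_pmf snd L))"
      and "measure_pmf.prob ?X {xs. \<forall>k<M. zip xs (c k) \<notin> G} \<le>
        measure_pmf.prob (replicate_pmf n L) (- G) + (1 - \<theta>) ^ M" by blast
    note this(2)
    also have "(1 - \<theta>) ^ M \<le> exp (- \<theta>) ^ M"
      using \<theta> exp_ge_add_one_self[of "- \<theta>"] by (intro power_mono) auto
    also have "exp (- \<theta>) ^ M = exp (- (real M * \<theta>))"
      by (simp flip: exp_of_nat_mult)
    also have "\<dots> \<le> exp (- (b powr (real n * e)))"
    proof -
      have "b powr (real n * e) = b powr (real n * (?I + 2 * e)) * \<theta>"
        unfolding \<theta>_def by (simp add: powr_add[symmetric] algebra_simps)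
      also have "\<dots> \<le> real M * \<theta>" using M(1) \<theta> by (intro mult_right_mono) auto
      finally show ?thesis by simp
    qed
    finally have fail: "measure_pmf.prob ?X {xs. \<forall>k<M. zip xs (c k) \<notin> G} \<le> 2 * \<kappa>"
      using elim(1,2) by (simp add: compl)
    \<comment> \<open>Uncovered words are sent to message 0, which exists because \<open>M\<close>
      is positive.\<close>
    define f where "f xs = (if \<exists>k<M. zip xs (c k) \<in> G then SOME k. k < M \<and> zip xs (c k) \<in> G else 0)" for xs
    have f: "f xs < M \<and> zip xs (c (f xs)) \<in> G" if "\<exists>k<M. zip xs (c k) \<in> G" for xs
      using someI_ex[OF that] that by (simp add: f_def)
    have fM: "f xs < M" for xs
      using f[of xs] M0 by (cases "\<exists>k<M. zip xs (c k) \<in> G") (auto simp: f_def)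
    have "\<bar>measure_pmf.expectation ?X (\<lambda>xs. \<Sum>i<n. \<psi> (xs ! i, c (f xs) ! i)) -
        real n * measure_pmf.expectation L \<psi>\<bar> \<le> real n * \<epsilon>" if \<psi>: "\<psi> \<in> \<Psi>" for \<psi>
    proof -
      let ?m = "measure_pmf.expectation L \<psi>"
      let ?B = "{xs. \<forall>k<M. zip xs (c k) \<notin> G}"
      have finX: "finite (set_pmf ?X)" by (rule finite_set_replicate_pmf) (simp add: fin)
      have int [simp]: "integrable (measure_pmf ?X) g" for g :: "'x list \<Rightarrow> real"
        by (rule integrable_measure_pmf_finite[OF finX])
      have "\<bar>measure_pmf.expectation ?X (\<lambda>xs. \<Sum>i<n. \<psi> (xs ! i, c (f xs) ! i)) - real n * ?m\<bar> =
          \<bar>measure_pmf.expectation ?X (\<lambda>xs. (\<Sum>i<n. \<psi> (xs ! i, c (f xs) ! i)) - real n * ?m)\<bar>"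
        by simp
      also have "\<dots> \<le> measure_pmf.expectation ?X (\<lambda>xs. \<bar>(\<Sum>i<n. \<psi> (xs ! i, c (f xs) ! i)) - real n * ?m\<bar>)"
        by (rule integral_abs_bound)
      also have "\<dots> \<le> measure_pmf.expectation ?X (\<lambda>xs. real n * e + real n * C' * indicator ?B xs)"
      proof (rule expectation_mono_pmf[OF finX])
        fix xs assume xs: "xs \<in> set_pmf ?X"
        let ?l = "zip xs (c (f xs))"
        have len: "length xs = n" "length (c (f xs)) = n"
          and mem: "\<And>i. i < n \<Longrightarrow> (xs ! i, c (f xs) ! i) \<in> ?S"
          using xs c[of "f xs"] by (auto simp: set_replicate_pmf in_lists_conv_set simp del: set_map_pmf)
        have sl: "(\<Sum>i<n. \<psi> (xs ! i, c (f xs) ! i)) = sum_list (map \<psi> ?l)"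
          by (simp add: sum_list_sum_nth len atLeast0LessThan)
        show "\<bar>(\<Sum>i<n. \<psi> (xs ! i, c (f xs) ! i)) - real n * ?m\<bar> \<le> real n * e + real n * C' * indicator ?B xs"
        proof (cases "xs \<in> ?B")
          case False
          then have "?l \<in> G" using f[of xs] by auto
          then show ?thesis using False \<psi> by (auto simp: sl G_def)
        next
          case True
          have "(\<Sum>i<n. \<psi> (xs ! i, c (f xs) ! i)) - real n * ?m = (\<Sum>i<n. \<psi> (xs ! i, c (f xs) ! i) - ?m)"
            by (simp add: sum_subtractf)
          also have "\<bar>\<dots>\<bar> \<le> (\<Sum>i<n. \<bar>\<psi> (xs ! i, c (f xs) ! i) - ?m\<bar>)" by (rule sum_abs)
          also have "\<dots> \<le> (\<Sum>i<n. C')" by (rule sum_mono) (use C[OF \<psi> mem] in auto)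
          finally have "\<bar>(\<Sum>i<n. \<psi> (xs ! i, c (f xs) ! i)) - real n * ?m\<bar> \<le> real n * C'"
            by simp
          moreover have "0 \<le> real n * e" using e by simp
          ultimately show ?thesis using True by (simp only: indicator_simps)
        qed
      qed
      also have "\<dots> = real n * e + real n * C' * measure_pmf.prob ?X ?B" by simp
      also have "\<dots> \<le> real n * e + real n * C' * (2 * \<kappa>)"
        using fail C' by (intro add_left_mono mult_left_mono) auto
      also have "\<dots> \<le> real n * \<epsilon>" using C' e by (simp add: \<kappa>_def e_def)
      finally show ?thesis .
    qed
    then show ?case using M0 rate c fM by blast
  qed
qed

section \<open>The inner region\<close>

lemma cond_entropy_pmf_kernel:
  fixes X :: "'a \<Rightarrow> 'b::countable" and Y :: "'a \<Rightarrow> 'c::countable"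
  assumes "1 < b" and fin: "finite (set_pmf p)"
  shows "cond_entropy_pmf b p X Y = measure_pmf.expectation p
    (\<lambda>a. - log b (pmf (cond_kernel (map_pmf (\<lambda>a. (Y a, X a)) p) (Y a)) (X a)))"
  unfolding cond_entropy_pmf_expectation[OF assms]
proof (rule expectation_cong_pmf)
  fix a assume a: "a \<in> set_pmf p"
  let ?m = "map_pmf (\<lambda>a. (Y a, X a)) p"
  have "pmf (map_pmf (\<lambda>a. (X a, Y a)) p) (X a, Y a) = pmf (map_pmf prod.swap ?m) (prod.swap (Y a, X a))"
    by (simp add: pmf.map_comp o_def)
  also have "\<dots> = pmf ?m (Y a, X a)" by (rule pmf_map_inj') simp
  also have "\<dots> = pmf (map_pmf Y p) (Y a) * pmf (cond_kernel ?m (Y a)) (X a)"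
    by (simp add: pmf_cond_kernel[symmetric] pmf.map_comp o_def)
  finally have "pmf (map_pmf (\<lambda>a. (X a, Y a)) p) (X a, Y a) =
      pmf (map_pmf Y p) (Y a) * pmf (cond_kernel ?m (Y a)) (X a)" .
  moreover have "pmf (map_pmf Y p) (Y a) \<noteq> 0"
    using a by (simp add: pmf_eq_0_set_pmf)
  ultimately show "- log b (pmf (map_pmf (\<lambda>a. (X a, Y a)) p) (X a, Y a) / pmf (map_pmf Y p) (Y a)) =
    - log b (pmf (cond_kernel ?m (Y a)) (X a))" by simp
qed

lemma log_prod_pos:
  fixes f :: "'a \<Rightarrow> real"
  assumes "finite A" "\<And>i. i \<in> A \<Longrightarrow> 0 < f i"
  shows "log b (\<Prod>i\<in>A. f i) = (\<Sum>i\<in>A. log b (f i))"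
proof -
  have "ln (\<Prod>i\<in>A. f i) = (\<Sum>i\<in>A. ln (f i))"
    by (rule ln_prod) (use assms in force)+
  then show ?thesis by (simp add: log_def sum_divide_distrib)
qed

lemma pmf_cond_kernel_pos:
  assumes "(a, b) \<in> set_pmf p"
  shows "0 < pmf (cond_kernel p a) b"
  using pmf_positive[OF assms] pmf_cond_kernel[of p a b]
  by (metis mult_zero_right pmf_nonneg order_less_le)

lemma cond_entropy_pmf_map:
  fixes X :: "'a \<Rightarrow> 'b::countable" and Y :: "'a \<Rightarrow> 'c::countable"
  assumes "1 < b" "finite (set_pmf p)"
  shows "cond_entropy_pmf b (map_pmf g p) X Y = cond_entropy_pmf b p (\<lambda>a. X (g a)) (\<lambda>a. Y (g a))"
  using assms by (simp add: cond_entropy_pmf_kernel pmf.map_comp o_def)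

section \<open>Calculus of single-letter laws\<close>

lemma letter_joint_bind:
  "letter_joint P J \<kappa> = bind_pmf J (\<lambda>a. letter_joint P (return_pmf a) \<kappa>)"
  by (simp add: letter_joint_def bind_return_pmf)

text \<open>A kernel that reads the auxiliary variable only through \<open>g\<close> allows it to be
  replaced by its image. In this way the past of a memoryless decoder collapses to a codeword
  letter.\<close>

lemma map_letter_joint:
  assumes "\<And>u y. \<kappa> u y = \<kappa>' (g u) y"
  shows "map_pmf (\<lambda>(u, v). (g u, v)) (letter_joint P J \<kappa>) =
    letter_joint P (map_pmf (\<lambda>(u, x). (g u, x)) J) \<kappa>'"
  unfolding letter_joint_def
  by (simp add: map_bind_pmf bind_map_pmf pmf.map_comp o_def case_prod_unfold assms)

lemma map_fst_letter_joint:
  "map_pmf (\<lambda>(u, x, _). (u, x)) (letter_joint P J \<kappa>) = J"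
  unfolding letter_joint_def
  by (simp add: map_bind_pmf pmf.map_comp o_def case_prod_unfold map_pmf_const bind_return_pmf')

lemma pmf_letter_joint:
  "pmf (letter_joint P J \<kappa>) (u, x, y, z, xh) =
    pmf J (u, x) * pmf (cond_kernel P x) (y, z) * pmf (\<kappa> u y) xh"
proof -
  let ?r = "\<lambda>(((u, x), y, z), xh). (u, x, y, z, xh)"
  let ?A = "bind_pmf J (\<lambda>a. map_pmf (Pair a) (cond_kernel P (snd a)))"
  have "letter_joint P J \<kappa> = map_pmf ?r
      (bind_pmf ?A (\<lambda>w. map_pmf (Pair w) (\<kappa> (fst (fst w)) (fst (snd w)))))"
    (is "_ = map_pmf ?r ?B")
    unfolding letter_joint_def
    by (simp add: map_bind_pmf bind_map_pmf bind_assoc_pmf pmf.map_comp o_def case_prod_unfold)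
  moreover have "inj ?r" by (auto simp: inj_def)
  ultimately have "pmf (letter_joint P J \<kappa>) (?r (((u, x), y, z), xh)) = pmf ?B (((u, x), y, z), xh)"
    using pmf_map_inj'[of ?r ?B "(((u, x), y, z), xh)"] by presburger
  then show ?thesis by (simp add: pmf_dependent_pair)
qed

lemma finite_set_letter_joint:
  fixes P :: "('x \<times> 'y::finite \<times> 'z::finite) pmf" and \<kappa> :: "'u \<Rightarrow> 'y \<Rightarrow> 'xh::finite pmf"
  assumes "finite (set_pmf J)"
  shows "finite (set_pmf (letter_joint P J \<kappa>))"
  using assms by (auto simp: letter_joint_def)

text \<open>The conditional mean of \<open>h\<close> given (x, u), a test function for the covering
  code. Its arguments follow the order of that code, opposite to the order in
  \<open>letter_joint\<close>.\<close>

definition letter_mean ::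
  "('x \<times> 'y \<times> 'z) pmf \<Rightarrow> ('u \<Rightarrow> 'y \<Rightarrow> 'xh pmf) \<Rightarrow> ('u \<times> 'x \<times> 'y \<times> 'z \<times> 'xh \<Rightarrow> real) \<Rightarrow> 'x \<times> 'u \<Rightarrow> real"
where
  "letter_mean P \<kappa> h a = measure_pmf.expectation (letter_joint P (return_pmf (prod.swap a)) \<kappa>) h"

lemma expectation_letter_joint:
  fixes P :: "('x \<times> 'y::finite \<times> 'z::finite) pmf" and \<kappa> :: "'u \<Rightarrow> 'y \<Rightarrow> 'xh::finite pmf"
  assumes "finite (set_pmf J)"
  shows "measure_pmf.expectation (letter_joint P J \<kappa>) h =
    measure_pmf.expectation J (\<lambda>(u, x). letter_mean P \<kappa> h (x, u))"
  by (subst letter_joint_bind)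
     (simp add: expectation_bind_finite assms finite_set_letter_joint letter_mean_def case_prod_unfold)

text \<open>Decoder steps count from 1 and list positions from 0, hence \<open>i - 1\<close>; the
  last entry of the observed prefix is the current side information.\<close>

definition memoryless_decoder ::
  "(nat \<Rightarrow> 'u list) \<Rightarrow> ('u \<Rightarrow> 'y \<Rightarrow> 'xh pmf) \<Rightarrow> nat \<Rightarrow> nat \<Rightarrow> 'y list \<Rightarrow> 'xh list \<Rightarrow> 'xh pmf" where
  "memoryless_decoder c \<kappa> i w ys xhs = \<kappa> (c w ! (i - 1)) (last ys)"

lemma memoryless_law:
  fixes P :: "('x \<times> 'y \<times> 'z) pmf"
  assumes "i < n"
  shows "map_pmf (\<lambda>(s, xhs). (c (f (map fst s)) ! i, fst (s ! i), fst (snd (s ! i)), snd (snd (s ! i)), xhs ! i))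
      (code_pmf P n f (memoryless_decoder c \<kappa>)) =
    letter_joint P (map_pmf (\<lambda>xs. (c (f xs) ! i, xs ! i)) (replicate_pmf n (map_pmf fst P))) \<kappa>"
proof -
  let ?C = "code_pmf P n f (memoryless_decoder c \<kappa>)"
  let ?J = "past_pmf P n f (memoryless_decoder c \<kappa>) i"
  let ?g = "\<lambda>(w, ys :: 'y list, xhs :: 'c list). c w ! i"
  have "map_pmf (\<lambda>(s, xhs). (c (f (map fst s)) ! i, fst (s ! i), fst (snd (s ! i)), snd (snd (s ! i)), xhs ! i)) ?C =
    map_pmf (\<lambda>(u, v). (?g u, v)) (map_pmf (\<lambda>(s, xhs). ((f (map fst s), take i (map (fst \<circ> snd) s), take i xhs),
      fst (s ! i), fst (snd (s ! i)), snd (snd (s ! i)), xhs ! i)) ?C)"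
    by (simp add: pmf.map_comp o_def case_prod_unfold)
  also have "\<dots> = letter_joint P (map_pmf (\<lambda>(u, x). (?g u, x)) ?J) \<kappa>"
    unfolding single_letter_law[OF assms]
    by (rule map_letter_joint) (auto simp: memoryless_decoder_def)
  also have "map_pmf (\<lambda>(u, x). (?g u, x)) ?J =
      map_pmf (\<lambda>(w, x). (c w ! i, x)) (map_pmf (\<lambda>((w, _), x). (w, x)) ?J)"
    by (simp add: pmf.map_comp o_def case_prod_unfold)
  also have "\<dots> = map_pmf (\<lambda>xs. (c (f xs) ! i, xs ! i)) (replicate_pmf n (map_pmf fst P))"
    unfolding message_letter_past_pmf[OF assms] by (simp add: pmf.map_comp o_def)
  finally show ?thesis .
qed

text \<open>Letterwise statistics of the code become averages of functions of (x, u), which are what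
  covering controls.\<close>

lemma expectation_memoryless_code:
  fixes P :: "('x::finite \<times> 'y::finite \<times> 'z::finite) pmf" and \<kappa> :: "'u \<Rightarrow> 'y \<Rightarrow> 'xh::finite pmf"
  shows "measure_pmf.expectation (code_pmf P n f (memoryless_decoder c \<kappa>))
      (\<lambda>(s, xhs). \<Sum>i<n. h (c (f (map fst s)) ! i, fst (s ! i), fst (snd (s ! i)), snd (snd (s ! i)), xhs ! i)) =
    measure_pmf.expectation (replicate_pmf n (map_pmf fst P))
      (\<lambda>xs. \<Sum>i<n. letter_mean P \<kappa> h (xs ! i, c (f xs) ! i))"
proof -
  let ?C = "code_pmf P n f (memoryless_decoder c \<kappa>)"
  let ?X = "replicate_pmf n (map_pmf fst P)"
  let ?T = "\<lambda>i (s, xhs). (c (f (map fst s)) ! i, fst (s ! i), fst (snd (s ! i)), snd (snd (s ! i)), xhs ! i)"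
  have finX: "finite (set_pmf ?X)" by (rule finite_set_replicate_pmf) simp
  have "measure_pmf.expectation ?C (\<lambda>w. \<Sum>i<n. h (?T i w)) = (\<Sum>i<n. measure_pmf.expectation ?C (\<lambda>w. h (?T i w)))"
    by (intro Bochner_Integration.integral_sum integrable_measure_pmf_finite finite_set_code_pmf)
  also have "\<dots> = (\<Sum>i<n. measure_pmf.expectation (map_pmf (?T i) ?C) h)" by simp
  also have "\<dots> = (\<Sum>i<n. measure_pmf.expectation ?X (\<lambda>xs. letter_mean P \<kappa> h (xs ! i, c (f xs) ! i)))"
    by (intro sum.cong refl) (simp add: memoryless_law expectation_letter_joint finX del: integral_map_pmf, simp)
  also have "\<dots> = measure_pmf.expectation ?X (\<lambda>xs. \<Sum>i<n. letter_mean P \<kappa> h (xs ! i, c (f xs) ! i))"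
    by (intro Bochner_Integration.integral_sum[symmetric] integrable_measure_pmf_finite finX)
  finally show ?thesis by (simp add: case_prod_unfold)
qed

text \<open>Gibbs' inequality against the law that draws \<open>w\<close> uniformly, \<open>z\<^sup>n\<close> and \<open>(x\<^sup>n, y\<^sup>n)\<close> letter by letter
  from \<open>qz\<close> and \<open>qxy\<close>, and \<open>xh\<^sup>n\<close> from its true conditional law given \<open>(w, z\<^sup>n)\<close>.\<close>

lemma memoryless_equivocation_ge:
  fixes P :: "('x::finite \<times> 'y::finite \<times> 'z::finite) pmf" and \<kappa> :: "'u \<Rightarrow> 'y \<Rightarrow> 'xh::finite pmf"
    and qxy :: "'u \<times> 'z \<times> 'xh \<Rightarrow> ('x \<times> 'y) pmf" and qz :: "'u \<Rightarrow> 'z pmf"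
  assumes b: "1 < b" and f: "\<And>xs. f xs < M"
    and qxy: "\<And>a v. 0 < pmf (qxy a) v" and qz: "\<And>a v. 0 < pmf (qz a) v"
  defines "\<psi> \<equiv> \<lambda>(u, x, y, z, xh). log b (pmf (qz u) z * pmf (qxy (u, z, xh)) (x, y) /
    (pmf P (x, y, z) * pmf (\<kappa> u y) xh))"
  shows "measure_pmf.expectation (code_pmf P n f (memoryless_decoder c \<kappa>))
      (\<lambda>(s, xhs). \<Sum>i<n. \<psi> (c (f (map fst s)) ! i, fst (s ! i), fst (snd (s ! i)), snd (snd (s ! i)), xhs ! i))
      - log b (real M) \<le>
    cond_entropy_pmf b (code_pmf P n f (memoryless_decoder c \<kappa>)) snd
      (\<lambda>(s, xhs). (f (map fst s), map (snd \<circ> snd) s))"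
proof -
  let ?p = "code_pmf P n f (memoryless_decoder c \<kappa>)"
  let ?T = "\<lambda>i (s, xhs). (c (f (map fst s)) ! i, fst (s ! i), fst (snd (s ! i)), snd (snd (s ! i)), xhs ! i)"
  define V where "V = (\<lambda>(s :: ('x \<times> 'y \<times> 'z) list, xhs :: 'xh list). (f (map fst s), map (snd \<circ> snd) s))"
  let ?m = "map_pmf (\<lambda>a. (V a, snd a)) ?p"
  \<comment> \<open>The position is read off the length of the word drawn so far, so
    \<open>seq_pmf\<close> yields independent letters with varying laws.\<close>
  define Q1 where "Q1 = bind_pmf (pmf_of_set {..<M}) (\<lambda>w. map_pmf (Pair w) (seq_pmf (\<lambda>l. qz (c w ! length l)) n))"
  define Q2 where "Q2 = bind_pmf Q1 (\<lambda>a. map_pmf (Pair a) (cond_kernel ?m a))"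
  define Q where "Q = bind_pmf Q2 (\<lambda>a. map_pmf (Pair a)
     (seq_pmf (\<lambda>l. qxy (c (fst (fst a)) ! length l, snd (fst a) ! length l, snd a ! length l)) n))"
  \<comment> \<open>The sample is regrouped in the order in which \<open>Q\<close> draws it;
    splitting each source letter into z and (x, y) loses nothing.\<close>
  define h where "h a = ((V a, snd a), map (\<lambda>(x, y, z). (x, y)) (fst a))" for a :: "('x \<times> 'y \<times> 'z) list \<times> 'xh list"
  have M: "{..<M} \<noteq> {}" using f[of undefined] by auto
  have M0: "0 < real M" using f[of undefined] by simp
  have fin: "finite (set_pmf ?p)" by (rule finite_set_code_pmf)
  have int [simp]: "integrable (measure_pmf ?p) g" for g :: "_ \<Rightarrow> real"
    by (rule integrable_measure_pmf_finite[OF fin])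
  have pm: "pmf (cond_kernel ?m (V a)) (snd a) > 0" if "a \<in> set_pmf ?p" for a
    by (rule pmf_cond_kernel_pos) (use that in auto)
  have Qh: "pmf Q (h a) = pmf (cond_kernel ?m (V a)) (snd a) / M *
     (\<Prod>i<n. case ?T i a of (u, x, y, z, xh) \<Rightarrow> pmf (qz u) z * pmf (qxy (u, z, xh)) (x, y))"
    if "a \<in> set_pmf ?p" for a
  proof -
    obtain s xhs where a: "a = (s, xhs)" by (cases a)
    note len = set_code_pmf[OF that[unfolded a]]
    show ?thesis
      using M f by (simp add: Q_def Q2_def Q1_def h_def pmf_dependent_pair pmf_seq_pmf V_def len a
          prod.distrib case_prod_unfold min_def cong: prod.cong_simp)
  qed
  have ph: "pmf ?p a = (\<Prod>i<n. case ?T i a of (u, x, y, z, xh) \<Rightarrow> pmf P (x, y, z) * pmf (\<kappa> u y) xh)"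
    if "a \<in> set_pmf ?p" for a
  proof -
    obtain s xhs where a: "a = (s, xhs)" by (cases a)
    note len = set_code_pmf[OF that[unfolded a]]
    show ?thesis by (simp add: a pmf_code_pmf len memoryless_decoder_def)
  qed
  \<comment> \<open>The last summand has mean minus the equivocation, so Gibbs' inequality becomes
    the claimed lower bound after averaging.\<close>
  have eq: "log b (pmf Q (h a) / pmf ?p a) =
     (\<Sum>i<n. \<psi> (?T i a)) - log b M + log b (pmf (cond_kernel ?m (V a)) (snd a))"
    if a: "a \<in> set_pmf ?p" for a
  proof -
    let ?A = "\<lambda>i. case ?T i a of (u, x, y, z, xh) \<Rightarrow> pmf (qz u) z * pmf (qxy (u, z, xh)) (x, y)"
    let ?B = "\<lambda>i. case ?T i a of (u, x, y, z, xh) \<Rightarrow> pmf P (x, y, z) * pmf (\<kappa> u y) xh"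
    have A: "0 < ?A i" for i using qxy qz by (simp add: case_prod_unfold)
    have "(\<Prod>i<n. ?B i) \<noteq> 0"
      using pmf_positive[OF a] unfolding ph[OF a] by (rule less_imp_neq[symmetric])
    then have B: "0 < ?B i" if "i < n" for i
      using that by (auto simp: less_le case_prod_unfold)
    have "pmf Q (h a) / pmf ?p a = pmf (cond_kernel ?m (V a)) (snd a) / M * (\<Prod>i<n. ?A i / ?B i)"
      unfolding Qh[OF a] ph[OF a] by (simp add: prod_dividef)
    moreover have "0 < pmf (cond_kernel ?m (V a)) (snd a) / M" using pm[OF a] M0 by (rule divide_pos_pos)
    moreover have AB: "0 < ?A i / ?B i" if "i < n" for i
      using A[of i] B[OF that] by (rule divide_pos_pos)
    then have "0 < (\<Prod>i<n. ?A i / ?B i)" by (intro prod_pos) auto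
    ultimately have "log b (pmf Q (h a) / pmf ?p a) =
       log b (pmf (cond_kernel ?m (V a)) (snd a) / M) + log b (\<Prod>i<n. ?A i / ?B i)"
      by (simp only: log_mult_pos)
    also have "log b (pmf (cond_kernel ?m (V a)) (snd a) / M) = log b (pmf (cond_kernel ?m (V a)) (snd a)) - log b M"
      using pm[OF a] M0 by (rule log_divide_pos)
    also have "log b (\<Prod>i<n. ?A i / ?B i) = (\<Sum>i<n. log b (?A i / ?B i))"
      using AB by (intro log_prod_pos) auto
    also have "\<dots> = (\<Sum>i<n. \<psi> (?T i a))" by (simp add: \<psi>_def case_prod_unfold)
    finally show ?thesis by simp
  qed
  have "measure_pmf.expectation ?p (\<lambda>a. log b (pmf Q (h a) / pmf ?p a)) \<le> 0"
  proof (rule gibbs_inequality[OF b fin])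
    show "inj_on h (set_pmf ?p)"
    proof (rule inj_onI)
      fix a a' assume "a \<in> set_pmf ?p" "a' \<in> set_pmf ?p" and eq: "h a = h a'"
      then have len: "length (fst a) = length (fst a')"
        by (metis prod.collapse set_code_pmf(1))
      have "fst a ! i = fst a' ! i" if "i < length (fst a)" for i
      proof -
        have "map (\<lambda>(x, y, z). (x, y)) (fst a) ! i = map (\<lambda>(x, y, z). (x, y)) (fst a') ! i"
          "map (snd \<circ> snd) (fst a) ! i = map (snd \<circ> snd) (fst a') ! i"
          using eq by (auto simp: h_def V_def case_prod_unfold)
        with that len show ?thesis by (simp add: prod_eq_iff case_prod_unfold)
      qed
      with len have "fst a = fst a'" by (intro nth_equalityI) auto
      moreover have "snd a = snd a'" using eq by (simp add: h_def)
      ultimately show "a = a'" by (simp add: prod_eq_iff)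
    qed
    show "0 < pmf Q (h a)" if "a \<in> set_pmf ?p" for a
      unfolding Qh[OF that] using pm[OF that] M0 qxy qz
      by (intro mult_pos_pos divide_pos_pos prod_pos) (simp_all add: case_prod_unfold)
  qed
  also have "measure_pmf.expectation ?p (\<lambda>a. log b (pmf Q (h a) / pmf ?p a)) =
    measure_pmf.expectation ?p (\<lambda>a. (\<Sum>i<n. \<psi> (?T i a)) - log b M + log b (pmf (cond_kernel ?m (V a)) (snd a)))"
    by (rule expectation_cong_pmf) (rule eq)
  also have "\<dots> = measure_pmf.expectation ?p (\<lambda>a. \<Sum>i<n. \<psi> (?T i a)) - log b M
      - measure_pmf.expectation ?p (\<lambda>a. - log b (pmf (cond_kernel ?m (V a)) (snd a)))"
    by (simp del: Bochner_Integration.integral_sum)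
  also have "measure_pmf.expectation ?p (\<lambda>a. - log b (pmf (cond_kernel ?m (V a)) (snd a))) =
     cond_entropy_pmf b ?p snd V"
    by (rule cond_entropy_pmf_kernel[OF b fin, symmetric])
  finally show ?thesis by (simp add: V_def case_prod_unfold)
qed

text \<open>A mixture with the uniform law. Strict positivity makes the reference law admissible for
  every pairing of source and codeword letters.\<close>

definition smooth :: "real \<Rightarrow> 'a pmf \<Rightarrow> 'a pmf" where
  "smooth \<eta> r = bind_pmf (bernoulli_pmf \<eta>) (\<lambda>B. if B then pmf_of_set UNIV else r)"

lemma pmf_smooth:
  fixes r :: "'a::finite pmf"
  assumes "0 \<le> \<eta>" "\<eta> \<le> 1"
  shows "pmf (smooth \<eta> r) a = \<eta> / CARD('a) + (1 - \<eta>) * pmf r a"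
  using assms by (simp add: smooth_def pmf_bind)

lemma pmf_smooth_ge:
  fixes r :: "'a::finite pmf"
  assumes "0 \<le> \<eta>" "\<eta> \<le> 1"
  shows "(1 - \<eta>) * pmf r a \<le> pmf (smooth \<eta> r) a"
  using assms by (simp add: pmf_smooth)

lemma pmf_smooth_pos:
  fixes r :: "'a::finite pmf"
  assumes "0 < \<eta>" "\<eta> < 1"
  shows "0 < pmf (smooth \<eta> r) a"
  using assms by (simp add: pmf_smooth add_pos_nonneg)

lemma pmf_map_inj_eq:
  assumes "inj g" "g a = c"
  shows "pmf (map_pmf g p) c = pmf p a"
  using pmf_map_inj'[OF assms(1), of p a] assms(2) by simp

text \<open>The letter law factors as L(x,u) P(y,z|x) \<kappa>(xh|u,y) and, by the chain rule, as
  P(u) P(z|u) P(xh|u,z) P(x,y|u,z,xh). Comparing the two leaves the likelihood ratio of (x, u)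
  divided by P(xh|u,z); the mean of its logarithm is I(X;U) + H(Xh|U,Z).\<close>

lemma letter_density_factorization:
  fixes P :: "('x \<times> 'y \<times> 'z) pmf" and L :: "('x \<times> 'u) pmf" and \<kappa> :: "'u \<Rightarrow> 'y \<Rightarrow> 'xh pmf"
  assumes marg: "map_pmf fst L = map_pmf fst P"
  defines "J' \<equiv> letter_joint P (map_pmf prod.swap L) \<kappa>"
  defines "m1 \<equiv> map_pmf (\<lambda>(u, x, y, z, xh). ((u, z, xh), (x, y))) J'"
    and "m2 \<equiv> map_pmf (\<lambda>(u, x, y, z, xh). (u, z)) J'"
    and "m3 \<equiv> map_pmf (\<lambda>(u, x, y, z, xh). ((u, z), xh)) J'"
  assumes mem: "(u, x, y, z, xh) \<in> set_pmf J'"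
  shows "pmf (cond_kernel m2 u) z * pmf (cond_kernel m1 (u, z, xh)) (x, y) /
      (pmf P (x, y, z) * pmf (\<kappa> u y) xh) =
    pmf L (x, u) / (pmf (map_pmf fst L) x * pmf (map_pmf snd L) u) / pmf (cond_kernel m3 (u, z)) xh"
    and "0 < pmf (cond_kernel m3 (u, z)) xh"
    and "0 < pmf L (x, u) / (pmf (map_pmf fst L) x * pmf (map_pmf snd L) u)"
    and "0 < pmf P (x, y, z) * pmf (\<kappa> u y) xh"
proof -
  have "pmf J' (u, x, y, z, xh) = pmf (map_pmf prod.swap L) (u, x) * pmf (cond_kernel P x) (y, z) * pmf (\<kappa> u y) xh"
    unfolding J'_def by (rule pmf_letter_joint)
  then have a: "pmf J' (u, x, y, z, xh) = pmf L (x, u) * pmf (cond_kernel P x) (y, z) * pmf (\<kappa> u y) xh"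
    by (simp add: pmf_map_inj_eq[of prod.swap "(x, u)"])
  have J'pos: "0 < pmf J' (u, x, y, z, xh)" by (rule pmf_positive[OF mem])
  have P: "pmf P (x, y, z) = pmf (map_pmf fst L) x * pmf (cond_kernel P x) (y, z)"
    by (simp add: marg pmf_cond_kernel)
  have m1: "pmf (map_pmf fst m1) (u, z, xh) * pmf (cond_kernel m1 (u, z, xh)) (x, y) = pmf J' (u, x, y, z, xh)"
    unfolding pmf_cond_kernel unfolding m1_def by (rule pmf_map_inj_eq) (auto simp: inj_def)
  have "map_pmf fst m2 = map_pmf fst (map_pmf (\<lambda>(u, x, _). (u, x)) J')"
    by (simp add: m2_def pmf.map_comp o_def case_prod_unfold)
  also have "\<dots> = map_pmf snd L"
    unfolding J'_def map_fst_letter_joint by (simp add: pmf.map_comp o_def)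
  finally have m2: "pmf (map_pmf snd L) u * pmf (cond_kernel m2 u) z = pmf m2 (u, z)"
    using pmf_cond_kernel[of m2 u z] by simp
  have "map_pmf fst m3 = m2"
    by (simp add: m2_def m3_def pmf.map_comp o_def case_prod_unfold)
  then have m3: "pmf m2 (u, z) * pmf (cond_kernel m3 (u, z)) xh = pmf m3 ((u, z), xh)"
    using pmf_cond_kernel[of m3 "(u, z)" xh] by simp
  have "m3 = map_pmf (\<lambda>(u, z, xh). ((u, z), xh)) (map_pmf fst m1)"
    by (simp add: m1_def m3_def pmf.map_comp o_def case_prod_unfold)
  then have m31: "pmf m3 ((u, z), xh) = pmf (map_pmf fst m1) (u, z, xh)"
    by (simp only:) (rule pmf_map_inj_eq, auto simp: inj_def)
  have prod: "pmf (map_pmf snd L) u * pmf (cond_kernel m2 u) z * pmf (cond_kernel m3 (u, z)) xh *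
      pmf (cond_kernel m1 (u, z, xh)) (x, y) = pmf L (x, u) * pmf (cond_kernel P x) (y, z) * pmf (\<kappa> u y) xh"
    using m1 m2 m3 m31 a by simp
  have pos: "0 < pmf L (x, u)" "0 < pmf (cond_kernel P x) (y, z)" "0 < pmf (\<kappa> u y) xh"
    using J'pos unfolding a by (simp_all add: less_le)
  then have "(x, u) \<in> set_pmf L" by (simp add: pmf_positive_iff)
  then have margpos: "0 < pmf (map_pmf fst L) x" "0 < pmf (map_pmf snd L) u"
    by (auto intro!: pmf_positive simp del: set_map_pmf) (force intro!: pmf_positive)+
  have "pmf (map_pmf snd L) u * pmf (cond_kernel m2 u) z * pmf (cond_kernel m3 (u, z)) xh *
      pmf (cond_kernel m1 (u, z, xh)) (x, y) \<noteq> 0"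
    unfolding prod using pos by simp
  then have k3: "pmf (cond_kernel m3 (u, z)) xh \<noteq> 0" by auto
  then show "0 < pmf (cond_kernel m3 (u, z)) xh" by (simp add: less_le)
  show "0 < pmf L (x, u) / (pmf (map_pmf fst L) x * pmf (map_pmf snd L) u)"
    using pos margpos by simp
  show "0 < pmf P (x, y, z) * pmf (\<kappa> u y) xh"
    unfolding P using pos margpos by simp
  show "pmf (cond_kernel m2 u) z * pmf (cond_kernel m1 (u, z, xh)) (x, y) /
      (pmf P (x, y, z) * pmf (\<kappa> u y) xh) =
    pmf L (x, u) / (pmf (map_pmf fst L) x * pmf (map_pmf snd L) u) / pmf (cond_kernel m3 (u, z)) xh"
    unfolding P using prod pos margpos k3 by (simp add: divide_simps) (simp add: mult_ac)
qed

text \<open>The factorization in logarithmic form, averaged. Smoothing lowers each of the two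
  conditional laws at most by the factor 1 - \<eta>, whence the loss 2 log (1 - \<eta>).\<close>

lemma smoothed_letter_mean_ge:
  fixes P :: "('x::finite \<times> 'y::finite \<times> 'z::finite) pmf" and L :: "('x \<times> nat) pmf"
    and \<kappa> :: "nat \<Rightarrow> 'y \<Rightarrow> 'xh::finite pmf"
  assumes b: "1 < b" and fin: "finite (set_pmf L)" and marg: "map_pmf fst L = map_pmf fst P"
    and \<eta>: "0 < \<eta>" "\<eta> < 1"
  defines "J' \<equiv> letter_joint P (map_pmf prod.swap L) \<kappa>"
  defines "qxy \<equiv> \<lambda>v. smooth \<eta> (cond_kernel (map_pmf (\<lambda>(u, x, y, z, xh). ((u, z, xh), (x, y))) J') v)"
    and "qz \<equiv> \<lambda>u. smooth \<eta> (cond_kernel (map_pmf (\<lambda>(u, x, y, z, xh). (u, z)) J') u)"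
  shows "measure_pmf.expectation L (info_density b L) +
      cond_entropy_pmf b J' (\<lambda>(u, x, y, z, xh). xh) (\<lambda>(u, x, y, z, xh). (u, z)) + 2 * log b (1 - \<eta>) \<le>
    measure_pmf.expectation J' (\<lambda>(u, x, y, z, xh). log b (pmf (qz u) z * pmf (qxy (u, z, xh)) (x, y) /
      (pmf P (x, y, z) * pmf (\<kappa> u y) xh)))"
proof -
  let ?m3 = "map_pmf (\<lambda>(u, x, y, z, xh). ((u, z), xh)) J'"
  have finJ: "finite (set_pmf J')" unfolding J'_def by (rule finite_set_letter_joint) (simp add: fin)
  have int [simp]: "integrable (measure_pmf J') g" for g :: "_ \<Rightarrow> real"
    by (rule integrable_measure_pmf_finite[OF finJ])
  have L: "L = map_pmf (\<lambda>(u, x, _). (x, u)) J'"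
  proof -
    have "map_pmf (\<lambda>(u, x, _). (x, u)) J' = map_pmf prod.swap (map_pmf (\<lambda>(u, x, _). (u, x)) J')"
      by (simp add: pmf.map_comp o_def case_prod_unfold)
    also have "\<dots> = L" unfolding J'_def map_fst_letter_joint by (simp add: pmf.map_comp o_def)
    finally show ?thesis by simp
  qed
  have ent: "cond_entropy_pmf b J' (\<lambda>(u, x, y, z, xh). xh) (\<lambda>(u, x, y, z, xh). (u, z)) =
      measure_pmf.expectation J' (\<lambda>(u, x, y, z, xh). - log b (pmf (cond_kernel ?m3 (u, z)) xh))"
    by (simp add: cond_entropy_pmf_kernel[OF b finJ] case_prod_unfold)
  have "measure_pmf.expectation L (info_density b L) =
      measure_pmf.expectation J' (\<lambda>(u, x, _). info_density b L (x, u))"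
    by (subst (1) L) (simp add: case_prod_unfold)
  then have "measure_pmf.expectation L (info_density b L) +
      cond_entropy_pmf b J' (\<lambda>(u, x, y, z, xh). xh) (\<lambda>(u, x, y, z, xh). (u, z)) + 2 * log b (1 - \<eta>) =
    measure_pmf.expectation J' (\<lambda>(u, x, y, z, xh). info_density b L (x, u) - log b (pmf (cond_kernel ?m3 (u, z)) xh)
       + 2 * log b (1 - \<eta>))"
    unfolding ent by (simp add: case_prod_unfold)
  also have "\<dots> \<le> measure_pmf.expectation J' (\<lambda>(u, x, y, z, xh). log b (pmf (qz u) z * pmf (qxy (u, z, xh)) (x, y) /
      (pmf P (x, y, z) * pmf (\<kappa> u y) xh)))"
  proof (rule expectation_mono_pmf[OF finJ])
    fix a assume "a \<in> set_pmf J'"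
    moreover obtain u x y z xh where a: "a = (u, x, y, z, xh)" by (cases a) auto
    ultimately have mem: "(u, x, y, z, xh) \<in> set_pmf J'" by simp
    note fact = letter_density_factorization[OF marg mem[unfolded J'_def], folded J'_def]
    let ?k1 = "pmf (cond_kernel (map_pmf (\<lambda>(u, x, y, z, xh). ((u, z, xh), (x, y))) J') (u, z, xh)) (x, y)"
    let ?k2 = "pmf (cond_kernel (map_pmf (\<lambda>(u, x, y, z, xh). (u, z)) J') u) z"
    let ?k3 = "pmf (cond_kernel ?m3 (u, z)) xh"
    let ?D = "pmf L (x, u) / (pmf (map_pmf fst L) x * pmf (map_pmf snd L) u)"
    let ?R = "pmf P (x, y, z) * pmf (\<kappa> u y) xh"
    have "(1 - \<eta>)\<^sup>2 * (?k2 * ?k1) = ((1 - \<eta>) * ?k2) * ((1 - \<eta>) * ?k1)" by (simp add: power2_eq_square)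
    also have "\<dots> \<le> pmf (qz u) z * pmf (qxy (u, z, xh)) (x, y)"
      unfolding qxy_def qz_def using \<eta> by (intro mult_mono pmf_smooth_ge) auto
    finally have "(1 - \<eta>)\<^sup>2 * (?k2 * ?k1 / ?R) \<le> pmf (qz u) z * pmf (qxy (u, z, xh)) (x, y) / ?R"
      using fact(4) by (simp add: divide_right_mono)
    then have le: "(1 - \<eta>)\<^sup>2 * (?D / ?k3) \<le> pmf (qz u) z * pmf (qxy (u, z, xh)) (x, y) / ?R"
      unfolding fact(1) .
    have Dk: "0 < ?D / ?k3" by (rule divide_pos_pos[OF fact(3,2)])
    have \<eta>2: "0 < (1 - \<eta>)\<^sup>2" using \<eta> by simp
    have "log b ((1 - \<eta>)\<^sup>2 * (?D / ?k3)) \<le> log b (pmf (qz u) z * pmf (qxy (u, z, xh)) (x, y) / ?R)"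
      by (rule log_mono[OF b mult_pos_pos[OF \<eta>2 Dk] le])
    also have "log b ((1 - \<eta>)\<^sup>2 * (?D / ?k3)) = 2 * log b (1 - \<eta>) + (log b ?D - log b ?k3)"
      unfolding log_mult_pos[OF \<eta>2 Dk] log_divide_pos[OF fact(3,2)] using \<eta> by (simp add: log_nat_power)
    finally show "(case a of (u, x, y, z, xh) \<Rightarrow> info_density b L (x, u) - log b (pmf (cond_kernel ?m3 (u, z)) xh)
       + 2 * log b (1 - \<eta>)) \<le> (case a of (u, x, y, z, xh) \<Rightarrow> log b (pmf (qz u) z * pmf (qxy (u, z, xh)) (x, y) /
      (pmf P (x, y, z) * pmf (\<kappa> u y) xh)))"
      by (simp add: a info_density_def)
  qed
  finally show ?thesis .
qed

text \<open>\<open>joint_in\<close> draws (y, z) before u, \<open>letter_joint\<close> after it;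
  given x the two are independent.\<close>

lemma joint_in_eq:
  "joint_in P PU PXh = map_pmf (\<lambda>(u, x, y, z, xh). (x, y, z, u, xh)) (letter_joint P
     (map_pmf prod.swap (bind_pmf (map_pmf fst P) (\<lambda>x. map_pmf (Pair x) (PU x)))) PXh)"
proof -
  have "joint_in P PU PXh = bind_pmf (bind_pmf (map_pmf fst P) (\<lambda>a. map_pmf (Pair a) (cond_kernel P a)))
     (\<lambda>(x, y, z). bind_pmf (PU x) (\<lambda>u. map_pmf (\<lambda>xh. (x, y, z, u, xh)) (PXh u y)))"
    unfolding bind_cond_kernel joint_in_def by (simp add: map_pmf_def case_prod_unfold)
  also have "\<dots> = bind_pmf (map_pmf fst P) (\<lambda>x. bind_pmf (cond_kernel P x) (\<lambda>(y, z). bind_pmf (PU x)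
       (\<lambda>u. map_pmf (\<lambda>xh. (x, y, z, u, xh)) (PXh u y))))"
    by (simp add: bind_assoc_pmf bind_map_pmf case_prod_unfold)
  also have "\<dots> = bind_pmf (map_pmf fst P) (\<lambda>x. bind_pmf (PU x) (\<lambda>u. bind_pmf (cond_kernel P x)
       (\<lambda>(y, z). map_pmf (\<lambda>xh. (x, y, z, u, xh)) (PXh u y))))"
    unfolding case_prod_unfold by (subst bind_commute_pmf) (rule refl)
  also have "\<dots> = map_pmf (\<lambda>(u, x, y, z, xh). (x, y, z, u, xh)) (letter_joint P
     (map_pmf prod.swap (bind_pmf (map_pmf fst P) (\<lambda>x. map_pmf (Pair x) (PU x)))) PXh)"
    by (simp add: letter_joint_def map_bind_pmf bind_map_pmf bind_assoc_pmf pmf.map_comp o_def case_prod_unfold)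
  finally show ?thesis .
qed

section \<open>Evaluation of the covering code\<close>

lemma expectation_avg_distortion:
  fixes P :: "('x \<times> 'y \<times> 'z) pmf"
  shows "measure_pmf.expectation (code_joint P n f q)
      (\<lambda>(xs, ys, zs, w, xhs). avg_distortion F d n xs ys xhs) =
    (1 / real n) * measure_pmf.expectation (code_pmf P n f q)
      (\<lambda>(s, xhs). \<Sum>i<n. d (F (fst (s ! i)) (fst (snd (s ! i)))) (xhs ! i))"
proof -
  have "measure_pmf.expectation (code_joint P n f q)
      (\<lambda>(xs, ys, zs, w, xhs). avg_distortion F d n xs ys xhs) =
    measure_pmf.expectation (code_pmf P n f q)
      (\<lambda>(s, xhs). avg_distortion F d n (map fst s) (map (fst \<circ> snd) s) xhs)"
    unfolding code_joint_eq_map_code_pmf by (simp add: case_prod_unfold)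
  also have "\<dots> = measure_pmf.expectation (code_pmf P n f q)
      (\<lambda>(s, xhs). (1 / real n) * (\<Sum>i<n. d (F (fst (s ! i)) (fst (snd (s ! i)))) (xhs ! i)))"
    by (rule expectation_cong_pmf) (auto simp: avg_distortion_def dest: set_code_pmf(1))
  also have "\<dots> = (1 / real n) * measure_pmf.expectation (code_pmf P n f q)
      (\<lambda>(s, xhs). \<Sum>i<n. d (F (fst (s ! i)) (fst (snd (s ! i)))) (xhs ! i))"
    unfolding case_prod_unfold by (rule integral_mult_right_zero)
  finally show ?thesis .
qed

lemma cond_entropy_code_joint:
  fixes P :: "('x::finite \<times> 'y::finite \<times> 'z::finite) pmf"
    and q :: "nat \<Rightarrow> nat \<Rightarrow> 'y list \<Rightarrow> 'xh::finite list \<Rightarrow> 'xh pmf"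
  assumes "1 < b"
  shows "cond_entropy_pmf b (code_joint P n f q)
      (\<lambda>(xs, ys, zs, w, xhs). xhs) (\<lambda>(xs, ys, zs, w, xhs). (w, zs)) =
    cond_entropy_pmf b (code_pmf P n f q) snd (\<lambda>(s, xhs). (f (map fst s), map (snd \<circ> snd) s))"
  unfolding code_joint_eq_map_code_pmf
  by (simp add: cond_entropy_pmf_map[OF assms finite_set_code_pmf] case_prod_unfold)

lemma region_in_subset_region_eve:
  fixes P :: "('x::finite \<times> 'y::finite \<times> 'z::finite) pmf"
    and F :: "'x \<Rightarrow> 'y \<Rightarrow> 'f"
    and d :: "'f \<Rightarrow> 'xh::finite \<Rightarrow> real"
  assumes b: "1 < b"
  shows "region_in b P F d \<subseteq> region_eve b P F d"
proof safe
  fix R D \<Delta> assume "(R, D, \<Delta>) \<in> region_in b P F d"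
  then obtain U :: "nat set" and PU and \<kappa> :: "nat \<Rightarrow> 'y \<Rightarrow> 'xh pmf" where
    nonneg: "0 \<le> R" "0 \<le> D" "0 \<le> \<Delta>" and U: "finite U" "\<And>x. set_pmf (PU x) \<subseteq> U" and
    R: "mutual_info_pmf b (joint_in P PU \<kappa>) (\<lambda>(x, y, z, u, xh). x) (\<lambda>(x, y, z, u, xh). u) \<le> R" and
    D: "measure_pmf.expectation (joint_in P PU \<kappa>) (\<lambda>(x, y, z, u, xh). d (F x y) xh) \<le> D" and
    \<Delta>: "\<Delta> \<le> cond_entropy_pmf b (joint_in P PU \<kappa>) (\<lambda>(x, y, z, u, xh). xh) (\<lambda>(x, y, z, u, xh). (u, z))"
    unfolding region_in_def by blast
  define L where "L = bind_pmf (map_pmf fst P) (\<lambda>x. map_pmf (Pair x) (PU x))"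
  define J' where "J' = letter_joint P (map_pmf prod.swap L) \<kappa>"
  have joint: "joint_in P PU \<kappa> = map_pmf (\<lambda>(u, x, y, z, xh). (x, y, z, u, xh)) J'"
    unfolding J'_def L_def by (rule joint_in_eq)
  have "finite (set_pmf (PU x))" for x using U finite_subset by blast
  then have fin: "finite (set_pmf L)" unfolding L_def by auto
  then have finJ: "finite (set_pmf J')" unfolding J'_def by (intro finite_set_letter_joint) simp
  have marg: "map_pmf fst L = map_pmf fst P"
    unfolding L_def by (simp add: map_bind_pmf pmf.map_comp o_def map_pmf_const bind_return_pmf')
  let ?g = "\<lambda>(u :: nat, x, y, z :: 'z, xh). d (F x y) xh"
  let ?I = "measure_pmf.expectation L (info_density b L)"
  have L: "map_pmf (\<lambda>(u, x, _). (x, u)) J' = L"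
  proof -
    have "map_pmf (\<lambda>(u, x, _). (x, u)) J' = map_pmf prod.swap (map_pmf (\<lambda>(u, x, _). (u, x)) J')"
      by (simp add: pmf.map_comp o_def case_prod_unfold)
    also have "\<dots> = L" unfolding J'_def map_fst_letter_joint by (simp add: pmf.map_comp o_def)
    finally show ?thesis .
  qed
  have "mutual_info_pmf b (joint_in P PU \<kappa>) (\<lambda>(x, y, z, u, xh). x) (\<lambda>(x, y, z, u, xh). u) =
      measure_pmf.expectation (map_pmf (\<lambda>(u, x, _). (x, u)) J')
        (info_density b (map_pmf (\<lambda>(u, x, _). (x, u)) J'))"
    by (simp add: mutual_info_pmf_expectation[OF b] finJ joint info_density_def pmf.map_comp o_def case_prod_unfold)
  then have I: "?I \<le> R" using R unfolding L by simp
  have g: "measure_pmf.expectation J' ?g \<le> D"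
    using D unfolding joint by (simp add: case_prod_unfold)
  have H: "\<Delta> \<le> cond_entropy_pmf b J' (\<lambda>(u, x, y, z, xh). xh) (\<lambda>(u, x, y, z, xh). (u, z))"
    using \<Delta> unfolding joint cond_entropy_pmf_map[OF b finJ] by (simp add: case_prod_unfold)
  have "achievable_eve b P F d R D \<Delta>"
    unfolding achievable_eve_def
  proof (intro allI impI)
    fix \<delta> :: real assume \<delta>: "0 < \<delta>"
    \<comment> \<open>Makes the smoothing loss 2 log (1 - \<eta>) equal to -\<delta>/4.\<close>
    define \<eta> where "\<eta> = 1 - b powr (- \<delta> / 8)"
    have "b powr (- \<delta> / 8) < b powr 0" using b \<delta> by (intro powr_less_mono) auto
    then have \<eta>: "0 < \<eta>" "\<eta> < 1" and log\<eta>: "log b (1 - \<eta>) = - \<delta> / 8" using b by (auto simp: \<eta>_def)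
    define qxy where "qxy v = smooth \<eta> (cond_kernel (map_pmf (\<lambda>(u, x, y, z, xh). ((u, z, xh), (x, y))) J') v)" for v
    define qz where "qz u = smooth \<eta> (cond_kernel (map_pmf (\<lambda>(u, x, y, z, xh). (u, z)) J') u)" for u
    have pos: "0 < pmf (qxy v) a" "0 < pmf (qz u) z" for v a u z
      unfolding qxy_def qz_def by (rule pmf_smooth_pos[OF \<eta>])+
    define \<psi> where "\<psi> = (\<lambda>(u, x, y, z, xh). log b (pmf (qz u) z * pmf (qxy (u, z, xh)) (x, y) /
      (pmf P (x, y, z) * pmf (\<kappa> u y) xh)))"
    have \<psi>: "?I + \<Delta> - \<delta> / 4 \<le> measure_pmf.expectation J' \<psi>"
      using smoothed_letter_mean_ge[OF b fin marg \<eta>, of \<kappa>] H log\<eta>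
      unfolding \<psi>_def qxy_def qz_def J'_def by simp
    have mean: "measure_pmf.expectation L (letter_mean P \<kappa> h) = measure_pmf.expectation J' h" for h
      unfolding J'_def by (simp add: expectation_letter_joint fin case_prod_unfold)
    have "\<forall>\<^sub>F n in sequentially. \<exists>M c f.
      0 < M \<and> log b (real M) \<le> real n * (?I + \<delta> / 4) \<and>
      (\<forall>k. c k \<in> set_pmf (replicate_pmf n (map_pmf snd L))) \<and> (\<forall>xs. f xs < M) \<and>
      (\<forall>\<psi>'\<in>{letter_mean P \<kappa> \<psi>, letter_mean P \<kappa> ?g}.
        \<bar>measure_pmf.expectation (replicate_pmf n (map_pmf fst L))
        (\<lambda>xs. \<Sum>i<n. \<psi>' (xs ! i, c (f xs) ! i)) - real n * measure_pmf.expectation L \<psi>'\<bar> \<le> real n * (\<delta> / 4))"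
      by (rule covering) (use b fin \<delta> in auto)
    then show "\<forall>\<^sub>F n in sequentially.
        \<exists>(W :: nat set) (f :: 'x list \<Rightarrow> nat) (q :: nat \<Rightarrow> nat \<Rightarrow> 'y list \<Rightarrow> 'xh list \<Rightarrow> 'xh pmf).
          finite W \<and> (\<forall>xs. length xs = n \<longrightarrow> f xs \<in> W) \<and>
          (1 / real n) * log b (real (card W)) \<le> R + \<delta> \<and>
          measure_pmf.expectation (code_joint P n f q)
            (\<lambda>(xs, ys, zs, w, xhs). avg_distortion F d n xs ys xhs) \<le> D + \<delta> \<and>
          (1 / real n) * cond_entropy_pmf b (code_joint P n f q)
            (\<lambda>(xs, ys, zs, w, xhs). xhs) (\<lambda>(xs, ys, zs, w, xhs). (w, zs)) \<ge> \<Delta> - \<delta>"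
      using eventually_gt_at_top[of 0]
    proof eventually_elim
      case (elim n)
      then obtain M c f where M: "0 < M" "log b (real M) \<le> real n * (?I + \<delta> / 4)" and f: "\<And>xs. f xs < M"
        and cov: "\<And>\<psi>'. \<psi>' \<in> {letter_mean P \<kappa> \<psi>, letter_mean P \<kappa> ?g} \<Longrightarrow>
          \<bar>measure_pmf.expectation (replicate_pmf n (map_pmf fst L))
            (\<lambda>xs. \<Sum>i<n. \<psi>' (xs ! i, c (f xs) ! i)) - real n * measure_pmf.expectation L \<psi>'\<bar> \<le> real n * (\<delta> / 4)"
        by blast
      have n: "0 < real n" using elim(2) by simp
      let ?q = "memoryless_decoder c \<kappa>"
      let ?C = "code_pmf P n f ?q"
      let ?T = "\<lambda>i (s, xhs). (c (f (map fst s)) ! i, fst (s ! i), fst (snd (s ! i)), snd (snd (s ! i)), xhs ! i)"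
      have code: "\<bar>measure_pmf.expectation ?C (\<lambda>(s, xhs). \<Sum>i<n. h (?T i (s, xhs))) -
          real n * measure_pmf.expectation J' h\<bar> \<le> real n * (\<delta> / 4)" if "h = \<psi> \<or> h = ?g" for h
        using cov[of "letter_mean P \<kappa> h"] that
        unfolding mean marg by (auto simp: expectation_memoryless_code)
      have "measure_pmf.expectation ?C (\<lambda>(s, xhs). \<Sum>i<n. ?g (?T i (s, xhs))) \<le> real n * (D + \<delta>)"
      proof -
        have "real n * measure_pmf.expectation J' ?g + real n * (\<delta> / 4) \<le> real n * (D + \<delta>)"
          unfolding distrib_left[symmetric] using g \<delta> by (intro mult_left_mono) auto
        then show ?thesis using code[OF disjI2[OF refl]] by linarith
      qed
      then have dist: "measure_pmf.expectation (code_joint P n f ?q)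
            (\<lambda>(xs, ys, zs, w, xhs). avg_distortion F d n xs ys xhs) \<le> D + \<delta>"
        unfolding expectation_avg_distortion using n by (simp add: field_simps)
      have rate: "(1 / real n) * log b (real (card {..<M})) \<le> R + \<delta>"
      proof -
        have "(1 / real n) * log b (real M) \<le> ?I + \<delta> / 4" using M n by (simp add: field_simps)
        then show ?thesis using I \<delta> by simp
      qed
      have "measure_pmf.expectation ?C (\<lambda>(s, xhs). \<Sum>i<n. \<psi> (?T i (s, xhs))) - log b (real M) \<le>
        cond_entropy_pmf b ?C snd (\<lambda>(s, xhs). (f (map fst s), map (snd \<circ> snd) s))"
        using memoryless_equivocation_ge[where f = f and M = M and qxy = qxy and qz = qz and P = P and \<kappa> = \<kappa>
            and c = c and n = n, OF b f pos]
        unfolding \<psi>_def by simp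
      moreover have "real n * (?I + \<Delta> - \<delta> / 4) \<le> real n * measure_pmf.expectation J' \<psi>"
        using \<psi> by (intro mult_left_mono) auto
      \<comment> \<open>Smoothing, covering and the size of the codebook each cost \<delta>/4 per
        letter, and the two terms \<open>?I\<close> cancel.\<close>
      ultimately have "real n * (?I + \<Delta> - \<delta> / 4) - real n * (\<delta> / 4) - real n * (?I + \<delta> / 4) \<le>
        cond_entropy_pmf b ?C snd (\<lambda>(s, xhs). (f (map fst s), map (snd \<circ> snd) s))"
        using code[OF disjI1[OF refl]] M by linarith
      moreover have "real n * (\<Delta> - \<delta>) \<le> real n * (?I + \<Delta> - \<delta> / 4) - real n * (\<delta> / 4) - real n * (?I + \<delta> / 4)"
        unfolding right_diff_distrib[symmetric] using \<delta> by (intro mult_left_mono) auto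
      ultimately have equiv: "(1 / real n) * cond_entropy_pmf b (code_joint P n f ?q)
            (\<lambda>(xs, ys, zs, w, xhs). xhs) (\<lambda>(xs, ys, zs, w, xhs). (w, zs)) \<ge> \<Delta> - \<delta>"
        unfolding cond_entropy_code_joint[OF b] using n by (simp add: field_simps)
      show ?case
        by (rule exI[of _ "{..<M}"], rule exI[of _ f], rule exI[of _ ?q]) (use rate dist equiv f in auto)
    qed
  qed
  then show "(R, D, \<Delta>) \<in> region_eve b P F d" using nonneg by (simp add: region_eve_def)
qed

section \<open>Single-letterization\<close>

text \<open>The time index is part of the auxiliary variable: pasts from different times stay
  distinct, and the kernel knows which decoder step to run.\<close>

definition time_sharing_pmf ::
  "('x \<times> 'y \<times> 'z) pmf \<Rightarrow> nat \<Rightarrow> ('x list \<Rightarrow> nat) \<Rightarrow>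
   (nat \<Rightarrow> nat \<Rightarrow> 'y list \<Rightarrow> 'xh list \<Rightarrow> 'xh pmf) \<Rightarrow> ((nat \<times> nat \<times> 'y list \<times> 'xh list) \<times> 'x) pmf" where
  "time_sharing_pmf P n f q =
     bind_pmf (pmf_of_set {..<n}) (\<lambda>i. map_pmf (\<lambda>(u, x). ((i, u), x)) (past_pmf P n f q i))"

definition time_sharing_kernel ::
  "(nat \<Rightarrow> nat \<Rightarrow> 'y list \<Rightarrow> 'xh list \<Rightarrow> 'xh pmf) \<Rightarrow> nat \<times> nat \<times> 'y list \<times> 'xh list \<Rightarrow> 'y \<Rightarrow> 'xh pmf" where
  "time_sharing_kernel q = (\<lambda>(i, w, ys, xhs) y. q (Suc i) w (ys @ [y]) xhs)"

definition letter_at ::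
  "('x list \<Rightarrow> nat) \<Rightarrow> nat \<Rightarrow> ('x \<times> 'y \<times> 'z) list \<times> 'xh list \<Rightarrow>
   (nat \<times> nat \<times> 'y list \<times> 'xh list) \<times> 'x \<times> 'y \<times> 'z \<times> 'xh" where
  "letter_at f i = (\<lambda>(s, xhs). ((i, f (map fst s), take i (map (fst \<circ> snd) s), take i xhs),
     fst (s ! i), fst (snd (s ! i)), snd (snd (s ! i)), xhs ! i))"

section \<open>The law of a uniformly chosen letter of a code\<close>

lemma finite_set_past_pmf:
  fixes P :: "('x::finite \<times> 'y::finite \<times> 'z::finite) pmf"
    and q :: "nat \<Rightarrow> nat \<Rightarrow> 'y list \<Rightarrow> 'xh::finite list \<Rightarrow> 'xh pmf"
  shows "finite (set_pmf (past_pmf P n f q i))"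
  by (simp add: past_pmf_def finite_set_code_pmf)

lemma finite_set_time_sharing_pmf:
  fixes P :: "('x::finite \<times> 'y::finite \<times> 'z::finite) pmf"
    and q :: "nat \<Rightarrow> nat \<Rightarrow> 'y list \<Rightarrow> 'xh::finite list \<Rightarrow> 'xh pmf"
  assumes "0 < n"
  shows "finite (set_pmf (time_sharing_pmf P n f q))"
  using assms by (auto simp: time_sharing_pmf_def finite_set_past_pmf set_pmf_of_set lessThan_empty_iff)

lemma map_snd_time_sharing_pmf:
  assumes "0 < n"
  shows "map_pmf snd (time_sharing_pmf P n f q) = map_pmf fst P"
proof -
  have ne: "{..<n} \<noteq> {}" using assms by (simp add: lessThan_empty_iff)
  have "map_pmf snd (time_sharing_pmf P n f q) =
      bind_pmf (pmf_of_set {..<n}) (\<lambda>i. map_pmf snd (map_pmf (\<lambda>((w, _), x). (w, x)) (past_pmf P n f q i)))"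
    by (simp add: time_sharing_pmf_def map_bind_pmf pmf.map_comp o_def case_prod_unfold)
  also have "\<dots> = bind_pmf (pmf_of_set {..<n}) (\<lambda>i. map_pmf fst P)"
    by (rule bind_pmf_cong)
      (use ne in \<open>auto simp: message_letter_past_pmf pmf.map_comp o_def law_nth_replicate_pmf\<close>)
  finally show ?thesis by simp
qed

lemma letter_joint_time_sharing:
  assumes "0 < n"
  shows "letter_joint P (time_sharing_pmf P n f q) (time_sharing_kernel q) =
    bind_pmf (pmf_of_set {..<n}) (\<lambda>i. map_pmf (letter_at f i) (code_pmf P n f q))"
proof -
  have ne: "{..<n} \<noteq> {}" using assms by (simp add: lessThan_empty_iff)
  have "letter_joint P (time_sharing_pmf P n f q) (time_sharing_kernel q) =
    bind_pmf (pmf_of_set {..<n}) (\<lambda>i. map_pmf (\<lambda>(u, v). ((i, u), v)) (letter_joint P (past_pmf P n f q i)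
      (\<lambda>(w, ys, xhs) y. q (Suc i) w (ys @ [y]) xhs)))"
    by (simp add: letter_joint_def time_sharing_pmf_def time_sharing_kernel_def bind_assoc_pmf
        bind_map_pmf map_bind_pmf pmf.map_comp o_def case_prod_unfold)
  also have "\<dots> = bind_pmf (pmf_of_set {..<n}) (\<lambda>i. map_pmf (letter_at f i) (code_pmf P n f q))"
  proof (rule bind_pmf_cong)
    fix i assume "i \<in> set_pmf (pmf_of_set {..<n})"
    then have "i < n" using ne by simp
    show "map_pmf (\<lambda>(u, v). ((i, u), v)) (letter_joint P (past_pmf P n f q i)
        (\<lambda>(w, ys, xhs) y. q (Suc i) w (ys @ [y]) xhs)) = map_pmf (letter_at f i) (code_pmf P n f q)"
      unfolding single_letter_law[OF \<open>i < n\<close>, symmetric]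
      by (simp add: pmf.map_comp o_def letter_at_def case_prod_unfold)
  qed simp
  finally show ?thesis .
qed

text \<open>Turns the sums over letters that Gibbs' inequality produces into expectations under a
  single letter law.\<close>

lemma expectation_time_sharing:
  fixes P :: "('x::finite \<times> 'y::finite \<times> 'z::finite) pmf"
    and q :: "nat \<Rightarrow> nat \<Rightarrow> 'y list \<Rightarrow> 'xh::finite list \<Rightarrow> 'xh pmf" and h :: "_ \<Rightarrow> real"
  assumes "0 < n"
  shows "measure_pmf.expectation (letter_joint P (time_sharing_pmf P n f q) (time_sharing_kernel q)) h =
    (1 / real n) * measure_pmf.expectation (code_pmf P n f q) (\<lambda>a. \<Sum>i<n. h (letter_at f i a))"
proof -
  have ne: "{..<n} \<noteq> {}" using assms by (simp add: lessThan_empty_iff)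
  have "measure_pmf.expectation (letter_joint P (time_sharing_pmf P n f q) (time_sharing_kernel q)) h =
     measure_pmf.expectation (pmf_of_set {..<n}) (\<lambda>i. measure_pmf.expectation (code_pmf P n f q) (\<lambda>a. h (letter_at f i a)))"
    unfolding letter_joint_time_sharing[OF assms]
    by (simp add: expectation_bind_finite ne finite_set_code_pmf)
  also have "\<dots> = (1 / real n) * (\<Sum>i<n. measure_pmf.expectation (code_pmf P n f q) (\<lambda>a. h (letter_at f i a)))"
    by (simp add: integral_pmf_of_set ne)
  also have "(\<Sum>i<n. measure_pmf.expectation (code_pmf P n f q) (\<lambda>a. h (letter_at f i a))) =
     measure_pmf.expectation (code_pmf P n f q) (\<lambda>a. \<Sum>i<n. h (letter_at f i a))"
    by (intro Bochner_Integration.integral_sum[symmetric] integrable_measure_pmf_finite finite_set_code_pmf)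
  finally show ?thesis .
qed

lemma letter_at_in_set_time_sharing:
  assumes "i < n" "a \<in> set_pmf (code_pmf P n f q)"
  shows "letter_at f i a \<in> set_pmf (letter_joint P (time_sharing_pmf P n f q) (time_sharing_kernel q))"
proof -
  have "{..<n} \<noteq> {}" using assms by auto
  then show ?thesis
    using assms by (subst letter_joint_time_sharing) (auto simp: set_pmf_of_set)
qed

text \<open>Gibbs' inequality against the law that keeps (W, Z^n) and draws each reconstruction
  letter from the time-averaged conditional law given the current z. This one comparison accounts
  for dropping the other observations, for dependence across time and for averaging over
  time.\<close>

lemma time_sharing_equivocation:
  fixes P :: "('x::finite \<times> 'y::finite \<times> 'z::finite) pmf"
    and q :: "nat \<Rightarrow> nat \<Rightarrow> 'y list \<Rightarrow> 'xh::finite list \<Rightarrow> 'xh pmf"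
  assumes b: "1 < b" and n: "0 < n"
  shows "(1 / real n) * cond_entropy_pmf b (code_pmf P n f q) snd (\<lambda>(s, xhs). (f (map fst s), map (snd \<circ> snd) s)) \<le>
    cond_entropy_pmf b (letter_joint P (time_sharing_pmf P n f q) (time_sharing_kernel q))
      (\<lambda>(u, x, y, z, xh). xh) (\<lambda>(u, x, y, z, xh). z)"
proof -
  let ?p = "code_pmf P n f q"
  let ?T = "letter_joint P (time_sharing_pmf P n f q) (time_sharing_kernel q)"
  define V where "V = (\<lambda>(s :: ('x \<times> 'y \<times> 'z) list, xhs :: 'xh list). (f (map fst s), map (snd \<circ> snd) s))"
  define \<rho> where "\<rho> = cond_kernel (map_pmf (\<lambda>(u, x, y, z, xh). (z, xh)) ?T)"
  let ?m = "map_pmf (\<lambda>a. (V a, snd a)) ?p"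
  define Q where "Q = bind_pmf (map_pmf V ?p) (\<lambda>v. map_pmf (Pair v) (seq_pmf (\<lambda>l. \<rho> (snd v ! length l)) n))"
  have fin: "finite (set_pmf ?p)" by (rule finite_set_code_pmf)
  have int [simp]: "integrable (measure_pmf ?p) g" for g :: "_ \<Rightarrow> real"
    by (rule integrable_measure_pmf_finite[OF fin])
  have finT: "finite (set_pmf ?T)"
    by (intro finite_set_letter_joint finite_set_time_sharing_pmf n)
  define R where "R a = (\<Prod>i<n. case letter_at f i a of (u, x, y, z, xh) \<Rightarrow> pmf (\<rho> z) xh)"
    for a :: "('x \<times> 'y \<times> 'z) list \<times> 'xh list"
  have \<rho>: "0 < (case letter_at f i a of (u, x, y, z, xh) \<Rightarrow> pmf (\<rho> z) xh)"
    if "i < n" "a \<in> set_pmf ?p" for i a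
    using letter_at_in_set_time_sharing[OF that]
    by (cases "letter_at f i a") (auto simp: \<rho>_def intro!: pmf_cond_kernel_pos, force)
  have R: "0 < R a" if "a \<in> set_pmf ?p" for a
    unfolding R_def by (rule prod_pos) (use \<rho> that in auto)
  have Qm: "pmf Q (V a, snd a) = pmf (map_pmf V ?p) (V a) * R a" if "a \<in> set_pmf ?p" for a
  proof -
    obtain s xhs where a: "a = (s, xhs)" by (cases a)
    note len = set_code_pmf[OF that[unfolded a]]
    show ?thesis
      by (simp add: Q_def pmf_dependent_pair pmf_seq_pmf a len R_def letter_at_def V_def min_def cong: prod.cong_simp)
  qed
  have mm: "pmf ?m (V a, snd a) = pmf (map_pmf V ?p) (V a) * pmf (cond_kernel ?m (V a)) (snd a)" for a
    by (simp add: pmf_cond_kernel[symmetric] pmf.map_comp o_def)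
  have pos: "0 < pmf (map_pmf V ?p) (V a)" "0 < pmf (cond_kernel ?m (V a)) (snd a)" if "a \<in> set_pmf ?p" for a
    by (auto intro!: pmf_positive pmf_cond_kernel_pos simp: that)
  have "measure_pmf.expectation ?m (\<lambda>v. log b (pmf Q (id v) / pmf ?m v)) \<le> 0"
  proof (rule gibbs_inequality[OF b])
    show "0 < pmf Q (id v)" if v: "v \<in> set_pmf ?m" for v
    proof -
      obtain a where a: "a \<in> set_pmf ?p" "v = (V a, snd a)"
        using v unfolding set_map_pmf by blast
      show ?thesis unfolding a(2) id_apply Qm[OF a(1)] by (intro mult_pos_pos pos R a)
    qed
  qed (use fin in auto)
  also have "measure_pmf.expectation ?m (\<lambda>v. log b (pmf Q (id v) / pmf ?m v)) =
     measure_pmf.expectation ?p (\<lambda>a. log b (pmf Q (V a, snd a) / pmf ?m (V a, snd a)))" by simp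
  also have "\<dots> = measure_pmf.expectation ?p
      (\<lambda>a. (\<Sum>i<n. case letter_at f i a of (u, x, y, z, xh) \<Rightarrow> log b (pmf (\<rho> z) xh)) -
        log b (pmf (cond_kernel ?m (V a)) (snd a)))"
  proof (rule expectation_cong_pmf)
    fix a assume a: "a \<in> set_pmf ?p"
    have "pmf Q (V a, snd a) / pmf ?m (V a, snd a) = R a / pmf (cond_kernel ?m (V a)) (snd a)"
      unfolding Qm[OF a] mm using pos(1)[OF a] by simp
    moreover have "log b (R a) = (\<Sum>i<n. case letter_at f i a of (u, x, y, z, xh) \<Rightarrow> log b (pmf (\<rho> z) xh))"
      unfolding R_def using \<rho> a by (subst log_prod_pos) (auto simp: case_prod_unfold)
    ultimately show "log b (pmf Q (V a, snd a) / pmf ?m (V a, snd a)) =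
       (\<Sum>i<n. case letter_at f i a of (u, x, y, z, xh) \<Rightarrow> log b (pmf (\<rho> z) xh)) -
        log b (pmf (cond_kernel ?m (V a)) (snd a))"
      using log_divide_pos[OF R[OF a] pos(2)[OF a]] by simp
  qed
  also have "\<dots> = measure_pmf.expectation ?p (\<lambda>a. \<Sum>i<n. case letter_at f i a of (u, x, y, z, xh) \<Rightarrow> log b (pmf (\<rho> z) xh)) +
      cond_entropy_pmf b ?p snd V"
    unfolding cond_entropy_pmf_kernel[OF b fin] by (simp del: Bochner_Integration.integral_sum)
  also have "measure_pmf.expectation ?p (\<lambda>a. \<Sum>i<n. case letter_at f i a of (u, x, y, z, xh) \<Rightarrow> log b (pmf (\<rho> z) xh)) =
      - (real n * cond_entropy_pmf b ?T (\<lambda>(u, x, y, z, xh). xh) (\<lambda>(u, x, y, z, xh). z))"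
  proof -
    have "cond_entropy_pmf b ?T (\<lambda>(u, x, y, z, xh). xh) (\<lambda>(u, x, y, z, xh). z) =
        - measure_pmf.expectation ?T (\<lambda>(u, x, y, z, xh). log b (pmf (\<rho> z) xh))"
      unfolding \<rho>_def by (simp add: cond_entropy_pmf_kernel[OF b finT] case_prod_unfold)
    then show ?thesis using n by (simp add: expectation_time_sharing)
  qed
  finally show ?thesis using n by (simp add: V_def field_simps)
qed

text \<open>Gibbs' inequality against the laws in which each \<open>x\<^sub>i\<close> is drawn from its conditional law given
  \<open>(w, y\<^sup>i\<^sup>-\<^sup>1, xh\<^sup>i\<^sup>-\<^sup>1)\<close> for a fixed message \<open>w\<close>, with \<open>w\<close> uniform.\<close>

lemma time_sharing_rate:
  fixes P :: "('x::finite \<times> 'y::finite \<times> 'z::finite) pmf"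
    and q :: "nat \<Rightarrow> nat \<Rightarrow> 'y list \<Rightarrow> 'xh::finite list \<Rightarrow> 'xh pmf"
  assumes b: "1 < b" and n: "0 < n" and W: "finite W" "\<And>xs. length xs = n \<Longrightarrow> f xs \<in> W"
  defines "J \<equiv> time_sharing_pmf P n f q"
  shows "measure_pmf.expectation J (\<lambda>(u, x). log b (pmf (cond_kernel J u) x / pmf (map_pmf fst P) x)) \<le>
    (1 / real n) * log b (real (card W))"
proof -
  let ?p = "code_pmf P n f q"
  let ?T = "letter_joint P J (time_sharing_kernel q)"
  let ?K = "cond_kernel P"
  \<comment> \<open>A letter is drawn in the order x, (y, z), xh; position, past side information
    and past reconstruction are read off the list \<open>l\<close>.\<close>
  define kern where "kern w l = bind_pmf (bind_pmf (cond_kernel J (length l, w, map (fst \<circ> snd \<circ> fst) l, map snd l))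
      (\<lambda>x. map_pmf (Pair x) (?K x)))
    (\<lambda>s. map_pmf (Pair s) (q (Suc (length l)) w (map (fst \<circ> snd \<circ> fst) l @ [fst (snd s)]) (map snd l)))"
    for w and l :: "(('x \<times> 'y \<times> 'z) \<times> 'xh) list"
  define Q where "Q = bind_pmf (pmf_of_set W) (\<lambda>w. map_pmf (Pair w) (seq_pmf (kern w) n))"
  define h where "h a = (f (map fst (fst a)), zip (fst a) (snd a))" for a :: "('x \<times> 'y \<times> 'z) list \<times> 'xh list"
  have "f (replicate n undefined) \<in> W" by (rule W) simp
  then have ne: "W \<noteq> {}" by blast
  with W(1) have card: "0 < real (card W)" by (simp add: card_gt_0_iff)
  have fin: "finite (set_pmf ?p)" by (rule finite_set_code_pmf)
  have int [simp]: "integrable (measure_pmf ?p) g" for g :: "_ \<Rightarrow> real"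
    by (rule integrable_measure_pmf_finite[OF fin])
  let ?a = "\<lambda>i a. case letter_at f i a of (u, x, y, z, xh) \<Rightarrow> pmf (cond_kernel J u) x"
  let ?x = "\<lambda>i a. case letter_at f i a of (u, x, y, z, xh) \<Rightarrow> pmf (map_pmf fst P) x"
  \<comment> \<open>These factors occur in the masses of both laws and cancel, so only the laws of x
    remain in the ratio.\<close>
  let ?r = "\<lambda>i a. case letter_at f i a of (u, x, y, z, xh) \<Rightarrow> pmf (?K x) (y, z) * pmf (time_sharing_kernel q u y) xh"
  have Qh: "pmf Q (h a) = (\<Prod>i<n. ?a i a * ?r i a) / real (card W)" if "a \<in> set_pmf ?p" for a
  proof -
    obtain s xhs where a: "a = (s, xhs)" by (cases a)
    note len = set_code_pmf[OF that[unfolded a]]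
    have pr: "map (\<lambda>x. fst (snd (fst x))) (take i (zip s xhs)) = take i (map (fst \<circ> snd) s)"
      "map snd (take i (zip s xhs)) = take i xhs" for i
    proof -
      have "map fst (take i (zip s xhs)) = take i s" by (simp add: take_zip len)
      then have "map (fst \<circ> snd) (map fst (take i (zip s xhs))) = map (fst \<circ> snd) (take i s)" by simp
      then show "map (\<lambda>x. fst (snd (fst x))) (take i (zip s xhs)) = take i (map (fst \<circ> snd) s)"
        by (simp add: o_def take_map)
      show "map snd (take i (zip s xhs)) = take i xhs" by (simp add: take_zip len)
    qed
    have "pmf (kern w (take i (zip s xhs))) (zip s xhs ! i) =
       pmf (cond_kernel J (i, w, take i (map (fst \<circ> snd) s), take i xhs)) (fst (s ! i)) *
        (pmf (?K (fst (s ! i))) (snd (s ! i)) *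
         pmf (q (Suc i) w (take i (map (fst \<circ> snd) s) @ [fst (snd (s ! i))]) (take i xhs)) (xhs ! i))"
      if "i < n" for i w
    proof -
      obtain x v where sx: "s ! i = (x, v)" by (cases "s ! i")
      show ?thesis
        using that by (simp add: kern_def len pr o_def pmf_dependent_pair sx)
    qed
    then show ?thesis
      using ne W len by (simp add: Q_def h_def a pmf_dependent_pair pmf_seq_pmf letter_at_def
        time_sharing_kernel_def indicator_def cong: prod.cong_simp)
  qed
  have ph: "pmf ?p a = (\<Prod>i<n. ?x i a * ?r i a)" if "a \<in> set_pmf ?p" for a
  proof -
    obtain s xhs where a: "a = (s, xhs)" by (cases a)
    note len = set_code_pmf[OF that[unfolded a]]
    have "pmf (map_pmf fst P) (fst (s ! i)) * pmf (?K (fst (s ! i))) (snd (s ! i)) = pmf P (s ! i)" for i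
      by (cases "s ! i") (simp add: pmf_cond_kernel)
    then show ?thesis
      by (simp add: a pmf_code_pmf len letter_at_def time_sharing_kernel_def mult.assoc[symmetric])
  qed
  have xr: "0 < ?x i a * ?r i a" if "i < n" "a \<in> set_pmf ?p" for i a
  proof -
    have "(\<Prod>i<n. ?x i a * ?r i a) \<noteq> 0"
      using pmf_positive[OF that(2)] unfolding ph[OF that(2)] by (rule less_imp_neq[symmetric])
    then have "?x i a * ?r i a \<noteq> 0" using that(1) by (simp only: prod_zero_iff finite_lessThan) blast
    then show ?thesis by (simp add: less_le case_prod_unfold)
  qed
  have apos: "0 < ?a i a" if "i < n" "a \<in> set_pmf ?p" for i a
  proof -
    have "(\<lambda>(u, x, _). (u, x)) (letter_at f i a) \<in> set_pmf (map_pmf (\<lambda>(u, x, _). (u, x)) ?T)"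
      unfolding set_map_pmf J_def by (rule imageI) (rule letter_at_in_set_time_sharing[OF that])
    then show ?thesis
      unfolding map_fst_letter_joint by (auto simp: case_prod_unfold intro: pmf_cond_kernel_pos)
  qed
  have rpos: "0 < ?r i a" and xpos: "0 < ?x i a" if "i < n" "a \<in> set_pmf ?p" for i a
    using xr[OF that] by (auto simp: zero_less_mult_iff case_prod_unfold not_less less_le)
  have "measure_pmf.expectation ?p (\<lambda>a. log b (pmf Q (h a) / pmf ?p a)) \<le> 0"
  proof (rule gibbs_inequality[OF b fin])
    show "inj_on h (set_pmf ?p)"
    proof (rule inj_onI)
      fix a a' assume "a \<in> set_pmf ?p" "a' \<in> set_pmf ?p" and eq: "h a = h a'"
      then have "length (fst a) = n" "length (snd a) = n" "length (fst a') = n" "length (snd a') = n"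
        by (metis prod.collapse set_code_pmf)+
      moreover have "zip (fst a) (snd a) = zip (fst a') (snd a')" using eq by (simp add: h_def)
      ultimately have "fst a = fst a'" "snd a = snd a'"
        by (metis map_fst_zip, metis map_snd_zip)
      then show "a = a'" by (simp add: prod_eq_iff)
    qed
    show "0 < pmf Q (h a)" if "a \<in> set_pmf ?p" for a
    proof -
      have "0 < (\<Prod>i<n. ?a i a * ?r i a)"
        by (rule prod_pos) (use mult_pos_pos[OF apos rpos, OF _ that _ that] in simp)
      then show ?thesis unfolding Qh[OF that] using card by (rule divide_pos_pos)
    qed
  qed
  also have "measure_pmf.expectation ?p (\<lambda>a. log b (pmf Q (h a) / pmf ?p a)) =
     measure_pmf.expectation ?p (\<lambda>a. (\<Sum>i<n. log b (?a i a / ?x i a)) - log b (real (card W)))"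
  proof (rule expectation_cong_pmf)
    fix a assume a: "a \<in> set_pmf ?p"
    have "pmf Q (h a) / pmf ?p a = (\<Prod>i<n. (?a i a * ?r i a) / (?x i a * ?r i a)) / real (card W)"
      unfolding Qh[OF a] ph[OF a] prod_dividef by (simp only: divide_divide_eq_left mult.commute)
    also have "(\<Prod>i<n. (?a i a * ?r i a) / (?x i a * ?r i a)) = (\<Prod>i<n. ?a i a / ?x i a)"
    proof (rule prod.cong)
      fix i assume "i \<in> {..<n}"
      then have "?r i a \<noteq> 0" using rpos[OF _ a, of i] by (intro less_imp_neq[symmetric]) simp
      then show "(?a i a * ?r i a) / (?x i a * ?r i a) = ?a i a / ?x i a"
        by (rule nonzero_mult_divide_mult_cancel_right)
    qed simp
    finally have eq: "pmf Q (h a) / pmf ?p a = (\<Prod>i<n. ?a i a / ?x i a) / real (card W)" .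
    have ax: "0 < ?a i a / ?x i a" if "i < n" for i
      by (rule divide_pos_pos[OF apos[OF that a] xpos[OF that a]])
    then have "0 < (\<Prod>i<n. ?a i a / ?x i a)" by (intro prod_pos) auto
    then have "log b (pmf Q (h a) / pmf ?p a) = log b (\<Prod>i<n. ?a i a / ?x i a) - log b (real (card W))"
      unfolding eq using card by (rule log_divide_pos)
    also have "log b (\<Prod>i<n. ?a i a / ?x i a) = (\<Sum>i<n. log b (?a i a / ?x i a))"
      by (rule log_prod_pos[OF finite_lessThan]) (rule ax, simp)
    finally show "log b (pmf Q (h a) / pmf ?p a) = (\<Sum>i<n. log b (?a i a / ?x i a)) - log b (real (card W))" .
  qed
  also have "\<dots> = measure_pmf.expectation ?p (\<lambda>a. \<Sum>i<n. log b (?a i a / ?x i a)) - log b (real (card W))"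
    by (simp del: Bochner_Integration.integral_sum)
  finally have "measure_pmf.expectation ?p (\<lambda>a. \<Sum>i<n. log b (?a i a / ?x i a)) \<le> log b (real (card W))"
    by simp
  then have "(1 / real n) * measure_pmf.expectation ?p (\<lambda>a. \<Sum>i<n. log b (?a i a / ?x i a)) \<le>
      (1 / real n) * log b (real (card W))"
    by (intro mult_left_mono) auto
  also have "(1 / real n) * measure_pmf.expectation ?p (\<lambda>a. \<Sum>i<n. log b (?a i a / ?x i a)) =
     measure_pmf.expectation ?T (\<lambda>(u, x, _). log b (pmf (cond_kernel J u) x / pmf (map_pmf fst P) x))"
    unfolding J_def by (simp add: expectation_time_sharing n case_prod_unfold)
  also have "\<dots> = measure_pmf.expectation (map_pmf (\<lambda>(u, x, _). (u, x)) ?T)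
      (\<lambda>(u, x). log b (pmf (cond_kernel J u) x / pmf (map_pmf fst P) x))"
    by (simp add: case_prod_unfold)
  finally show ?thesis unfolding map_fst_letter_joint .
qed

section \<open>Closedness of the outer region\<close>

definition entropy_term :: "real \<Rightarrow> real \<Rightarrow> real" where
  "entropy_term b t = - (t * log b t)"

text \<open>Only 0 is delicate: there the value 0 agrees with the limit of t ln t.\<close>

lemma continuous_on_entropy_term: "continuous_on {0..} (entropy_term b)"
proof (rule continuous_on_eq_continuous_within[THEN iffD2], intro ballI)
  fix t :: real assume "t \<in> {0..}"
  then consider "t = 0" | "0 < t" by force
  then show "continuous (at t within {0..}) (entropy_term b)"
  proof cases
    case 1
    have "((\<lambda>t::real. - (t * (ln t / ln b))) \<longlongrightarrow> 0) (at_right 0)"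
    proof -
      have "((\<lambda>t::real. t * ln t) \<longlongrightarrow> 0) (at_right 0)" by real_asymp
      then have "((\<lambda>t::real. - ((t * ln t) / ln b)) \<longlongrightarrow> - (0 / ln b)) (at_right 0)"
        unfolding divide_inverse by (intro tendsto_intros)
      then show ?thesis by simp
    qed
    then show ?thesis
      by (simp add: 1 continuous_within entropy_term_def[abs_def] log_def at_within_Ici_at_right)
  next
    case 2
    then have "isCont (\<lambda>t. - (t * (ln t / ln b))) t"
      unfolding divide_inverse by (intro continuous_intros) auto
    then show ?thesis
      by (simp add: entropy_term_def[abs_def] log_def continuous_at_imp_continuous_at_within)
  qed
qed

lemma pmf_with_weights:
  fixes w :: "'a \<Rightarrow> real"
  assumes "finite A" "\<And>a. 0 \<le> w a" "\<And>a. a \<notin> A \<Longrightarrow> w a = 0" "sum w A = 1"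
  obtains p where "\<And>a. pmf p a = w a"
proof
  have "(\<integral>\<^sup>+a. ennreal (w a) \<partial>count_space UNIV) = (\<Sum>a\<in>A. ennreal (w a))"
    by (rule nn_integral_count_space'[OF assms(1)]) (use assms in auto)
  also have "\<dots> = 1" using assms by (simp add: sum_ennreal)
  finally show "pmf (embed_pmf w) a = w a" for a
    by (intro pmf_embed_pmf) (use assms in auto)
qed

text \<open>Laws and kernels are encoded as vectors to gain the topology and convexity of Euclidean
  space.\<close>

definition pmf_vec :: "'x::finite pmf \<Rightarrow> real ^ 'x" where
  "pmf_vec a = (\<chi> x. pmf a x)"

definition kernel_vec :: "('y::finite \<Rightarrow> 'xh::finite pmf) \<Rightarrow> real ^ ('y \<times> 'xh)" where
  "kernel_vec \<kappa> = (\<chi> v. pmf (\<kappa> (fst v)) (snd v))"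

section \<open>Compact sets of laws and kernels\<close>

lemma sum_pmf_UNIV: "(\<Sum>x\<in>UNIV. pmf p x) = 1" for p :: "'a::finite pmf"
  by (rule sum_pmf_eq_1) auto

lemma compact_range_pmf_vec: "compact (range (pmf_vec :: 'x::finite pmf \<Rightarrow> real ^ 'x))"
proof -
  let ?S = "{A :: real ^ 'x. (\<forall>x. 0 \<le> A $ x) \<and> (\<Sum>x\<in>UNIV. A $ x) = 1}"
  have "range pmf_vec = ?S"
  proof (intro equalityI subsetI)
    fix A assume A: "A \<in> ?S"
    then obtain a where "\<And>x. pmf a x = A $ x"
      using pmf_with_weights[of UNIV "\<lambda>x. A $ x"] by auto
    then have "A = pmf_vec a" by (simp add: pmf_vec_def vec_eq_iff)
    then show "A \<in> range pmf_vec" by blast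
  qed (auto simp: pmf_vec_def sum_pmf_UNIV)
  moreover have "closed ?S"
    by (intro closed_Collect_conj closed_Collect_all closed_Collect_le closed_Collect_eq continuous_intros)
  moreover have "bounded ?S"
    unfolding bounded_iff
  proof (intro exI ballI)
    fix A assume A: "A \<in> ?S"
    have "norm A \<le> (\<Sum>x\<in>UNIV. \<bar>A $ x\<bar>)" by (rule norm_le_l1_cart)
    with A show "norm A \<le> 1" by simp
  qed
  ultimately show ?thesis by (simp add: compact_eq_bounded_closed)
qed

lemma compact_range_kernel_vec:
  "compact (range (kernel_vec :: ('y::finite \<Rightarrow> 'xh::finite pmf) \<Rightarrow> real ^ ('y \<times> 'xh)))"
proof -
  let ?S = "{C :: real ^ ('y \<times> 'xh). (\<forall>v. 0 \<le> C $ v) \<and> (\<forall>y. (\<Sum>xh\<in>UNIV. C $ (y, xh)) = 1)}"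
  have "range kernel_vec = ?S"
  proof (intro equalityI subsetI)
    fix C assume C: "C \<in> ?S"
    have "\<exists>p. \<forall>xh. pmf p xh = C $ (y, xh)" for y
      by (rule pmf_with_weights[of UNIV "\<lambda>xh. C $ (y, xh)"]) (use C in auto)
    then obtain \<kappa> where "\<And>y xh. pmf (\<kappa> y) xh = C $ (y, xh)" by metis
    then have "C = kernel_vec \<kappa>" by (simp add: kernel_vec_def vec_eq_iff)
    then show "C \<in> range kernel_vec" by blast
  qed (auto simp: kernel_vec_def sum_pmf_UNIV)
  moreover have "closed ?S"
    by (intro closed_Collect_conj closed_Collect_all closed_Collect_le closed_Collect_eq continuous_intros)
  moreover have "bounded ?S"
    unfolding bounded_iff
  proof (intro exI ballI)
    fix C assume C: "C \<in> ?S"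
    have "norm C \<le> (\<Sum>v\<in>UNIV \<times> UNIV. \<bar>C $ v\<bar>)" using norm_le_l1_cart[of C] by simp
    also have "\<dots> = (\<Sum>y\<in>UNIV. \<Sum>xh\<in>UNIV. C $ (y, xh))"
    proof -
      have "0 \<le> C $ v" for v using C by (cases v) simp
      then show ?thesis unfolding sum.cartesian_product by (simp add: case_prod_unfold)
    qed
    also have "\<dots> = real CARD('y)" using C by simp
    finally show "norm C \<le> real CARD('y)" .
  qed
  ultimately show ?thesis by (simp add: compact_eq_bounded_closed)
qed

text \<open>The mean of \<open>h\<close> under the letter law for a fixed u, where \<open>A\<close>
  is the law of X and \<open>C\<close> the decoder kernel. It is bilinear in them, hence
  continuous.\<close>

definition letter_form ::
  "('x::finite \<times> 'y::finite \<times> 'z::finite) pmf \<Rightarrow> ('x \<times> 'y \<times> 'z \<times> 'xh::finite \<Rightarrow> real) \<Rightarrow>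
   real ^ 'x \<Rightarrow> real ^ ('y \<times> 'xh) \<Rightarrow> real" where
  "letter_form P h A C =
     (\<Sum>(x, y, z, xh)\<in>UNIV. A $ x * pmf (cond_kernel P x) (y, z) * C $ (y, xh) * h (x, y, z, xh))"

lemma continuous_on_letter_form:
  "continuous_on S (\<lambda>v. letter_form P h (fst v) (snd v))"
  unfolding letter_form_def case_prod_unfold by (intro continuous_intros)

text \<open>Since \<open>h\<close> does not see u, and given u the other variables are governed by
  \<open>a u\<close> and \<open>\<kappa> u\<close>, averaging over u is a convex
  combination.\<close>

lemma expectation_letter_mixture:
  fixes P :: "('x::finite \<times> 'y::finite \<times> 'z::finite) pmf" and \<kappa> :: "'u \<Rightarrow> 'y \<Rightarrow> 'xh::finite pmf"
  assumes "finite A" "set_pmf \<mu> \<subseteq> A"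
  shows "measure_pmf.expectation
      (letter_joint P (bind_pmf \<mu> (\<lambda>u. map_pmf (Pair u) (a u))) \<kappa>) (\<lambda>(u, v). h v) =
    (\<Sum>u\<in>A. pmf \<mu> u * letter_form P h (pmf_vec (a u)) (kernel_vec (\<kappa> u)))"
proof -
  let ?T = "letter_joint P (bind_pmf \<mu> (\<lambda>u. map_pmf (Pair u) (a u))) \<kappa>"
  have "measure_pmf.expectation ?T (\<lambda>(u, v). h v) = (\<Sum>t\<in>A \<times> UNIV. pmf ?T t *\<^sub>R (case t of (u, v) \<Rightarrow> h v))"
    by (rule integral_measure_pmf) (use assms in \<open>auto simp: letter_joint_def\<close>)
  also have "\<dots> = (\<Sum>u\<in>A. \<Sum>v\<in>UNIV. pmf ?T (u, v) * h v)"
    by (simp add: sum.cartesian_product case_prod_unfold)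
  also have "\<dots> = (\<Sum>u\<in>A. pmf \<mu> u * letter_form P h (pmf_vec (a u)) (kernel_vec (\<kappa> u)))"
  proof (intro sum.cong refl)
    fix u
    have "pmf ?T (u, v) * h v = pmf \<mu> u * (case v of (x, y, z, xh) \<Rightarrow> pmf_vec (a u) $ x *
        pmf (cond_kernel P x) (y, z) * kernel_vec (\<kappa> u) $ (y, xh) * h (x, y, z, xh))" for v
      by (cases v) (simp add: pmf_letter_joint pmf_dependent_pair pmf_vec_def kernel_vec_def)
    then show "(\<Sum>v\<in>UNIV. pmf ?T (u, v) * h v) =
        pmf \<mu> u * letter_form P h (pmf_vec (a u)) (kernel_vec (\<kappa> u))"
      by (simp add: letter_form_def sum_distrib_left)
  qed
  finally show ?thesis .
qed

text \<open>Coordinates: the law of \<open>X\<close>, its entropy, the expected distortion and the law of \<open>(Z, Xh)\<close>.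
  Averaging over \<open>U\<close> becomes a convex combination of such points.\<close>

definition letter_point ::
  "real \<Rightarrow> ('x::finite \<times> 'y::finite \<times> 'z::finite) pmf \<Rightarrow> ('x \<Rightarrow> 'y \<Rightarrow> 'f) \<Rightarrow> ('f \<Rightarrow> 'xh::finite \<Rightarrow> real) \<Rightarrow>
   (real ^ 'x) \<times> (real ^ ('y \<times> 'xh)) \<Rightarrow> (real ^ 'x) \<times> real \<times> real \<times> (real ^ ('z \<times> 'xh))" where
  "letter_point b P F d v =
     (fst v, (\<Sum>x\<in>UNIV. entropy_term b (fst v $ x)),
      letter_form P (\<lambda>(x, y, z, xh). d (F x y) xh) (fst v) (snd v),
      (\<chi> m. letter_form P (\<lambda>(x, y, z, xh). of_bool ((z, xh) = m)) (fst v) (snd v)))"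

text \<open>All averages over an auxiliary variable with a finite alphabet of any size, so one set
  serves all block lengths.\<close>

definition letter_hull where
  "letter_hull b P F d = convex hull (letter_point b P F d ` (range pmf_vec \<times> range kernel_vec))"

text \<open>A continuous image of a compact set is compact and, in finite dimension, so is its
  convex hull.\<close>

lemma compact_letter_hull:
  fixes P :: "('x::finite \<times> 'y::finite \<times> 'z::finite) pmf" and d :: "'f \<Rightarrow> 'xh::finite \<Rightarrow> real"
  shows "compact (letter_hull b P F d)"
  unfolding letter_hull_def
proof (intro compact_convex_hull compact_continuous_image compact_Times
    compact_range_pmf_vec compact_range_kernel_vec)
  let ?S = "range pmf_vec \<times> range kernel_vec :: ((real ^ 'x) \<times> (real ^ ('y \<times> 'xh))) set"
  have "continuous_on ?S (\<lambda>v. entropy_term b (fst v $ x))" for x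
    by (rule continuous_on_compose2[OF continuous_on_entropy_term])
      (auto intro!: continuous_intros simp: pmf_vec_def)
  moreover have "continuous_on ?S (\<lambda>v. \<chi> m. letter_form P (h m) (fst v) (snd v))" for h
    by (rule continuous_on_vec_lambda) (rule continuous_on_letter_form)
  ultimately show "continuous_on ?S (letter_point b P F d)"
    unfolding letter_point_def by (intro continuous_intros continuous_on_letter_form)
qed

text \<open>The same coordinates read off a joint law; the second is H(X|U).\<close>

definition mixture_point where
  "mixture_point b P F d \<mu> a \<kappa> =
    (let T = letter_joint P (bind_pmf \<mu> (\<lambda>u. map_pmf (Pair u) (a u))) \<kappa>
     in (pmf_vec (map_pmf (\<lambda>(u, x, _). x) T),
         measure_pmf.expectation \<mu> (\<lambda>u. \<Sum>x\<in>UNIV. entropy_term b (pmf (a u) x)),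
         measure_pmf.expectation T (\<lambda>(u, x, y, z, xh). d (F x y) xh),
         pmf_vec (map_pmf (\<lambda>(u, x, y, z, xh). (z, xh)) T)))"

lemma pmf_map_eq_expectation: "pmf (map_pmf g p) m = measure_pmf.expectation p (\<lambda>a. of_bool (g a = m))"
proof -
  have "(\<lambda>a. of_bool (g a = m)) = (indicator (g -` {m}) :: _ \<Rightarrow> real)" by (auto simp: fun_eq_iff)
  then show ?thesis by (simp add: pmf_map)
qed

text \<open>The index set may exceed the support, so convex combinations with vanishing weights are
  covered.\<close>

lemma mixture_point_eq_sum:
  fixes P :: "('x::finite \<times> 'y::finite \<times> 'z::finite) pmf" and \<kappa> :: "'u \<Rightarrow> 'y \<Rightarrow> 'xh::finite pmf"
  assumes A: "finite A" "set_pmf \<mu> \<subseteq> A"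
  shows "mixture_point b P F d \<mu> a \<kappa> =
    (\<Sum>u\<in>A. pmf \<mu> u *\<^sub>R letter_point b P F d (pmf_vec (a u), kernel_vec (\<kappa> u)))"
proof -
  let ?T = "letter_joint P (bind_pmf \<mu> (\<lambda>u. map_pmf (Pair u) (a u))) \<kappa>"
  note E = expectation_letter_mixture[OF A, of P a \<kappa>]
  have "map_pmf (\<lambda>(u, x, _). x) ?T = map_pmf snd (map_pmf (\<lambda>(u, x, _). (u, x)) ?T)"
    by (simp add: pmf.map_comp o_def case_prod_unfold)
  also have "\<dots> = bind_pmf \<mu> a"
    unfolding map_fst_letter_joint by (simp add: map_bind_pmf pmf.map_comp o_def)
  finally have "pmf_vec (map_pmf (\<lambda>(u, x, _). x) ?T) = (\<Sum>u\<in>A. pmf \<mu> u *\<^sub>R pmf_vec (a u))"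
    using A by (simp add: pmf_vec_def vec_eq_iff pmf_bind integral_measure_pmf[of A] subset_iff)
  moreover have "measure_pmf.expectation \<mu> (\<lambda>u. \<Sum>x\<in>UNIV. entropy_term b (pmf (a u) x)) =
      (\<Sum>u\<in>A. pmf \<mu> u *\<^sub>R (\<Sum>x\<in>UNIV. entropy_term b (pmf (a u) x)))"
    using A by (intro integral_measure_pmf) auto
  moreover have "pmf_vec (map_pmf (\<lambda>(u, x, y, z, xh). (z, xh)) ?T) =
      (\<Sum>u\<in>A. pmf \<mu> u *\<^sub>R (\<chi> m. letter_form P (\<lambda>(x, y, z, xh). of_bool ((z, xh) = m)) (pmf_vec (a u)) (kernel_vec (\<kappa> u))))"
  proof -
    have "pmf (map_pmf (\<lambda>(u, x, y, z, xh). (z, xh)) ?T) m =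
       measure_pmf.expectation ?T (\<lambda>(u, v). (\<lambda>(x, y, z, xh). of_bool ((z, xh) = m)) v)" for m
      by (simp add: pmf_map_eq_expectation case_prod_unfold)
    then show ?thesis unfolding E by (simp add: vec_eq_iff pmf_vec_def[of "map_pmf _ _"])
  qed
  moreover have "measure_pmf.expectation ?T (\<lambda>(u, x, y, z, xh). d (F x y) xh) =
      (\<Sum>u\<in>A. pmf \<mu> u *\<^sub>R letter_form P (\<lambda>(x, y, z, xh). d (F x y) xh) (pmf_vec (a u)) (kernel_vec (\<kappa> u)))"
    using E[of "\<lambda>(x, y, z, xh). d (F x y) xh"] by simp
  ultimately show ?thesis
    unfolding mixture_point_def Let_def letter_point_def
    by (simp add: prod_eq_iff fst_sum snd_sum pmf_vec_def[of "a _"])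
qed

lemma mixture_point_in_letter_hull:
  fixes P :: "('x::finite \<times> 'y::finite \<times> 'z::finite) pmf" and \<kappa> :: "'u \<Rightarrow> 'y \<Rightarrow> 'xh::finite pmf"
  assumes "finite (set_pmf \<mu>)"
  shows "mixture_point b P F d \<mu> a \<kappa> \<in> letter_hull b P F d"
  unfolding mixture_point_eq_sum[OF assms order_refl] letter_hull_def
  by (rule convex_sum[OF assms convex_convex_hull])
     (auto simp: sum_pmf_eq_1[OF assms] intro!: hull_inc)

text \<open>The indices of a finite convex combination become the values of U; this brings auxiliary
  variables of any type back to natural numbers.\<close>

lemma letter_hull_mixture:
  fixes P :: "('x::finite \<times> 'y::finite \<times> 'z::finite) pmf" and d :: "'f \<Rightarrow> 'xh::finite \<Rightarrow> real"
  assumes "v \<in> letter_hull b P F d"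
  obtains \<mu> :: "nat pmf" and a \<kappa> where "finite (set_pmf \<mu>)" "v = mixture_point b P F d \<mu> a \<kappa>"
proof -
  obtain k w p where w: "\<And>i. i \<in> {1..k::nat} \<Longrightarrow> 0 \<le> w i"
      "\<And>i. i \<in> {1..k} \<Longrightarrow> p i \<in> letter_point b P F d ` (range pmf_vec \<times> range kernel_vec)"
      "sum w {1..k} = 1" "v = (\<Sum>i = 1..k. w i *\<^sub>R p i)"
    using assms unfolding letter_hull_def convex_hull_indexed by blast
  have "\<exists>a \<kappa>. p i = letter_point b P F d (pmf_vec a, kernel_vec \<kappa>)" if "i \<in> {1..k}" for i
    using w(2)[OF that] by blast
  then obtain a \<kappa> where p: "\<And>i. i \<in> {1..k} \<Longrightarrow> p i = letter_point b P F d (pmf_vec (a i), kernel_vec (\<kappa> i))"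
    by metis
  obtain \<mu> where \<mu>: "\<And>i. pmf \<mu> i = (if i \<in> {1..k} then w i else 0)"
  proof (rule pmf_with_weights[of "{1..k}" "\<lambda>i. if i \<in> {1..k} then w i else 0"])
    show "(\<Sum>i = 1..k. if i \<in> {1..k} then w i else 0) = 1"
      using w(3) by (simp cong: sum.cong_simp)
  qed (use w(1) in auto)
  have sub: "set_pmf \<mu> \<subseteq> {1..k}" by (auto simp: set_pmf_eq \<mu> split: if_splits)
  have "v = mixture_point b P F d \<mu> a \<kappa>"
    unfolding mixture_point_eq_sum[OF finite_atLeastAtMost sub] w(4)
    by (rule sum.cong) (simp_all add: p \<mu>)
  then show thesis using sub by (intro that[of \<mu> a \<kappa>]) (auto intro: finite_subset)
qed

text \<open>H(Z, Xh) - H(Z), which is H(Xh|Z) in a form that stays continuous where masses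
  vanish.\<close>

definition side_entropy :: "real \<Rightarrow> real ^ ('z::finite \<times> 'xh::finite) \<Rightarrow> real" where
  "side_entropy b m = (\<Sum>v\<in>UNIV. entropy_term b (m $ v)) -
     (\<Sum>z\<in>UNIV. entropy_term b (\<Sum>xh\<in>UNIV. m $ (z, xh)))"

lemma continuous_on_side_entropy: "continuous_on {m. \<forall>v. 0 \<le> m $ v} (side_entropy b)"
  unfolding side_entropy_def
  by (intro continuous_intros continuous_on_compose2[OF continuous_on_entropy_term])
     (auto intro: sum_nonneg)

section \<open>Information measures in terms of hull coordinates\<close>

lemma pmf_map_fst_sum:
  fixes M :: "('z::finite \<times> 'xh::finite) pmf"
  shows "pmf (map_pmf fst M) z = (\<Sum>xh\<in>UNIV. pmf M (z, xh))"
proof -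
  have "(\<Sum>xh\<in>UNIV. pmf M (z, xh)) = (\<Sum>xh\<in>UNIV. pmf (map_pmf fst M) z * pmf (cond_kernel M z) xh)"
    by (simp add: pmf_cond_kernel)
  then show ?thesis by (simp add: sum_distrib_left[symmetric] sum_pmf_UNIV)
qed

lemma cond_entropy_pmf_side_entropy:
  fixes X :: "'a \<Rightarrow> 'xh::finite" and Z :: "'a \<Rightarrow> 'z::finite"
  assumes b: "1 < b" and fin: "finite (set_pmf p)"
  shows "cond_entropy_pmf b p X Z = side_entropy b (pmf_vec (map_pmf (\<lambda>a. (Z a, X a)) p))"
proof -
  let ?M = "map_pmf (\<lambda>a. (Z a, X a)) p"
  have "cond_entropy_pmf b p X Z = measure_pmf.expectation ?M (\<lambda>(z, x). - log b (pmf (cond_kernel ?M z) x))"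
    by (simp add: cond_entropy_pmf_kernel[OF b fin])
  also have "\<dots> = (\<Sum>v\<in>UNIV. pmf ?M v *\<^sub>R (case v of (z, x) \<Rightarrow> - log b (pmf (cond_kernel ?M z) x)))"
    by (rule integral_measure_pmf) auto
  also have "\<dots> = (\<Sum>v\<in>UNIV. entropy_term b (pmf ?M v) + pmf ?M v * log b (pmf (map_pmf fst ?M) (fst v)))"
  proof (rule sum.cong)
    fix v :: "'z \<times> 'xh"
    obtain z x where v: "v = (z, x)" by (cases v)
    show "pmf ?M v *\<^sub>R (case v of (z, x) \<Rightarrow> - log b (pmf (cond_kernel ?M z) x)) =
        entropy_term b (pmf ?M v) + pmf ?M v * log b (pmf (map_pmf fst ?M) (fst v))"
    proof (cases "pmf ?M (z, x) = 0")
      case False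
      note prod = pmf_cond_kernel[of ?M z x]
      from False have pos: "0 < pmf (map_pmf fst ?M) z" "0 < pmf (cond_kernel ?M z) x"
        unfolding prod[symmetric] by (simp_all add: less_le)
      have "log b (pmf ?M (z, x)) = log b (pmf (map_pmf fst ?M) z) + log b (pmf (cond_kernel ?M z) x)"
        unfolding prod[symmetric] by (rule log_mult_pos[OF pos])
      then show ?thesis unfolding v entropy_term_def by (simp add: algebra_simps)
    qed (simp add: v entropy_term_def)
  qed simp
  also have "\<dots> = (\<Sum>v\<in>UNIV. entropy_term b (pmf ?M v)) +
      (\<Sum>v\<in>UNIV. pmf ?M v * log b (pmf (map_pmf fst ?M) (fst v)))"
    by (rule sum.distrib)
  also have "(\<Sum>v\<in>UNIV. pmf ?M v * log b (pmf (map_pmf fst ?M) (fst v))) =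
      (\<Sum>z\<in>UNIV. \<Sum>x\<in>UNIV. pmf ?M (z, x) * log b (pmf (map_pmf fst ?M) z))"
    by (simp add: sum.cartesian_product case_prod_unfold)
  also have "\<dots> = - (\<Sum>z\<in>UNIV. entropy_term b (pmf (map_pmf fst ?M) z))"
    by (simp add: entropy_term_def pmf_map_fst_sum sum_distrib_right sum_negf del: pmf_map)
  finally show ?thesis
    by (simp only: side_entropy_def pmf_vec_def vec_lambda_beta pmf_map_fst_sum)
qed

text \<open>I(X;U) = H(X) - H(X|U): with the law of X fixed, the rate is affine in the second hull
  coordinate.\<close>

lemma mixture_information:
  fixes a :: "'u \<Rightarrow> 'x::finite pmf"
  assumes b: "1 < b" and fin: "finite (set_pmf \<mu>)" and marg: "bind_pmf \<mu> a = pX"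
  shows "measure_pmf.expectation (bind_pmf \<mu> (\<lambda>u. map_pmf (Pair u) (a u))) (\<lambda>(u, x). log b (pmf (a u) x / pmf pX x)) =
    (\<Sum>x\<in>UNIV. entropy_term b (pmf pX x)) -
      measure_pmf.expectation \<mu> (\<lambda>u. \<Sum>x\<in>UNIV. entropy_term b (pmf (a u) x))"
proof -
  let ?J = "bind_pmf \<mu> (\<lambda>u. map_pmf (Pair u) (a u))"
  have finJ: "finite (set_pmf ?J)" using fin by auto
  have snd: "map_pmf snd ?J = pX" by (simp add: map_bind_pmf pmf.map_comp o_def marg)
  have int [simp]: "integrable (measure_pmf ?J) g" for g :: "_ \<Rightarrow> real"
    by (rule integrable_measure_pmf_finite[OF finJ])
  have E: "measure_pmf.expectation p (\<lambda>x. log b (pmf p x)) = - (\<Sum>x\<in>UNIV. entropy_term b (pmf p x))"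
    for p :: "'x pmf"
    by (subst integral_measure_pmf[of UNIV]) (auto simp: entropy_term_def sum_negf)
  have "measure_pmf.expectation ?J (\<lambda>(u, x). log b (pmf (a u) x / pmf pX x)) =
      measure_pmf.expectation ?J (\<lambda>(u, x). log b (pmf (a u) x) - log b (pmf pX x))"
  proof (rule expectation_cong_pmf)
    fix ux assume ux: "ux \<in> set_pmf ?J"
    then have "snd ux \<in> set_pmf pX" unfolding snd[symmetric] by (simp add: rev_image_eqI)
    moreover have "snd ux \<in> set_pmf (a (fst ux))" using ux by auto
    ultimately show "(case ux of (u, x) \<Rightarrow> log b (pmf (a u) x / pmf pX x)) =
        (case ux of (u, x) \<Rightarrow> log b (pmf (a u) x) - log b (pmf pX x))"
      by (simp add: case_prod_unfold log_divide_pos pmf_positive)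
  qed
  also have "\<dots> = measure_pmf.expectation ?J (\<lambda>(u, x). log b (pmf (a u) x)) -
      measure_pmf.expectation (map_pmf snd ?J) (\<lambda>x. log b (pmf pX x))"
    by (simp add: case_prod_unfold)
  also have "measure_pmf.expectation ?J (\<lambda>(u, x). log b (pmf (a u) x)) =
      measure_pmf.expectation \<mu> (\<lambda>u. measure_pmf.expectation (a u) (\<lambda>x. log b (pmf (a u) x)))"
    by (simp add: expectation_bind_finite fin)
  finally show ?thesis unfolding snd E by simp
qed

lemma mutual_info_mixture:
  fixes a :: "'u::countable \<Rightarrow> 'x::finite pmf"
  assumes b: "1 < b" and fin: "finite (set_pmf p)"
    and J: "map_pmf (\<lambda>w. (U w, X w)) p = bind_pmf \<mu> (\<lambda>u. map_pmf (Pair u) (a u))"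
  shows "mutual_info_pmf b p X U =
    measure_pmf.expectation (bind_pmf \<mu> (\<lambda>u. map_pmf (Pair u) (a u))) (\<lambda>(u, x). log b (pmf (a u) x / pmf (bind_pmf \<mu> a) x))"
proof -
  let ?J = "bind_pmf \<mu> (\<lambda>u. map_pmf (Pair u) (a u))"
  have "map_pmf X p = map_pmf snd ?J" "map_pmf U p = map_pmf fst ?J"
    unfolding J[symmetric] by (simp_all add: pmf.map_comp o_def)
  then have X: "map_pmf X p = bind_pmf \<mu> a" and U: "map_pmf U p = \<mu>"
    by (simp_all add: map_bind_pmf pmf.map_comp o_def map_pmf_const bind_return_pmf')
  have XU: "pmf (map_pmf (\<lambda>w. (X w, U w)) p) (x, u) = pmf \<mu> u * pmf (a u) x" for x u
  proof -
    have "map_pmf (\<lambda>w. (X w, U w)) p = map_pmf prod.swap ?J"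
      unfolding J[symmetric] by (simp add: pmf.map_comp o_def)
    then show ?thesis by (simp add: pmf_map_inj_eq[of prod.swap "(u, x)"] pmf_dependent_pair)
  qed
  have "mutual_info_pmf b p X U = measure_pmf.expectation p (\<lambda>w. log b (pmf (a (U w)) (X w) / pmf (bind_pmf \<mu> a) (X w)))"
    unfolding mutual_info_pmf_expectation[OF b fin] XU X U
  proof (rule expectation_cong_pmf)
    fix w assume "w \<in> set_pmf p"
    then have "U w \<in> set_pmf \<mu>" unfolding U[symmetric] by simp
    then have "pmf \<mu> (U w) \<noteq> 0" by (simp add: pmf_eq_0_set_pmf)
    then show "log b (pmf \<mu> (U w) * pmf (a (U w)) (X w) / (pmf (bind_pmf \<mu> a) (X w) * pmf \<mu> (U w))) =
      log b (pmf (a (U w)) (X w) / pmf (bind_pmf \<mu> a) (X w))" by simp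
  qed
  then show ?thesis unfolding J[symmetric] by simp
qed

text \<open>Injective relabelling changes no mass. Applied to the map from z to (0, z), it removes a
  constant T from the conditioning.\<close>

lemma cond_entropy_pmf_inj:
  fixes X :: "'a \<Rightarrow> 'b::countable" and Y :: "'a \<Rightarrow> 'c::countable" and g :: "'c \<Rightarrow> 'e::countable"
  assumes b: "1 < b" and fin: "finite (set_pmf p)" and g: "inj g"
  shows "cond_entropy_pmf b p X (\<lambda>a. g (Y a)) = cond_entropy_pmf b p X Y"
proof -
  have "pmf (map_pmf (\<lambda>a. (X a, g (Y a))) p) (X a, g (Y a)) = pmf (map_pmf (\<lambda>a. (X a, Y a)) p) (X a, Y a)" for a
  proof -
    have "map_pmf (\<lambda>a. (X a, g (Y a))) p = map_pmf (map_prod id g) (map_pmf (\<lambda>a. (X a, Y a)) p)"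
      by (simp add: pmf.map_comp o_def)
    then show ?thesis by (simp only:) (rule pmf_map_inj_eq, auto simp: g prod.inj_map)
  qed
  moreover have "pmf (map_pmf (\<lambda>a. g (Y a)) p) (g (Y a)) = pmf (map_pmf Y p) (Y a)" for a
  proof -
    have "map_pmf (\<lambda>a. g (Y a)) p = map_pmf g (map_pmf Y p)" by (simp add: pmf.map_comp o_def)
    then show ?thesis by (simp only:) (rule pmf_map_inj_eq, auto simp: g)
  qed
  ultimately show ?thesis by (simp add: cond_entropy_pmf_expectation[OF b fin])
qed

lemma cond_entropy_pmf_const:
  fixes X :: "'a \<Rightarrow> 'b::countable" and Y :: "'a \<Rightarrow> 'c::countable"
  assumes b: "1 < b" and fin: "finite (set_pmf p)" and X: "\<And>a. X a = x"
  shows "cond_entropy_pmf b p X Y = 0"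
proof -
  have "pmf (map_pmf (\<lambda>a. (X a, Y a)) p) (X a, Y a) = pmf (map_pmf Y p) (Y a)" for a
  proof -
    have "map_pmf (\<lambda>a. (X a, Y a)) p = map_pmf (Pair x) (map_pmf Y p)" by (simp add: pmf.map_comp o_def X)
    then show ?thesis by (simp only: X) (rule pmf_map_inj_eq, auto simp: inj_def)
  qed
  then have "cond_entropy_pmf b p X Y = measure_pmf.expectation p (\<lambda>a. 0)"
    unfolding cond_entropy_pmf_expectation[OF b fin]
    by (intro expectation_cong_pmf) (auto simp: pmf_eq_0_set_pmf)
  then show ?thesis by simp
qed

text \<open>A constant \<open>T\<close> is the best choice in the outer region, since conditioning on \<open>T\<close> only lowers the
  equivocation; hence every mixture yields a point of the region.\<close>

lemma mixture_in_region_out: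
  fixes P :: "('x::finite \<times> 'y::finite \<times> 'z::finite) pmf" and \<kappa> :: "nat \<Rightarrow> 'y \<Rightarrow> 'xh::finite pmf"
  assumes b: "1 < b" and fin: "finite (set_pmf \<mu>)" and v: "mixture_point b P F d \<mu> a \<kappa> = (pmf_vec (map_pmf fst P), e, D', m)"
    and nonneg: "0 \<le> R" "0 \<le> D" "0 \<le> \<Delta>"
    and R: "(\<Sum>x\<in>UNIV. entropy_term b (pmf (map_pmf fst P) x)) - e \<le> R"
    and D: "D' \<le> D" and \<Delta>: "\<Delta> \<le> side_entropy b m"
  shows "(R, D, \<Delta>) \<in> region_out b P F d"
proof -
  define J where "J = bind_pmf \<mu> (\<lambda>u. map_pmf (Pair u) (a u))"
  define T where "T = letter_joint P J \<kappa>"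
  \<comment> \<open>The mixture gives X from U whereas the region asks for U from X: Bayes inversion
    of \<open>J\<close>.\<close>
  define PU where "PU = cond_kernel (map_pmf prod.swap J)"
  define PT :: "nat \<Rightarrow> nat pmf" where "PT u = return_pmf 0" for u
  let ?O = "joint_out P PU PT \<kappa>"
  have finJ: "finite (set_pmf J)" using fin by (auto simp: J_def)
  have finT: "finite (set_pmf T)" unfolding T_def by (rule finite_set_letter_joint[OF finJ])
  have TJ: "map_pmf (\<lambda>(u, x, _). (u, x)) T = J" unfolding T_def by (rule map_fst_letter_joint)
  have snd: "map_pmf snd J = bind_pmf \<mu> a" by (simp add: J_def map_bind_pmf pmf.map_comp o_def)
  have "map_pmf (\<lambda>(u, x, _). x) T = map_pmf snd (map_pmf (\<lambda>(u, x, _). (u, x)) T)"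
    by (simp add: pmf.map_comp o_def case_prod_unfold)
  then have "pmf_vec (bind_pmf \<mu> a) = pmf_vec (map_pmf fst P)"
    using v by (simp add: mixture_point_def Let_def J_def[symmetric] T_def[symmetric] TJ snd)
  then have marg: "bind_pmf \<mu> a = map_pmf fst P"
    by (auto simp: pmf_vec_def vec_eq_iff intro: pmf_eqI)
  have e: "e = measure_pmf.expectation \<mu> (\<lambda>u. \<Sum>x\<in>UNIV. entropy_term b (pmf (a u) x))"
    and D': "D' = measure_pmf.expectation T (\<lambda>(u, x, y, z, xh). d (F x y) xh)"
    and m: "m = pmf_vec (map_pmf (\<lambda>(u, x, y, z, xh). (z, xh)) T)"
    using v by (simp_all add: mixture_point_def Let_def J_def T_def)
  have "map_pmf fst P = map_pmf fst (map_pmf prod.swap J)"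
    by (simp add: pmf.map_comp o_def snd[unfolded marg, symmetric])
  then have swap: "map_pmf prod.swap (bind_pmf (map_pmf fst P) (\<lambda>x. map_pmf (Pair x) (PU x))) = J"
    unfolding PU_def by (simp only: bind_cond_kernel) (simp add: pmf.map_comp o_def)
  have "?O = map_pmf (\<lambda>(x, y, z, u, xh). (x, y, z, u, 0, xh)) (joint_in P PU \<kappa>)"
    unfolding joint_out_def joint_in_def PT_def
    by (simp add: bind_return_pmf map_bind_pmf case_prod_unfold)
  also have "\<dots> = map_pmf (\<lambda>(u, x, y, z, xh). (x, y, z, u, 0, xh)) T"
    unfolding joint_in_eq swap T_def by (simp add: pmf.map_comp o_def case_prod_unfold)
  finally have O: "?O = map_pmf (\<lambda>(u, x, y, z, xh). (x, y, z, u, 0, xh)) T" .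
  have "cond_entropy_pmf b ?O (\<lambda>(x, y, z, u, t, xh). t) (\<lambda>(x, y, z, u, t, xh). u) = 0"
    unfolding O cond_entropy_pmf_map[OF b finT]
    by (rule cond_entropy_pmf_const[OF b finT, where x = 0]) (simp add: case_prod_unfold)
  moreover have "mutual_info_pmf b ?O (\<lambda>(x, y, z, u, t, xh). x) (\<lambda>(x, y, z, u, t, xh). u) \<le> R"
  proof -
    have "mutual_info_pmf b ?O (\<lambda>(x, y, z, u, t, xh). x) (\<lambda>(x, y, z, u, t, xh). u) =
        measure_pmf.expectation J (\<lambda>(u, x). log b (pmf (a u) x / pmf (bind_pmf \<mu> a) x))"
      unfolding J_def
    proof (rule mutual_info_mixture[OF b])
      show "map_pmf (\<lambda>w. ((\<lambda>(x, y, z, u, t, xh). u) w, (\<lambda>(x, y, z, u, t, xh). x) w)) ?O =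
          bind_pmf \<mu> (\<lambda>u. map_pmf (Pair u) (a u))"
        unfolding J_def[symmetric] TJ[symmetric] O by (simp add: pmf.map_comp o_def case_prod_unfold)
    qed (use finT in \<open>simp add: O\<close>)
    also have "\<dots> \<le> R"
      using R mixture_information[OF b fin marg] unfolding marg e J_def by simp
    finally show ?thesis .
  qed
  moreover have "measure_pmf.expectation ?O (\<lambda>(x, y, z, u, t, xh). d (F x y) xh) \<le> D"
    using D unfolding O D' by (simp add: case_prod_unfold)
  moreover have "\<Delta> \<le> cond_entropy_pmf b ?O (\<lambda>(x, y, z, u, t, xh). xh) (\<lambda>(x, y, z, u, t, xh). (t, z))"
  proof -
    have "cond_entropy_pmf b ?O (\<lambda>(x, y, z, u, t, xh). xh) (\<lambda>(x, y, z, u, t, xh). (t, z)) =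
        cond_entropy_pmf b T (\<lambda>(u, x, y, z, xh). xh) (\<lambda>w. (0::nat, (\<lambda>(u, x, y, z, xh). z) w))"
      unfolding O cond_entropy_pmf_map[OF b finT] by (simp add: case_prod_unfold)
    also have "\<dots> = cond_entropy_pmf b T (\<lambda>(u, x, y, z, xh). xh) (\<lambda>(u, x, y, z, xh). z)"
      by (rule cond_entropy_pmf_inj[OF b finT]) (simp add: inj_def)
    also have "\<dots> = side_entropy b m"
      unfolding cond_entropy_pmf_side_entropy[OF b finT] m by (simp add: case_prod_unfold)
    finally show ?thesis using \<Delta> by simp
  qed
  moreover have "finite (\<Union>x. set_pmf (PU x))"
    unfolding PU_def by (intro finite_UN_I finite_set_cond_kernel) (use finJ in auto)
  moreover have "\<forall>x. set_pmf (PU x) \<subseteq> (\<Union>x. set_pmf (PU x))" by blast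
  moreover have "finite {0::nat}" "\<forall>u\<in>(\<Union>x. set_pmf (PU x)). set_pmf (PT u) \<subseteq> {0}" by (auto simp: PT_def)
  ultimately show ?thesis
    using nonneg unfolding region_out_def mem_Collect_eq prod.case by blast
qed

text \<open>Disintegrated over its auxiliary variable, the time-sharing law is a mixture. Only its
  point in the hull is retained, so here the auxiliary variable may consist of tuples and
  lists.\<close>

lemma code_point_in_letter_hull:
  fixes P :: "('x::finite \<times> 'y::finite \<times> 'z::finite) pmf" and d :: "'f \<Rightarrow> 'xh::finite \<Rightarrow> real"
    and q :: "nat \<Rightarrow> nat \<Rightarrow> 'y list \<Rightarrow> 'xh list \<Rightarrow> 'xh pmf"
  assumes b: "1 < b" and n: "0 < n" and W: "finite W" "\<And>xs. length xs = n \<Longrightarrow> f xs \<in> W"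
  obtains e D m where "(pmf_vec (map_pmf fst P), e, D, m) \<in> letter_hull b P F d"
    "(\<Sum>x\<in>UNIV. entropy_term b (pmf (map_pmf fst P) x)) - e \<le> (1 / real n) * log b (real (card W))"
    "D = measure_pmf.expectation (code_joint P n f q) (\<lambda>(xs, ys, zs, w, xhs). avg_distortion F d n xs ys xhs)"
    "(1 / real n) * cond_entropy_pmf b (code_joint P n f q)
      (\<lambda>(xs, ys, zs, w, xhs). xhs) (\<lambda>(xs, ys, zs, w, xhs). (w, zs)) \<le> side_entropy b m"
proof -
  let ?J = "time_sharing_pmf P n f q" and ?\<kappa> = "time_sharing_kernel q"
  let ?T = "letter_joint P ?J ?\<kappa>"
  let ?a = "cond_kernel ?J"
  let ?\<mu> = "map_pmf fst ?J"
  have J: "bind_pmf ?\<mu> (\<lambda>u. map_pmf (Pair u) (?a u)) = ?J" by (rule bind_cond_kernel)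
  have finJ: "finite (set_pmf ?J)" by (rule finite_set_time_sharing_pmf[OF n])
  have finT: "finite (set_pmf ?T)" by (rule finite_set_letter_joint[OF finJ])
  have "bind_pmf ?\<mu> ?a = map_pmf snd (bind_pmf ?\<mu> (\<lambda>u. map_pmf (Pair u) (?a u)))"
    by (simp add: map_bind_pmf pmf.map_comp o_def)
  then have marg: "bind_pmf ?\<mu> ?a = map_pmf fst P" unfolding J by (simp add: map_snd_time_sharing_pmf n)
  define e where "e = measure_pmf.expectation ?\<mu> (\<lambda>u. \<Sum>x\<in>UNIV. entropy_term b (pmf (?a u) x))"
  define m where "m = pmf_vec (map_pmf (\<lambda>(u, x, y, z, xh). (z, xh)) ?T)"
  define D where "D = measure_pmf.expectation ?T (\<lambda>(u, x, y, z, xh). d (F x y) xh)"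
  have "map_pmf (\<lambda>(u, x, _). x) ?T = map_pmf snd (map_pmf (\<lambda>(u, x, _). (u, x)) ?T)"
    by (simp add: pmf.map_comp o_def case_prod_unfold)
  also have "\<dots> = map_pmf fst P" unfolding map_fst_letter_joint by (rule map_snd_time_sharing_pmf[OF n])
  finally have X: "map_pmf (\<lambda>(u, x, _). x) ?T = map_pmf fst P" .
  have "mixture_point b P F d ?\<mu> ?a ?\<kappa> = (pmf_vec (map_pmf fst P), e, D, m)"
    unfolding mixture_point_def J Let_def X e_def m_def D_def ..
  moreover have "mixture_point b P F d ?\<mu> ?a ?\<kappa> \<in> letter_hull b P F d"
    by (rule mixture_point_in_letter_hull) (simp add: finJ)
  ultimately have 1: "(pmf_vec (map_pmf fst P), e, D, m) \<in> letter_hull b P F d" by simp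
  have "(\<Sum>x\<in>UNIV. entropy_term b (pmf (map_pmf fst P) x)) - e =
      measure_pmf.expectation ?J (\<lambda>(u, x). log b (pmf (?a u) x / pmf (map_pmf fst P) x))"
    using mixture_information[OF b _ marg] finJ unfolding J e_def by simp
  also have "\<dots> \<le> (1 / real n) * log b (real (card W))"
    by (rule time_sharing_rate[OF b n W])
  finally have 2: "(\<Sum>x\<in>UNIV. entropy_term b (pmf (map_pmf fst P) x)) - e \<le> (1 / real n) * log b (real (card W))" .
  have 3: "D = measure_pmf.expectation (code_joint P n f q) (\<lambda>(xs, ys, zs, w, xhs). avg_distortion F d n xs ys xhs)"
    unfolding D_def expectation_time_sharing[OF n] expectation_avg_distortion
    by (simp add: letter_at_def case_prod_unfold)
  have "(1 / real n) * cond_entropy_pmf b (code_joint P n f q)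
      (\<lambda>(xs, ys, zs, w, xhs). xhs) (\<lambda>(xs, ys, zs, w, xhs). (w, zs)) \<le>
    cond_entropy_pmf b ?T (\<lambda>(u, x, y, z, xh). xh) (\<lambda>(u, x, y, z, xh). z)"
    unfolding cond_entropy_code_joint[OF b] by (rule time_sharing_equivocation[OF b n])
  also have "\<dots> = side_entropy b m"
    unfolding cond_entropy_pmf_side_entropy[OF b finT] m_def by (simp add: case_prod_unfold)
  finally show thesis by (rule that[OF 1 2 3])
qed

text \<open>Keeps hull points in the domain where \<open>side_entropy\<close> is continuous.\<close>

lemma letter_hull_nonneg:
  assumes "v \<in> letter_hull b P F d"
  shows "0 \<le> snd (snd (snd v)) $ i"
proof -
  obtain \<mu> :: "nat pmf" and a \<kappa> where "v = mixture_point b P F d \<mu> a \<kappa>"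
    by (rule letter_hull_mixture[OF assms])
  then show ?thesis by (simp add: mixture_point_def Let_def pmf_vec_def)
qed

text \<open>Codes yield points of a compact set that violate the constraints by at most any given
  \<delta>; the least violation is attained, hence at most 0.\<close>

lemma region_eve_subset_region_out:
  fixes P :: "('x::finite \<times> 'y::finite \<times> 'z::finite) pmf"
    and F :: "'x \<Rightarrow> 'y \<Rightarrow> 'f"
    and d :: "'f \<Rightarrow> 'xh::finite \<Rightarrow> real"
  assumes b: "1 < b"
  shows "region_eve b P F d \<subseteq> region_out b P F d"
proof safe
  fix R D \<Delta> assume "(R, D, \<Delta>) \<in> region_eve b P F d"
  then have nonneg: "0 \<le> R" "0 \<le> D" "0 \<le> \<Delta>" and ach: "achievable_eve b P F d R D \<Delta>"
    by (auto simp: region_eve_def)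
  let ?p = "pmf_vec (map_pmf fst P)"
  let ?H = "\<Sum>x\<in>UNIV. entropy_term b (pmf (map_pmf fst P) x)"
  \<comment> \<open>Fixing the law of X keeps the set compact and makes H(X) a constant in the rate
    constraint.\<close>
  define C where "C = letter_hull b P F d \<inter> {v. fst v = ?p}"
  \<comment> \<open>The largest violation of the three constraints: all of them hold exactly where
    it is at most 0.\<close>
  define G where "G v = max (?H - fst (snd v) - R)
    (max (fst (snd (snd v)) - D) (\<Delta> - side_entropy b (snd (snd (snd v)))))"
    for v :: "(real ^ 'x) \<times> real \<times> real \<times> (real ^ ('z \<times> 'xh))"
  have approx: "\<exists>v\<in>C. G v \<le> \<delta>" if \<delta>: "0 < \<delta>" for \<delta>
  proof -
    obtain n where n: "0 < n" and "\<exists>(W :: nat set) (f :: 'x list \<Rightarrow> nat)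
          (q :: nat \<Rightarrow> nat \<Rightarrow> 'y list \<Rightarrow> 'xh list \<Rightarrow> 'xh pmf).
          finite W \<and> (\<forall>xs. length xs = n \<longrightarrow> f xs \<in> W) \<and>
          (1 / real n) * log b (real (card W)) \<le> R + \<delta> \<and>
          measure_pmf.expectation (code_joint P n f q)
            (\<lambda>(xs, ys, zs, w, xhs). avg_distortion F d n xs ys xhs) \<le> D + \<delta> \<and>
          (1 / real n) * cond_entropy_pmf b (code_joint P n f q)
            (\<lambda>(xs, ys, zs, w, xhs). xhs) (\<lambda>(xs, ys, zs, w, xhs). (w, zs)) \<ge> \<Delta> - \<delta>"
      using eventually_happens'[OF sequentially_bot eventually_conj[OF eventually_gt_at_top[of 0]
        ach[unfolded achievable_eve_def, rule_format, OF \<delta>]]] by blast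
    then obtain W :: "nat set" and f :: "'x list \<Rightarrow> nat" and q :: "nat \<Rightarrow> nat \<Rightarrow> 'y list \<Rightarrow> 'xh list \<Rightarrow> 'xh pmf"
      where W: "finite W" "\<And>xs. length xs = n \<Longrightarrow> f xs \<in> W"
        and le: "(1 / real n) * log b (real (card W)) \<le> R + \<delta>"
          "measure_pmf.expectation (code_joint P n f q)
            (\<lambda>(xs, ys, zs, w, xhs). avg_distortion F d n xs ys xhs) \<le> D + \<delta>"
          "(1 / real n) * cond_entropy_pmf b (code_joint P n f q)
            (\<lambda>(xs, ys, zs, w, xhs). xhs) (\<lambda>(xs, ys, zs, w, xhs). (w, zs)) \<ge> \<Delta> - \<delta>"
      by blast
    obtain e D' m where v: "(?p, e, D', m) \<in> letter_hull b P F d"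
      and pt: "?H - e \<le> (1 / real n) * log b (real (card W))"
      "D' = measure_pmf.expectation (code_joint P n f q) (\<lambda>(xs, ys, zs, w, xhs). avg_distortion F d n xs ys xhs)"
      "(1 / real n) * cond_entropy_pmf b (code_joint P n f q)
        (\<lambda>(xs, ys, zs, w, xhs). xhs) (\<lambda>(xs, ys, zs, w, xhs). (w, zs)) \<le> side_entropy b m"
      by (rule code_point_in_letter_hull[OF b n W, where P = P and F = F and d = d and q = q])
    have "G (?p, e, D', m) \<le> \<delta>"
      using le pt by (simp add: G_def)
    then show ?thesis using v by (intro bexI[of _ "(?p, e, D', m)"]) (auto simp: C_def)
  qed
  have "compact C"
    unfolding C_def by (intro compact_Int_closed compact_letter_hull closed_Collect_eq continuous_intros)
  moreover have "C \<noteq> {}" using approx[of 1] by auto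
  moreover have "continuous_on C G"
    unfolding G_def
    by (intro continuous_intros continuous_on_compose2[OF continuous_on_side_entropy])
       (auto simp: C_def dest: letter_hull_nonneg)
  ultimately obtain v where v: "v \<in> C" and min: "\<And>v'. v' \<in> C \<Longrightarrow> G v \<le> G v'"
    using continuous_attains_inf[of C G] by blast
  have "G v \<le> 0"
  proof (rule field_le_epsilon)
    fix \<delta> :: real assume "0 < \<delta>"
    then obtain v' where "v' \<in> C" "G v' \<le> \<delta>" using approx by blast
    then show "G v \<le> 0 + \<delta>" using min[of v'] by simp
  qed
  moreover obtain e D' m where v_eq: "v = (?p, e, D', m)"
    using v by (cases v) (auto simp: C_def)
  ultimately have le: "?H - e \<le> R" "D' \<le> D" "\<Delta> \<le> side_entropy b m" by (auto simp: G_def)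
  obtain \<mu> :: "nat pmf" and a \<kappa> where fin: "finite (set_pmf \<mu>)" and mix: "v = mixture_point b P F d \<mu> a \<kappa>"
    using v letter_hull_mixture unfolding C_def by blast
  show "(R, D, \<Delta>) \<in> region_out b P F d"
    by (rule mixture_in_region_out[OF b fin mix[symmetric, unfolded v_eq] nonneg le])
qed

theorem proposition2:
  fixes P :: "('x::finite \<times> 'y::finite \<times> 'z::finite) pmf"
    and F :: "'x \<Rightarrow> 'y \<Rightarrow> 'f"
    and d :: "'f \<Rightarrow> 'xh::finite \<Rightarrow> real"
    and b :: real
  assumes "1 < b"
    and "\<And>v xh. 0 \<le> d v xh"
  shows "region_in b P F d \<subseteq> region_eve b P F d \<and> region_eve b P F d \<subseteq> region_out b P F d"
  using region_in_subset_region_eve[OF assms(1)] region_eve_subset_region_out[OF assms(1)] by blast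

end
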